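(* Let $d\ge 2$ and let $v$ be an even or odd solution of the Helmholtz equation $\Delta v+v=0$ on $\mathbb{R}^d$ (that is, $v(-x)=v(x)$ for all $x$, or $v(-x)=-v(x)$ for all $x$). Given any small $\varepsilon>0$, any integer $k\ge 0$, and any ball $B\subset\mathbb{R}^d$, there exist some $\kappa>0$ and an eigenfunction $\psi$ of the hyperbolic harmonic oscillator operator $H_\kappa^{\mathrm H}$ on $\mathbb{H}^d(\kappa)$ such that $$\big\|\psi\circ \exp_{p_0}^\kappa(\lambda^{-1/2}\,\cdot\,)-v\big\|_{C^k(B)}<\varepsilon .$$ Here $\lambda$ is the eigenvalue of $H_\kappa^{\mathrm H}$ corresponding to $\psi$, and $p_0\in\mathbb{H}^d(\kappa)$ is the point where the potential $V_\kappa^{\mathrm H}$ attains its global minimum.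
   Context: For $\kappa>0$, $\mathbb{H}^d(\kappa)$ is the $d$-dimensional hyperbolic space of constant sectional curvature $-\kappa^2$. Fix a point $p_0\in\mathbb{H}^d(\kappa)$ and let $\rho$ be the geodesic distance to $p_0$. In geodesic polar coordinates $(\rho,\omega)\in(0,\infty)\times\mathbb{S}^{d-1}$ the metric is $g_\kappa=d\rho^2+\frac{\sinh^2(\kappa\rho)}{\kappa^2}g_{\mathbb{S}^{d-1}}$. Let $\Delta_\kappa$ be the Laplace--Beltrami operator of $g_\kappa$ and set $r:=\sinh(\kappa\rho)/\kappa$. The harmonic oscillator potential on $\mathbb{H}^d(\kappa)$ is $$V_\kappa^{\mathrm H}:=\frac{r^2}{1+\kappa^2r^2},$$ whose global minimum is attained at $p_0$, and the harmonic oscillator operator is $$H_\kappa^{\mathrm H}:=-\Delta_\kappa+\alpha V_\kappa^{\mathrm H},$$ where $\alpha>0$ is a fixed constant (independent of $\kappa$). An eigenfunction of $H_\kappa^{\mathrm H}$ with eigenvalue $\lambda$ is a square-integrable function $\psi$ on $\mathbb{H}^d(\kappa)$ with $H_\kappa^{\mathrm H}\psi=\lambda\psi$. The map $\exp_{p_0}^\kappa$ is the Riemannian exponential map at $p_0$ of the metric $g_\kappa$, with the tangent space at $p_0$ identified isometrically with $\mathbb{R}^d$. $\Delta$ is the Euclidean Laplacian on $\mathbb{R}^d$. *)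

theory Defs
  imports "HOL-Analysis.Analysis"
begin

section \<open>Partial derivatives and the spaces \<open>C\<^sup>k\<close>\<close>

definition partial_deriv ::
    "'n::finite \<Rightarrow> (real ^ 'n \<Rightarrow> 'b::real_normed_vector) \<Rightarrow> real ^ 'n \<Rightarrow> 'b" where
  "partial_deriv i f x = frechet_derivative f (at x) (axis i 1)"

fun iterated_partial ::
    "'n::finite list \<Rightarrow> (real ^ 'n \<Rightarrow> 'b::real_normed_vector) \<Rightarrow> real ^ 'n \<Rightarrow> 'b" where
  "iterated_partial [] f = f"
| "iterated_partial (i # is) f = partial_deriv i (iterated_partial is f)"

text \<open>Meant for open \<open>S\<close>. Differentiability of the lower order derivatives is required
  explicitly because \<^const>\<open>frechet_derivative\<close> is a total function.\<close>

definition Ck_on ::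
    "nat \<Rightarrow> (real ^ 'n::finite) set \<Rightarrow> (real ^ 'n \<Rightarrow> 'b::real_normed_vector) \<Rightarrow> bool" where
  "Ck_on k S f \<longleftrightarrow>
     (\<forall>is. length is < k \<longrightarrow> (\<forall>x\<in>S. iterated_partial is f differentiable (at x))) \<and>
     (\<forall>is. length is \<le> k \<longrightarrow> continuous_on S (iterated_partial is f))"

text \<open>The supremum of all partial derivatives of order at most \<open>k\<close>; it is infinite if \<open>f\<close> is not
  \<open>C\<^sup>k\<close> on \<open>S\<close>.\<close>

definition Ck_norm ::
    "nat \<Rightarrow> (real ^ 'n::finite) set \<Rightarrow> (real ^ 'n \<Rightarrow> 'b::real_normed_vector) \<Rightarrow> ennreal" where
  "Ck_norm k S f =
     (if Ck_on k S f
      then SUP is\<in>{is. length is \<le> k}. SUP x\<in>S. ennreal (norm (iterated_partial is f x))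
      else \<infinity>)"

definition laplacian ::
    "(real ^ 'n::finite \<Rightarrow> 'b::real_normed_vector) \<Rightarrow> real ^ 'n \<Rightarrow> 'b" where
  "laplacian f x = (\<Sum>i\<in>UNIV. partial_deriv i (partial_deriv i f) x)"


section \<open>Riemannian metrics in a global chart\<close>

text \<open>A metric on a manifold with a global chart onto \<open>\<real>\<^sup>d\<close> is given by its matrix
  \<open>(g\<^sub>i\<^sub>j)\<close> as a function of the coordinates; tangent vectors are given by their components with
  respect to the coordinate vector fields.\<close>

type_synonym 'n metric = "real ^ 'n \<Rightarrow> real ^ 'n ^ 'n"

definition metric_inner ::
    "'n::finite metric \<Rightarrow> real ^ 'n \<Rightarrow> real ^ 'n \<Rightarrow> real ^ 'n \<Rightarrow> real" where
  "metric_inner G p u w = (\<Sum>i\<in>UNIV. \<Sum>j\<in>UNIV. G p $ i $ j * u $ i * w $ j)"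

definition riemannian_volume :: "'n::finite metric \<Rightarrow> (real ^ 'n) measure" where
  "riemannian_volume G = density lborel (\<lambda>x. ennreal (sqrt (det (G x))))"

definition laplace_beltrami ::
    "'n::finite metric \<Rightarrow> (real ^ 'n \<Rightarrow> 'b::real_normed_vector) \<Rightarrow> real ^ 'n \<Rightarrow> 'b" where
  "laplace_beltrami G f x =
     (1 / sqrt (det (G x))) *\<^sub>R
       (\<Sum>i\<in>UNIV. partial_deriv i
          (\<lambda>y. \<Sum>j\<in>UNIV. (sqrt (det (G y)) * matrix_inv (G y) $ i $ j) *\<^sub>R partial_deriv j f y) x)"

text \<open>Lengths are required to be finite: \<^const>\<open>valid_path\<close> (continuous and piecewise \<open>C\<^sup>1\<close>) permits
  an unbounded derivative near the break points.\<close>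

definition riemannian_dist :: "'n::finite metric \<Rightarrow> real ^ 'n \<Rightarrow> real ^ 'n \<Rightarrow> real" where
  "riemannian_dist G p q =
     Inf {L. \<exists>\<gamma>. valid_path \<gamma> \<and> pathstart \<gamma> = p \<and> pathfinish \<gamma> = q \<and>
            ((\<lambda>t. let u = vector_derivative \<gamma> (at t) in sqrt (metric_inner G (\<gamma> t) u u))
               has_integral L) {0..1}}"

definition christoffel :: "'n::finite metric \<Rightarrow> 'n \<Rightarrow> 'n \<Rightarrow> 'n \<Rightarrow> real ^ 'n \<Rightarrow> real" where
  "christoffel G k i j x =
     (\<Sum>l\<in>UNIV. matrix_inv (G x) $ k $ l *
        (partial_deriv i (\<lambda>y. G y $ j $ l) x + partial_deriv j (\<lambda>y. G y $ i $ l) x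
          - partial_deriv l (\<lambda>y. G y $ i $ j) x)) / 2"

definition geodesic_on ::
    "'n::finite metric \<Rightarrow> real set \<Rightarrow> (real \<Rightarrow> real ^ 'n) \<Rightarrow> (real \<Rightarrow> real ^ 'n) \<Rightarrow> bool" where
  "geodesic_on G T \<gamma> u \<longleftrightarrow>
     (\<forall>t\<in>T. (\<gamma> has_vector_derivative u t) (at t within T) \<and>
        (u has_vector_derivative
           (\<chi> k. - (\<Sum>i\<in>UNIV. \<Sum>j\<in>UNIV. christoffel G k i j (\<gamma> t) * u t $ i * u t $ j)))
          (at t within T))"

definition exp_map :: "'n::finite metric \<Rightarrow> real ^ 'n \<Rightarrow> real ^ 'n \<Rightarrow> real ^ 'n" where
  "exp_map G p w =
     (THE q. \<exists>\<gamma> u. geodesic_on G {0..1} \<gamma> u \<and> \<gamma> 0 = p \<and> u 0 = w \<and> \<gamma> 1 = q)"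

text \<open>An isometric identification of \<open>\<real>\<^sup>d\<close> with the tangent space at \<open>p\<close>.\<close>

definition tangent_isometry ::
    "'n::finite metric \<Rightarrow> real ^ 'n \<Rightarrow> (real ^ 'n \<Rightarrow> real ^ 'n) \<Rightarrow> bool" where
  "tangent_isometry G p J \<longleftrightarrow> linear J \<and> (\<forall>u w. metric_inner G p (J u) (J w) = u \<bullet> w)"


section \<open>Hyperbolic space of curvature \<open>-\<kappa>\<^sup>2\<close>\<close>

text \<open>The upper sheet \<open>{(x, t). t\<^sup>2 - \<bar>x\<bar>\<^sup>2 = 1 / \<kappa>\<^sup>2, t > 0}\<close> of the hyperboloid in Minkowski space,
  with the metric induced by the Minkowski form, in the global chart \<open>(x, t) \<mapsto> x\<close>.\<close>

definition minkowski :: "(real ^ 'n::finite) \<times> real \<Rightarrow> (real ^ 'n) \<times> real \<Rightarrow> real" where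
  "minkowski X Y = fst X \<bullet> fst Y - snd X * snd Y"

definition hyperboloid_point :: "real \<Rightarrow> real ^ 'n::finite \<Rightarrow> (real ^ 'n) \<times> real" where
  "hyperboloid_point \<kappa> x = (x, sqrt (1 / \<kappa>\<^sup>2 + x \<bullet> x))"

definition hyp_metric :: "real \<Rightarrow> 'n::finite metric" where
  "hyp_metric \<kappa> x =
     (\<chi> i j. minkowski (partial_deriv i (hyperboloid_point \<kappa>) x)
                       (partial_deriv j (hyperboloid_point \<kappa>) x))"

lemma frechet_derivative_hyperboloid_point:
  fixes x :: "real ^ 'n::finite"
  assumes "\<kappa> > 0"
  shows "frechet_derivative (hyperboloid_point \<kappa>) (at x) =
           (\<lambda>u. (u, (x \<bullet> u) / sqrt (1 / \<kappa>\<^sup>2 + x \<bullet> x)))"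
proof -
  have pos: "1 / \<kappa>\<^sup>2 + x \<bullet> x > 0"
    using assms by (simp add: add_pos_nonneg)
  have "(hyperboloid_point \<kappa> has_derivative
          (\<lambda>u. (u, (x \<bullet> u) / sqrt (1 / \<kappa>\<^sup>2 + x \<bullet> x)))) (at x)"
    unfolding hyperboloid_point_def
    by (rule has_derivative_eq_rhs, (rule derivative_intros pos)+)
       (auto simp: fun_eq_iff inner_commute divide_simps)
  then show ?thesis
    using frechet_derivative_at by metis
qed

lemma hyp_metric_component:
  fixes x :: "real ^ 'n::finite"
  assumes "\<kappa> > 0"
  shows "hyp_metric \<kappa> x $ i $ j =
           (if i = j then 1 else 0) - \<kappa>\<^sup>2 * x $ i * x $ j / (1 + \<kappa>\<^sup>2 * (x \<bullet> x))"
proof -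
  have pos: "1 / \<kappa>\<^sup>2 + x \<bullet> x > 0"
    using assms by (simp add: add_pos_nonneg)
  have "sqrt (1 / \<kappa>\<^sup>2 + x \<bullet> x) * sqrt (1 / \<kappa>\<^sup>2 + x \<bullet> x) = (1 + \<kappa>\<^sup>2 * (x \<bullet> x)) / \<kappa>\<^sup>2"
    using pos assms by (simp add: field_simps)
  moreover have "axis i 1 \<bullet> (axis j 1 :: real ^ 'n) = (if i = j then 1 else 0)"
    by (simp add: inner_axis_axis)
  ultimately show ?thesis
    using assms
    by (simp add: hyp_metric_def minkowski_def partial_deriv_def
        frechet_derivative_hyperboloid_point inner_axis mult.commute mult.left_commute)
qed

lemma metric_inner_hyp_metric:
  fixes x :: "real ^ 'n::finite"
  assumes "\<kappa> > 0"
  shows "metric_inner (hyp_metric \<kappa>) x u w =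
           u \<bullet> w - \<kappa>\<^sup>2 * (x \<bullet> u) * (x \<bullet> w) / (1 + \<kappa>\<^sup>2 * (x \<bullet> x))"
proof -
  define c where "c = \<kappa>\<^sup>2 / (1 + \<kappa>\<^sup>2 * (x \<bullet> x))"
  have "metric_inner (hyp_metric \<kappa>) x u w =
          (\<Sum>i\<in>UNIV. \<Sum>j\<in>UNIV. (if i = j then u $ i * w $ j else 0)
             - c * ((x $ i * u $ i) * (x $ j * w $ j)))"
    unfolding metric_inner_def hyp_metric_component[OF assms] c_def
    by (intro sum.cong refl) (auto simp: algebra_simps)
  also have "\<dots> = u \<bullet> w - c * ((x \<bullet> u) * (x \<bullet> w))"
    by (simp add: sum_subtractf inner_vec_def sum_product)
       (simp add: sum_distrib_left)
  finally show ?thesis by (simp add: c_def)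
qed

text \<open>Agreement with the expression \<open>d\<rho>\<^sup>2 + (sinh (\<kappa> \<rho>) / \<kappa>)\<^sup>2 g\<^bsub>S\<^esub>\<close> in geodesic polar coordinates
  around the vertex of the hyperboloid: the vectors below are the images of \<open>(a, \<sigma>)\<close> and \<open>(b, \<tau>)\<close>,
  where \<open>\<sigma>\<close> and \<open>\<tau>\<close> are tangent to the sphere at \<open>\<omega>\<close>, under the derivative of
  \<open>(\<rho>, \<omega>) \<mapsto> (sinh (\<kappa> \<rho>) / \<kappa>) \<omega>\<close>.\<close>

lemma hyp_metric_polar:
  fixes \<omega> \<sigma> \<tau> :: "real ^ 'n::finite"
  assumes "\<kappa> > 0" "\<omega> \<bullet> \<omega> = 1" "\<omega> \<bullet> \<sigma> = 0" "\<omega> \<bullet> \<tau> = 0"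
  shows "metric_inner (hyp_metric \<kappa>) ((sinh (\<kappa> * \<rho>) / \<kappa>) *\<^sub>R \<omega>)
           ((a * cosh (\<kappa> * \<rho>)) *\<^sub>R \<omega> + (sinh (\<kappa> * \<rho>) / \<kappa>) *\<^sub>R \<sigma>)
           ((b * cosh (\<kappa> * \<rho>)) *\<^sub>R \<omega> + (sinh (\<kappa> * \<rho>) / \<kappa>) *\<^sub>R \<tau>)
         = a * b + (sinh (\<kappa> * \<rho>) / \<kappa>)\<^sup>2 * (\<sigma> \<bullet> \<tau>)"
proof -
  let ?s = "sinh (\<kappa> * \<rho>)" and ?c = "cosh (\<kappa> * \<rho>)"
  have c: "?c\<^sup>2 = 1 + ?s\<^sup>2" by (simp add: cosh_square_eq)
  have cpos: "?c\<^sup>2 \<noteq> 0"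
    using cosh_real_pos[of "\<kappa> * \<rho>"] by simp
  have k: "1 + \<kappa>\<^sup>2 * (?s / \<kappa> * (?s / \<kappa>)) = ?c\<^sup>2"
    using assms(1) c by (simp add: power2_eq_square)
  have "\<sigma> \<bullet> \<omega> = 0"
    using assms(3) by (simp add: inner_commute)
  then have "metric_inner (hyp_metric \<kappa>) ((?s / \<kappa>) *\<^sub>R \<omega>)
           ((a * ?c) *\<^sub>R \<omega> + (?s / \<kappa>) *\<^sub>R \<sigma>) ((b * ?c) *\<^sub>R \<omega> + (?s / \<kappa>) *\<^sub>R \<tau>)
        = (a * ?c) * (b * ?c) + (?s / \<kappa>) * (?s / \<kappa>) * (\<sigma> \<bullet> \<tau>)
           - \<kappa>\<^sup>2 * (?s / \<kappa> * (a * ?c)) * (?s / \<kappa> * (b * ?c)) / ?c\<^sup>2"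
    unfolding metric_inner_hyp_metric[OF assms(1)] using assms(2-4)
    by (simp only: inner_add_left inner_add_right inner_scaleR_left inner_scaleR_right k
        mult_zero_right add_0_left add_0_right mult_1_right) (simp add: algebra_simps)
  also have "\<dots> = a * b * ?c\<^sup>2 + (?s / \<kappa>)\<^sup>2 * (\<sigma> \<bullet> \<tau>) - ?s\<^sup>2 * (a * b)"
    using cpos assms(1) by (simp add: power2_eq_square)
  also have "\<dots> = a * b + (?s / \<kappa>)\<^sup>2 * (\<sigma> \<bullet> \<tau>)"
    by (simp add: c algebra_simps)
  finally show ?thesis .
qed


section \<open>The hyperbolic harmonic oscillator\<close>

definition harmonic_potential :: "real \<Rightarrow> real ^ 'n::finite \<Rightarrow> real ^ 'n \<Rightarrow> real" where
  "harmonic_potential \<kappa> p\<^sub>0 x =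
     (let \<rho> = riemannian_dist (hyp_metric \<kappa>) p\<^sub>0 x; r = sinh (\<kappa> * \<rho>) / \<kappa>
      in r\<^sup>2 / (1 + \<kappa>\<^sup>2 * r\<^sup>2))"

definition harmonic_oscillator ::
    "real \<Rightarrow> real \<Rightarrow> real ^ 'n::finite \<Rightarrow> (real ^ 'n \<Rightarrow> 'b::real_normed_vector) \<Rightarrow> real ^ 'n \<Rightarrow> 'b" where
  "harmonic_oscillator \<alpha> \<kappa> p\<^sub>0 \<psi> x =
     - laplace_beltrami (hyp_metric \<kappa>) \<psi> x + (\<alpha> * harmonic_potential \<kappa> p\<^sub>0 x) *\<^sub>R \<psi> x"

text \<open>By elliptic regularity an \<open>L\<^sup>2\<close> solution is smooth, so smoothness is made part of the
  definition and the eigenvalue equation is pointwise.\<close>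

definition oscillator_eigenfunction ::
    "real \<Rightarrow> real \<Rightarrow> real ^ 'n::finite \<Rightarrow> real \<Rightarrow> (real ^ 'n \<Rightarrow> 'b::real_normed_vector) \<Rightarrow> bool" where
  "oscillator_eigenfunction \<alpha> \<kappa> p\<^sub>0 ev \<psi> \<longleftrightarrow>
     (\<exists>x. \<psi> x \<noteq> 0) \<and>
     (\<forall>k. Ck_on k UNIV \<psi>) \<and>
     integrable (riemannian_volume (hyp_metric \<kappa>)) (\<lambda>x. (norm (\<psi> x))\<^sup>2) \<and>
     (\<forall>x. harmonic_oscillator \<alpha> \<kappa> p\<^sub>0 \<psi> x = ev *\<^sub>R \<psi> x)"

end

theory Submission
  imports Defs
begin

text \<open>Write \<open>a = N\<^sup>2\<close> and let \<open>\<tau> = cosh (\<kappa> \<rho>)\<close>. If \<open>q\<^sub>j\<close> is the homogeneous part of degree \<open>j\<close> of the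
  Taylor series of a Helmholtz solution \<open>v\<close> at \<open>0\<close>, then \<open>\<Delta> q\<^bsub>j + 2\<^esub> = - q\<^sub>j\<close>, and in the ambient
  linear coordinates \<open>Y\<close> of Minkowski space the operator \<open>H\<close> maps \<open>\<tau>\<^bsup>- a - j\<^esup> q\<^sub>j(Y)\<close> to a combination of itself,
  of \<open>\<tau>\<^bsup>- a - j - 2\<^esup> q\<^sub>j(Y)\<close> and of \<open>\<tau>\<^bsup>- a - j\<^esup> (\<Delta> q\<^sub>j)(Y)\<close>. A suitable choice of \<open>\<kappa>\<close> makes the coefficient of
  the second of these vanish for \<open>j = N\<close>, so that a finite sum over \<open>j \<le> N\<close> with explicitly weighted terms is an
  eigenfunction; here the parity of \<open>v\<close> is used to have \<open>q\<^bsub>N + 1\<^esub> = 0\<close>. As \<open>N\<close> tends to infinity,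
  the weights stay in \<open>[0, 1]\<close> and tend to \<open>1\<close>, so that the rescaled eigenfunctions converge to the Taylor series of \<open>v\<close>.
  That the series represents \<open>v\<close> follows from derivative estimates
  based on the mean value property of the harmonic function \<open>e\<^sup>t v(y)\<close>. If \<open>v = 0\<close>, small multiples of
  eigenfunctions belonging to another solution are used.\<close>

section \<open>Convergence of all partial derivatives up to order \<open>k\<close>\<close>

text \<open>Put \<open>m j = (a + j) * (a + j + 1)\<close>. In the coefficient of the power with two
  more factors, minus the Laplacian contributes \<open>\<kappa>^2 * m j\<close> and the potential
  \<open>- \<alpha> / \<kappa>^2\<close>. As \<open>\<alpha>\<close> is given, the one free
  parameter is \<open>\<kappa>\<close>, and \<open>\<alpha> = \<kappa>^4 * m N\<close> makes the two
  cancel at \<open>j = N\<close>. What remains is the eigenvalue \<open>\<kappa>^2 * D\<close> with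
  \<open>D = m N - a * (a + 1 - d) = (2 * N + d) * a + N * (N + 1)\<close>, the number called
  \<open>oscillator_scale\<close>.

  At distance |x| / sqrt \<lambda> from the minimum, \<open>\<kappa>\<close> times the distance is
  |x| / sqrt D. Hence neither \<open>\<kappa>\<close> nor \<open>\<alpha>\<close> occurs in the
  rescaled eigenfunctions, and the claim becomes a limit in \<open>N\<close> alone. The envelope
  cosh (|x| / sqrt D) ^ (- a) is about exp (- a |x|^2 / (2 D)) and tends to 1, because a / D is at
  most 1 / (2 N). The power \<open>a = N^2\<close> is also large enough for square integrability as
  soon as it reaches the dimension.

  Two obstacles shape the rest: \<open>v\<close> is only assumed to be C^2, so that its smoothness
  and analyticity have to be proved, and the base point and frame are arbitrary for every
  \<open>\<kappa>\<close>, so that the computations are done with Minkowski products.\<close>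

lemma has_derivative_partial_derivs:
  fixes f :: "real ^ 'n::finite \<Rightarrow> 'b::real_normed_vector"
  assumes "f differentiable (at x)"
  shows "(f has_derivative (\<lambda>h. \<Sum>i\<in>UNIV. h $ i *\<^sub>R partial_deriv i f x)) (at x)"
proof -
  have D: "(f has_derivative frechet_derivative f (at x)) (at x)"
    using assms by (simp add: frechet_derivative_works)
  then have lin: "linear (frechet_derivative f (at x))"
    by (rule has_derivative_linear)
  have "frechet_derivative f (at x) h = (\<Sum>i\<in>UNIV. h $ i *\<^sub>R partial_deriv i f x)" for h
  proof -
    have "h = (\<Sum>i\<in>UNIV. h $ i *\<^sub>R axis i 1)"
      by (simp add: vec_eq_iff axis_def if_distrib sum.If_cases cong: if_cong)
    then have "frechet_derivative f (at x) h = frechet_derivative f (at x) (\<Sum>i\<in>UNIV. h $ i *\<^sub>R axis i 1)"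
      by simp
    also have "\<dots> = (\<Sum>i\<in>UNIV. h $ i *\<^sub>R partial_deriv i f x)"
      by (simp add: linear_sum[OF lin] linear_scale[OF lin] partial_deriv_def)
    finally show ?thesis .
  qed
  then show ?thesis using D by presburger
qed

lemma partial_deriv_eq:
  assumes "(f has_derivative f') (at x)"
  shows "partial_deriv i f x = f' (axis i 1)"
  using frechet_derivative_at[OF assms] by (simp add: partial_deriv_def)

lemma sum_axis_scaleR:
  fixes g :: "'n::finite \<Rightarrow> 'b::real_vector"
  shows "(\<Sum>j\<in>UNIV. (axis i (1::real) :: real ^ 'n) $ j *\<^sub>R g j) = g i"
proof -
  have "(\<Sum>j\<in>UNIV. (axis i (1::real) :: real ^ 'n) $ j *\<^sub>R g j) = (\<Sum>j\<in>UNIV. if j = i then g j else 0)"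
    by (rule sum.cong) (auto simp: axis_def)
  then show ?thesis by simp
qed

section \<open>The notion of C^k convergence\<close>

text \<open>Locally uniform convergence, tested on balls about the origin; every ball of the theorem
  lies in one of them. Continuity of all members is included so that products and compositions stay
  within the notion.\<close>

definition C0_converges ::
  "(nat \<Rightarrow> real ^ 'n::finite \<Rightarrow> 'b::real_normed_vector) \<Rightarrow> (real ^ 'n \<Rightarrow> 'b) \<Rightarrow> bool" where
  "C0_converges F f \<longleftrightarrow> (\<forall>N. continuous_on UNIV (F N)) \<and> continuous_on UNIV f \<and>
     (\<forall>\<rho>. uniform_limit (cball 0 \<rho>) F f sequentially)"

text \<open>The recursion replaces the functions by their first derivatives, so that an induction on
  k can generalize over the functions. For a constant sequence this is membership in C^k, which is
  why \<open>Ck\<close> is an instance and inherits all closure lemmas.\<close>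

primrec Ck_converges ::
  "nat \<Rightarrow> (nat \<Rightarrow> real ^ 'n::finite \<Rightarrow> 'b::real_normed_vector) \<Rightarrow> (real ^ 'n \<Rightarrow> 'b) \<Rightarrow> bool" where
  "Ck_converges 0 F f \<longleftrightarrow> C0_converges F f"
| "Ck_converges (Suc k) F f \<longleftrightarrow> C0_converges F f \<and>
     (\<forall>N x. F N differentiable (at x)) \<and> (\<forall>x. f differentiable (at x)) \<and>
     (\<forall>i. Ck_converges k (\<lambda>N. partial_deriv i (F N)) (partial_deriv i f))"

abbreviation Ck :: "nat \<Rightarrow> (real ^ 'n::finite \<Rightarrow> 'b::real_normed_vector) \<Rightarrow> bool" where
  "Ck k f \<equiv> Ck_converges k (\<lambda>_. f) f"

lemma C0_converges_const: "C0_converges (\<lambda>_. f) f \<longleftrightarrow> continuous_on UNIV f"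
  by (auto simp: C0_converges_def uniform_limit_const)

lemma C0_if_Ck_converges: "Ck_converges k F f \<Longrightarrow> C0_converges F f"
  by (cases k) auto

lemma Ck_converges_SucD: "Ck_converges (Suc k) F f \<Longrightarrow> Ck_converges k F f"
  by (induction k arbitrary: F f) auto

lemma Ck_converges_mono: "Ck_converges m F f \<Longrightarrow> k \<le> m \<Longrightarrow> Ck_converges k F f"
  by (induction m) (auto simp: le_Suc_eq dest: Ck_converges_SucD simp del: Ck_converges.simps)

lemma Ck_0: "Ck 0 f \<longleftrightarrow> continuous_on UNIV f"
  by (simp add: C0_converges_const)

lemma Ck_Suc:
  "Ck (Suc k) f \<longleftrightarrow> (\<forall>x. f differentiable (at x)) \<and> (\<forall>i. Ck k (partial_deriv i f))"
  by (auto simp: C0_converges_const continuous_on_eq_continuous_within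
      intro: differentiable_imp_continuous_within)

lemma Ck_continuous: "Ck k f \<Longrightarrow> continuous_on UNIV f"
  using C0_if_Ck_converges C0_converges_const by blast

lemma Ck_converges_imp_Ck:
  "Ck_converges k F f \<Longrightarrow> Ck k (F N)" "Ck_converges k F f \<Longrightarrow> Ck k f"
proof (induction k arbitrary: F f)
  case (Suc k)
  { case 1
    then show ?case
      using Suc(1)[of "\<lambda>N. partial_deriv i (F N)" "partial_deriv i f" for i] unfolding Ck_Suc by auto }
  { case 2
    then show ?case
      using Suc(2)[of "\<lambda>N. partial_deriv i (F N)" "partial_deriv i f" for i] unfolding Ck_Suc by auto }
qed (auto simp: C0_converges_def uniform_limit_const)

text \<open>Candidates for the derivatives are supplied as \<open>F'\<close> and \<open>f'\<close>,
  so that one identity of linear maps in \<open>h\<close> replaces the computation of every partial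
  derivative. Most closure properties below are inductions through this rule.\<close>

lemma Ck_converges_SucI:
  assumes "C0_converges F f"
    and "\<And>N x. (F N has_derivative (\<lambda>h. \<Sum>i\<in>UNIV. h $ i *\<^sub>R F' i N x)) (at x)"
    and "\<And>x. (f has_derivative (\<lambda>h. \<Sum>i\<in>UNIV. h $ i *\<^sub>R f' i x)) (at x)"
    and "\<And>i. Ck_converges k (F' i) (f' i)"
  shows "Ck_converges (Suc k) F f"
proof -
  have "partial_deriv i (F N) = F' i N" "partial_deriv i f = f' i" for i N
    using partial_deriv_eq[OF assms(2)] partial_deriv_eq[OF assms(3)]
    by (auto simp: sum_axis_scaleR fun_eq_iff)
  moreover have "(\<lambda>N. partial_deriv i (F N)) = F' i" for i
    using calculation by auto
  ultimately show ?thesis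
    using assms(1,4) differentiableI[OF assms(2)] differentiableI[OF assms(3)] by simp
qed

lemma Ck_SucI:
  assumes "\<And>x. (f has_derivative (\<lambda>h. \<Sum>i\<in>UNIV. h $ i *\<^sub>R f' i x)) (at x)"
    and "\<And>i. Ck k (f' i)"
  shows "Ck (Suc k) f"
proof -
  have "partial_deriv i f = f' i" for i
    using partial_deriv_eq[OF assms(1)] by (auto simp: sum_axis_scaleR fun_eq_iff)
  then show ?thesis using assms unfolding Ck_Suc by (auto simp: differentiable_def)
qed

section \<open>Sums, products and quotients\<close>

text \<open>Uniform convergence of a product needs bounded limits, which continuity gives on the
  compact balls.\<close>

lemma C0_converges_scaleR:
  assumes "C0_converges F f" "C0_converges G g"
  shows "C0_converges (\<lambda>N x. F N x *\<^sub>R G N x) (\<lambda>x. f x *\<^sub>R g x)"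
proof -
  have "bounded (f ` cball 0 \<rho>)" "bounded (g ` cball 0 \<rho>)" for \<rho>
    using assms unfolding C0_converges_def
    by (meson compact_cball compact_continuous_image compact_imp_bounded continuous_on_subset subset_UNIV)+
  then show ?thesis
    using assms unfolding C0_converges_def
    by (auto intro!: continuous_on_scaleR
        bounded_bilinear.bounded_uniform_limit[OF bounded_bilinear_scaleR])
qed

lemma C0_converges_add:
  "C0_converges F f \<Longrightarrow> C0_converges G g \<Longrightarrow> C0_converges (\<lambda>N x. F N x + G N x) (\<lambda>x. f x + g x)"
  unfolding C0_converges_def by (auto intro!: continuous_on_add uniform_limit_add)

lemma Ck_converges_add:
  "Ck_converges k F f \<Longrightarrow> Ck_converges k G g \<Longrightarrow> Ck_converges k (\<lambda>N x. F N x + G N x) (\<lambda>x. f x + g x)"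
proof (induction k arbitrary: F f G g)
  case 0
  then show ?case by (simp add: C0_converges_add)
next
  case (Suc k)
  show ?case
  proof (rule Ck_converges_SucI)
    show "Ck_converges k (\<lambda>N x. partial_deriv i (F N) x + partial_deriv i (G N) x)
        (\<lambda>x. partial_deriv i f x + partial_deriv i g x)" for i
      using Suc by auto
  qed (use Suc.prems in \<open>auto intro!: C0_converges_add derivative_eq_intros has_derivative_partial_derivs
     simp: scaleR_add_right sum.distrib\<close>)
qed

lemma Ck_converges_const:
  fixes r :: "nat \<Rightarrow> 'b::real_normed_vector"
  assumes "r \<longlonglongrightarrow> r0"
  shows "Ck_converges k (\<lambda>N x. r N) (\<lambda>x::real^'n::finite. r0)"
  using assms
proof (induction k arbitrary: r r0)
  case 0
  then have "uniform_limit X (\<lambda>N (x::real^'n). r N) (\<lambda>x. r0) sequentially" for X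
    by (auto simp: uniform_limit_iff tendsto_iff elim!: allE eventually_mono)
  then show ?case by (auto simp: C0_converges_def)
next
  case (Suc k)
  show ?case
  proof (rule Ck_converges_SucI)
    show "C0_converges (\<lambda>N x. r N) (\<lambda>x::real^'n. r0)"
      using Suc.IH[OF Suc.prems] C0_if_Ck_converges by blast
    show "Ck_converges k (\<lambda>N (x::real^'n). 0::'b) (\<lambda>x. 0)" for i
      by (rule Suc.IH) simp
  qed auto
qed

lemma Ck_const [simp]: "Ck k (\<lambda>x. r)"
  by (rule Ck_converges_const) simp

lemma Ck_converges_scaleR:
  "Ck_converges k F f \<Longrightarrow> Ck_converges k G g \<Longrightarrow>
    Ck_converges k (\<lambda>N x. F N x *\<^sub>R G N x) (\<lambda>x. f x *\<^sub>R g x)"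
proof (induction k arbitrary: F f G g)
  case 0
  then show ?case by (simp add: C0_converges_scaleR)
next
  case (Suc k)
  show ?case
  proof (rule Ck_converges_SucI)
    show "Ck_converges k (\<lambda>N x. F N x *\<^sub>R partial_deriv i (G N) x + partial_deriv i (F N) x *\<^sub>R G N x)
        (\<lambda>x. f x *\<^sub>R partial_deriv i g x + partial_deriv i f x *\<^sub>R g x)" for i
      by (intro Ck_converges_add Suc.IH) (use Suc.prems in \<open>auto dest: Ck_converges_SucD simp del: Ck_converges.simps, auto\<close>)
    have D: "((\<lambda>x. u x *\<^sub>R w x) has_derivative (\<lambda>h. \<Sum>i\<in>UNIV. h $ i *\<^sub>R
        (u x *\<^sub>R partial_deriv i w x + partial_deriv i u x *\<^sub>R w x))) (at x)"
      if "u differentiable (at x)" "w differentiable (at x)"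
      for u and w :: "real^'a \<Rightarrow> 'b" and x
      by (rule has_derivative_eq_rhs[OF has_derivative_scaleR[OF
              has_derivative_partial_derivs[OF that(1)] has_derivative_partial_derivs[OF that(2)]]])
         (simp add: fun_eq_iff scaleR_add_right sum.distrib scaleR_sum_right scaleR_sum_left mult.commute)
    show "((\<lambda>x. F N x *\<^sub>R G N x) has_derivative (\<lambda>h. \<Sum>i\<in>UNIV. h $ i *\<^sub>R
        (F N x *\<^sub>R partial_deriv i (G N) x + partial_deriv i (F N) x *\<^sub>R G N x))) (at x)" for N x
      using Suc.prems by (intro D) auto
    show "((\<lambda>x. f x *\<^sub>R g x) has_derivative (\<lambda>h. \<Sum>i\<in>UNIV. h $ i *\<^sub>R
        (f x *\<^sub>R partial_deriv i g x + partial_deriv i f x *\<^sub>R g x))) (at x)" for x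
      using Suc.prems by (intro D) auto
  qed (use Suc.prems in \<open>auto intro: C0_converges_scaleR\<close>)
qed

lemma Ck_converges_mult:
  fixes F G :: "nat \<Rightarrow> real^'n::finite \<Rightarrow> real"
  shows "Ck_converges k F f \<Longrightarrow> Ck_converges k G g \<Longrightarrow>
    Ck_converges k (\<lambda>N x. F N x * G N x) (\<lambda>x. f x * g x)"
  using Ck_converges_scaleR[of k F f G g] by simp

lemma Ck_converges_minus:
  "Ck_converges k F f \<Longrightarrow> Ck_converges k (\<lambda>N x. - F N x) (\<lambda>x. - f x)"
  using Ck_converges_scaleR[OF Ck_const[of k "-1"], of F f] by simp

lemma Ck_converges_diff:
  "Ck_converges k F f \<Longrightarrow> Ck_converges k G g \<Longrightarrow> Ck_converges k (\<lambda>N x. F N x - G N x) (\<lambda>x. f x - g x)"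
  using Ck_converges_add[OF _ Ck_converges_minus] by fastforce

lemma Ck_converges_sum:
  assumes "\<And>j. j \<in> A \<Longrightarrow> Ck_converges k (F j) (f j)"
  shows "Ck_converges k (\<lambda>N x. \<Sum>j\<in>A. F j N x) (\<lambda>x. \<Sum>j\<in>A. f j x)"
  using assms by (induction A rule: infinite_finite_induct) (auto intro!: Ck_converges_add)

lemma Ck_converges_power:
  fixes F :: "nat \<Rightarrow> real^'n::finite \<Rightarrow> real"
  shows "Ck_converges k F f \<Longrightarrow> Ck_converges k (\<lambda>N x. F N x ^ m) (\<lambda>x. f x ^ m)"
  by (induction m) (auto intro: Ck_converges_mult)

lemma Ck_component: "Ck k (\<lambda>x::real^'n::finite. x $ i)"
proof (cases k)
  case 0
  then show ?thesis by (simp add: C0_converges_const continuous_on_component)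
next
  case (Suc m)
  have "((\<lambda>x. x $ i) has_derivative (\<lambda>h. \<Sum>j\<in>UNIV. h $ j *\<^sub>R (if j = i then 1 else 0))) (at x)"
    for x :: "real^'n"
    by (rule has_derivative_eq_rhs[OF bounded_linear_imp_has_derivative[OF bounded_linear_vec_nth]])
       (simp add: fun_eq_iff if_distrib cong: if_cong)
  then show ?thesis
    unfolding Suc by (rule Ck_SucI) auto
qed

text \<open>In order 0 the limit has a positive minimum on each compact ball. In higher order the
  derivative of the inverse is a product of the inverse itself, controlled one order lower, with the
  derivative of \<open>F\<close>; so the induction runs over k for fixed functions.\<close>

lemma Ck_converges_inverse:
  fixes F :: "nat \<Rightarrow> real^'n::finite \<Rightarrow> real"
  assumes "\<And>N x. F N x > 0" "\<And>x. f x > 0"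
  shows "Ck_converges k F f \<Longrightarrow> Ck_converges k (\<lambda>N x. inverse (F N x)) (\<lambda>x. inverse (f x))"
proof (induction k)
  case 0
  have "uniform_limit (cball 0 \<rho>) (\<lambda>N x. inverse (F N x)) (\<lambda>x. inverse (f x)) sequentially" for \<rho>
  proof (cases "\<rho> \<ge> 0")
    case True
    have "\<exists>y\<in>cball 0 \<rho>. \<forall>x\<in>cball 0 \<rho>. f y \<le> f x"
      using 0 True by (intro continuous_attains_inf) (auto simp: C0_converges_def intro: continuous_on_subset)
    then obtain y where "\<forall>x\<in>cball 0 \<rho>. f y \<le> f x" by auto
    then show ?thesis
      using 0 assms uniform_lim_inverse[where S = "cball 0 \<rho>" and f = F and l = f and F = sequentially and b = "f y"]
      by (auto simp: C0_converges_def comp_def abs_of_pos)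
  qed (simp add: uniform_limit_iff)
  moreover have "F N x \<noteq> 0" "f x \<noteq> 0" for N x
    using assms by (metis less_irrefl)+
  ultimately show ?case using 0 assms
    by (auto simp: C0_converges_def intro!: continuous_on_inverse)
next
  case (Suc k)
  have IH: "Ck_converges k (\<lambda>N x. inverse (F N x)) (\<lambda>x. inverse (f x))"
    using Suc Ck_converges_SucD by blast
  show ?case
  proof (rule Ck_converges_SucI)
    show "C0_converges (\<lambda>N x. inverse (F N x)) (\<lambda>x. inverse (f x))"
      using IH C0_if_Ck_converges by blast
    show "Ck_converges k (\<lambda>N x. - (inverse (F N x) * partial_deriv i (F N) x * inverse (F N x)))
           (\<lambda>x. - (inverse (f x) * partial_deriv i f x * inverse (f x)))" for i
      using Suc.prems by (intro Ck_converges_minus Ck_converges_mult IH) auto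
    have D: "((\<lambda>x. inverse (u x)) has_derivative (\<lambda>h. \<Sum>i\<in>UNIV. h $ i *\<^sub>R
        (- (inverse (u x) * partial_deriv i u x * inverse (u x))))) (at x)"
      if "u differentiable (at x)" "u x > 0" for u :: "real^'n \<Rightarrow> real" and x
      by (rule has_derivative_eq_rhs[OF Deriv.has_derivative_inverse[OF _
              has_derivative_partial_derivs[OF that(1)]]])
         (use that in \<open>auto simp: fun_eq_iff sum_distrib_left sum_distrib_right sum_negf mult_ac\<close>)
    show "((\<lambda>x. inverse (F N x)) has_derivative (\<lambda>h. \<Sum>i\<in>UNIV. h $ i *\<^sub>R
        (- (inverse (F N x) * partial_deriv i (F N) x * inverse (F N x))))) (at x)" for N x
      using Suc.prems assms by (intro D) auto
    show "((\<lambda>x. inverse (f x)) has_derivative (\<lambda>h. \<Sum>i\<in>UNIV. h $ i *\<^sub>R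
        (- (inverse (f x) * partial_deriv i f x * inverse (f x))))) (at x)" for x
      using Suc.prems assms by (intro D) auto
  qed
qed

section \<open>Composition of C^k maps\<close>

lemma has_derivative_compose_vec:
  fixes q :: "real ^ 'm::finite \<Rightarrow> 'b::real_normed_vector" and Y :: "real^'n::finite \<Rightarrow> real^'m"
  assumes "q differentiable (at (Y x))" "\<And>l. (\<lambda>x. Y x $ l) differentiable (at x)"
  shows "((\<lambda>x. q (Y x)) has_derivative
    (\<lambda>h. \<Sum>i\<in>UNIV. h $ i *\<^sub>R (\<Sum>l\<in>UNIV. partial_deriv i (\<lambda>x. Y x $ l) x *\<^sub>R partial_deriv l q (Y x)))) (at x)"
proof -
  have "((\<lambda>x. Y x \<bullet> b) has_derivative (\<lambda>h. (\<chi> l. \<Sum>i\<in>UNIV. h $ i *\<^sub>R partial_deriv i (\<lambda>x. Y x $ l) x) \<bullet> b)) (at x)"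
    if "b \<in> Basis" for b
    using that has_derivative_partial_derivs[OF assms(2)] by (auto simp: Basis_vec_def inner_axis)
  then have Y: "(Y has_derivative (\<lambda>h. \<chi> l. \<Sum>i\<in>UNIV. h $ i *\<^sub>R partial_deriv i (\<lambda>x. Y x $ l) x)) (at x)"
    by (subst has_derivative_componentwise_within) auto
  have "((\<lambda>x. q (Y x)) has_derivative (\<lambda>h. \<Sum>l\<in>UNIV. (\<chi> l. \<Sum>i\<in>UNIV. h $ i *\<^sub>R partial_deriv i (\<lambda>x. Y x $ l) x) $ l *\<^sub>R partial_deriv l q (Y x))) (at x)"
    using has_derivative_compose[OF Y has_derivative_partial_derivs[OF assms(1)]] .
  also have "(\<lambda>h::real^'n. \<Sum>l\<in>UNIV. (\<chi> l. \<Sum>i\<in>UNIV. h $ i *\<^sub>R partial_deriv i (\<lambda>x. Y x $ l) x) $ l *\<^sub>R partial_deriv l q (Y x))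
    = (\<lambda>h. \<Sum>i\<in>UNIV. h $ i *\<^sub>R (\<Sum>l\<in>UNIV. partial_deriv i (\<lambda>x. Y x $ l) x *\<^sub>R partial_deriv l q (Y x)))"
    by (rule ext, simp add: scaleR_sum_left scaleR_sum_right, rule sum.swap)
  finally show ?thesis .
qed

text \<open>The partial derivatives are sums of products of derivatives of \<open>Y\<close> with
  \<open>partial_deriv l q\<close> composed with the same \<open>Y\<close>; hence \<open>q\<close>
  varies in the induction while \<open>Y\<close> stays fixed.\<close>

lemma Ck_compose_vec:
  fixes q :: "real ^ 'm::finite \<Rightarrow> 'b::real_normed_vector" and Y :: "real^'n::finite \<Rightarrow> real^'m"
  shows "Ck k q \<Longrightarrow> (\<And>l. Ck k (\<lambda>x. Y x $ l)) \<Longrightarrow> Ck k (\<lambda>x. q (Y x))"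
proof (induction k arbitrary: q)
  case 0
  have "continuous_on UNIV (\<lambda>x. \<chi> l. Y x $ l)"
    using 0(2) by (intro continuous_on_vec_lambda) (simp add: C0_converges_const)
  then have "continuous_on UNIV Y" by simp
  then show ?case using 0(1)
    by (auto simp: C0_converges_const intro: continuous_on_compose2)
next
  case (Suc k)
  have "((\<lambda>x. q (Y x)) has_derivative
    (\<lambda>h. \<Sum>i\<in>UNIV. h $ i *\<^sub>R (\<Sum>l\<in>UNIV. partial_deriv i (\<lambda>x. Y x $ l) x *\<^sub>R partial_deriv l q (Y x)))) (at x)" for x
    using Suc.prems by (intro has_derivative_compose_vec) (auto simp: Ck_Suc simp del: Ck_converges.simps)
  moreover have "Ck k (\<lambda>x. \<Sum>l\<in>UNIV. partial_deriv i (\<lambda>x. Y x $ l) x *\<^sub>R partial_deriv l q (Y x))" for i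
    using Suc.prems Suc.IH
    by (intro Ck_converges_sum Ck_converges_scaleR Suc.IH) (auto simp: Ck_Suc Ck_converges_SucD simp del: Ck_converges.simps)
  ultimately show ?case by (rule Ck_SucI)
qed

section \<open>Translation to \<open>Ck_on\<close> and \<open>Ck_norm\<close>\<close>

text \<open>\<open>iterated_partial\<close> adds derivatives on the outside,
  \<open>Ck_converges\<close> peels them off on the inside. Moving the innermost derivative of a
  list into the function is the bridge between the two.\<close>

lemma iterated_partial_snoc:
  "iterated_partial (is @ [i]) f = iterated_partial is (partial_deriv i f)"
  by (induction "is") auto

lemma Ck_converges_iterated_partial:
  "Ck_converges (length is + k) F f \<Longrightarrow>
    Ck_converges k (\<lambda>N. iterated_partial is (F N)) (iterated_partial is f)"
  by (induction "is" arbitrary: F f rule: rev_induct) (auto simp: iterated_partial_snoc)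

lemma Ck_imp_Ck_on:
  assumes "Ck k f" shows "Ck_on k S f"
proof -
  have "iterated_partial is f differentiable (at x)" if "length is < k" for "is" x
  proof -
    have "Ck (Suc 0) (iterated_partial is f)"
      by (rule Ck_converges_iterated_partial, rule Ck_converges_mono[OF assms]) (use that in auto)
    then show ?thesis unfolding Ck_Suc by blast
  qed
  moreover have "continuous_on S (iterated_partial is f)" if "length is \<le> k" for "is"
  proof -
    have "Ck 0 (iterated_partial is f)"
      by (rule Ck_converges_iterated_partial, rule Ck_converges_mono[OF assms]) (use that in auto)
    then show ?thesis unfolding Ck_0 by (meson continuous_on_subset subset_UNIV)
  qed
  ultimately show ?thesis by (auto simp: Ck_on_def)
qed

lemma Ck_on_UNIV_imp_Ck: "Ck_on k UNIV f \<Longrightarrow> Ck k f"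
proof (induction k arbitrary: f)
  case 0
  have "continuous_on UNIV (iterated_partial [] f)"
    using 0 unfolding Ck_on_def by (metis le0 list.size(3))
  then show ?case by (simp add: C0_converges_const)
next
  case (Suc k)
  have "Ck_on k UNIV (partial_deriv i f)" for i
    unfolding Ck_on_def
  proof (intro conjI allI impI)
    fix "is" :: "'a list"
    show "\<forall>x\<in>UNIV. iterated_partial is (partial_deriv i f) differentiable at x" if "length is < k"
      using Suc.prems that unfolding Ck_on_def
      by (metis Suc_less_eq iterated_partial_snoc length_append_singleton)
    show "continuous_on UNIV (iterated_partial is (partial_deriv i f))" if "length is \<le> k"
      using Suc.prems that unfolding Ck_on_def
      by (metis Suc_le_mono iterated_partial_snoc length_append_singleton)
  qed
  moreover have "f differentiable at x" for x
    using Suc.prems unfolding Ck_on_def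
    by (metis UNIV_I iterated_partial.simps(1) list.size(3) zero_less_Suc)
  ultimately show ?case
    unfolding Ck_Suc using Suc.IH by blast
qed

lemma iterated_partial_zero:
  "iterated_partial is (\<lambda>x. 0 :: 'b::real_normed_vector) = (\<lambda>x. 0)"
proof (induction "is")
  case (Cons i "is")
  have "partial_deriv i (\<lambda>x. 0) x = (0::'b)" for x
    by (rule partial_deriv_eq[THEN trans, OF has_derivative_const]) simp
  then have "partial_deriv i (\<lambda>x. 0) = (\<lambda>x. 0::'b)" by (rule ext)
  with Cons show ?case by simp
qed auto

lemma Ck_norm_le:
  assumes "Ck k f" "\<And>is x. length is \<le> k \<Longrightarrow> x \<in> S \<Longrightarrow> norm (iterated_partial is f x) \<le> \<epsilon>"
  shows "Ck_norm k S f \<le> ennreal \<epsilon>"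
  unfolding Ck_norm_def using Ck_imp_Ck_on[OF assms(1)] assms(2)
  by (auto intro!: SUP_least ennreal_leI)

lemma Ck_converges_eventually_Ck_norm:
  assumes "Ck_converges k F f" "\<epsilon> > 0" "bounded S"
  shows "\<forall>\<^sub>F N in sequentially. Ck_norm k S (\<lambda>x. F N x - f x) < ennreal \<epsilon>"
proof -
  obtain \<rho> where \<rho>: "S \<subseteq> cball 0 \<rho>"
    using assms(3) unfolding bounded_iff by (metis mem_cball_0 subsetI)
  have cv: "Ck_converges k (\<lambda>N x. F N x - f x) (\<lambda>x. 0)"
    using Ck_converges_diff[OF assms(1) Ck_converges_imp_Ck(2)[OF assms(1)]] by simp
  have "\<forall>\<^sub>F N in sequentially. \<forall>x\<in>cball 0 \<rho>. norm (iterated_partial is (\<lambda>x. F N x - f x) x) < \<epsilon> / 2"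
    if "length is \<le> k" for "is"
  proof -
    have "Ck_converges 0 (\<lambda>N. iterated_partial is (\<lambda>x. F N x - f x)) (iterated_partial is (\<lambda>x. 0))"
      by (rule Ck_converges_iterated_partial, rule Ck_converges_mono[OF cv]) (use that in auto)
    then have "uniform_limit (cball 0 \<rho>) (\<lambda>N. iterated_partial is (\<lambda>x. F N x - f x)) (\<lambda>x. 0) sequentially"
      by (simp add: C0_converges_def iterated_partial_zero)
    then show ?thesis using assms(2)
      by (auto simp: uniform_limit_iff dest: spec[of _ "\<epsilon>/2"])
  qed
  moreover have "finite {is::'a list. length is \<le> k}"
    using finite_lists_length_le[of "UNIV::'a set" k] by simp
  ultimately have "\<forall>\<^sub>F N in sequentially. \<forall>is\<in>{is. length is \<le> k}.
      \<forall>x\<in>cball 0 \<rho>. norm (iterated_partial is (\<lambda>x. F N x - f x) x) < \<epsilon> / 2"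
    by (subst eventually_ball_finite_distrib) auto
  then show ?thesis
  proof eventually_elim
    case (elim N)
    \<comment> \<open>Bounding every derivative by \<open>\<epsilon> / 2\<close> leaves room for the
      supremum, which need not inherit a strict inequality.\<close>
    have "Ck_norm k S (\<lambda>x. F N x - f x) \<le> ennreal (\<epsilon> / 2)"
      using elim \<rho> by (intro Ck_norm_le Ck_converges_imp_Ck(1)[OF cv]) (auto intro: less_imp_le)
    also have "\<dots> < ennreal \<epsilon>"
      using assms(2) by (simp add: ennreal_less_iff)
    finally show ?case .
  qed
qed

section \<open>Mean value property and smoothness of Helmholtz solutions\<close>

text \<open>A box because the integrals are taken over \<open>cbox\<close>; the factor 2 leaves room
  for a function supported in the unit ball to be shifted by less than 1 in any direction.\<close>

definition bigbox :: "'a::euclidean_space set" where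
  "bigbox = cbox (- (2 *\<^sub>R One)) (2 *\<^sub>R One)"

lemma norm_le_2_imp_bigbox: "norm y \<le> 2 \<Longrightarrow> y \<in> bigbox"
proof -
  assume y: "norm y \<le> 2"
  have "One \<bullet> b = 1" if "b \<in> Basis" for b :: 'a
    using that by (simp add: inner_sum_left inner_Basis)
  moreover have "\<bar>y \<bullet> b\<bar> \<le> 2" if "b \<in> Basis" for b
    using Basis_le_norm[OF that, of y] y by linarith
  ultimately show ?thesis
    by (force simp: bigbox_def mem_box abs_le_iff)
qed

text \<open>Translating a function supported in the unit ball does not change its integral.\<close>

lemma integral_directional_derivative_eq_0:
  fixes g g' :: "'a::euclidean_space \<Rightarrow> 'b::banach"
  assumes g: "continuous_on UNIV g" and g': "continuous_on UNIV g'"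
    and deriv: "\<And>y t. ((\<lambda>t. g (y + t *\<^sub>R e)) has_vector_derivative g' (y + t *\<^sub>R e)) (at t)"
    and supp: "\<And>y. norm y \<ge> 1 \<Longrightarrow> g y = 0" and e: "norm e = 1"
  shows "integral bigbox g' = 0"
proof -
  define a :: 'a where "a = - (2 *\<^sub>R One)"
  define b :: 'a where "b = 2 *\<^sub>R One"
  have Q: "bigbox = cbox a b"
    by (simp add: bigbox_def a_def b_def)
  define I where "I t = integral (cbox a b) (\<lambda>y. g (y + t *\<^sub>R e))" for t
  have int: "(\<lambda>y. g (y + t *\<^sub>R e)) integrable_on cbox a b" for t
    by (intro integrable_continuous continuous_on_compose2[OF g] continuous_intros) auto
  have der: "(I has_vector_derivative integral (cbox a b) (\<lambda>y. g' (y + 0 *\<^sub>R e))) (at 0 within UNIV)"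
    unfolding I_def
  proof (rule leibniz_rule_vector_derivative)
    show "continuous_on (UNIV \<times> cbox a b) (\<lambda>(t, y). g' (y + t *\<^sub>R e))"
      unfolding split_beta
      by (intro continuous_on_compose2[OF g'] continuous_intros) auto
  qed (use deriv int in auto)
  \<comment> \<open>Before and after the shift the support lies inside the box, so both integrals
    extend to the whole space, where a translation changes nothing. Shifts of size below 1 suffice
    for the derivative at 0.\<close>
  have const: "I t = I 0" if "t \<in> {-1<..<1}" for t
  proof -
    have "(g has_integral I 0) (cbox a b)"
      using integrable_integral[OF int[of 0]] by (simp add: I_def)
    then have "((\<lambda>x. g (x + t *\<^sub>R e)) has_integral I 0) ((\<lambda>x. x - t *\<^sub>R e) ` cbox a b)"
      using has_integral_affinity[of g "I 0" a b 1 "t *\<^sub>R e"] by simp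
    then have 1: "((\<lambda>x. g (x + t *\<^sub>R e)) has_integral I 0) UNIV"
    proof (rule has_integral_on_superset)
      fix x assume "x \<notin> (\<lambda>x. x - t *\<^sub>R e) ` cbox a b"
      then have "x + t *\<^sub>R e \<notin> bigbox"
        unfolding Q by (metis add_diff_cancel_right' image_eqI)
      then show "g (x + t *\<^sub>R e) = 0"
        using norm_le_2_imp_bigbox[of "x + t *\<^sub>R e"] by (intro supp) linarith
    qed auto
    have "((\<lambda>x. g (x + t *\<^sub>R e)) has_integral I t) (cbox a b)"
      using integrable_integral[OF int[of t]] by (simp add: I_def)
    then have 2: "((\<lambda>x. g (x + t *\<^sub>R e)) has_integral I t) UNIV"
    proof (rule has_integral_on_superset)
      fix x assume "x \<notin> cbox a b"
      then have "norm x > 2"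
        using norm_le_2_imp_bigbox[of x] by (force simp: Q)
      moreover have "norm (t *\<^sub>R e) \<le> 1"
        using that e by auto
      ultimately have "norm (x + t *\<^sub>R e) \<ge> 1"
        using norm_diff_ineq[of x "t *\<^sub>R e"] by linarith
      then show "g (x + t *\<^sub>R e) = 0" by (rule supp)
    qed auto
    show ?thesis using has_integral_unique[OF 2 1] .
  qed
  have "(I has_vector_derivative 0) (at 0)"
    by (rule has_vector_derivative_transform_within_open[OF has_vector_derivative_const[of "I 0"], of "{-1<..<1}"])
      (simp_all add: const[symmetric] del: greaterThanLessThan_iff, simp)
  from vector_derivative_unique_at[OF this der] show ?thesis
    by (simp add: Q)
qed

section \<open>A bump function and averages against kernels\<close>

text \<open>With exponent at least 2 the truncation is differentiable also at 0, where the
  difference quotient is at most \<open>\<bar>h\<bar> ^ m\<close>.\<close>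

lemma has_real_derivative_pos_part_power:
  assumes "m \<ge> 1"
  shows "((\<lambda>r. max 0 r ^ Suc m) has_real_derivative real (Suc m) * max 0 x ^ m) (at x)"
proof -
  consider "x < 0" | "x > 0" | "x = 0" by linarith
  then show ?thesis
  proof cases
    case 1
    have "((\<lambda>r::real. 0) has_real_derivative 0) (at x)" by simp
    then have "((\<lambda>r. max 0 r ^ Suc m) has_real_derivative 0) (at x)"
      by (rule has_field_derivative_transform_within_open[of _ _ _ "{..<0}"]) (use 1 in auto)
    then show ?thesis using 1 assms by (simp add: power_0_left)
  next
    case 2
    have "((\<lambda>r. r ^ Suc m) has_real_derivative real (Suc m) * x ^ m) (at x)"
      using DERIV_pow[of "Suc m" x] by simp
    then have "((\<lambda>r. max 0 r ^ Suc m) has_real_derivative real (Suc m) * x ^ m) (at x)"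
      by (rule has_field_derivative_transform_within_open[of _ _ _ "{0<..}"]) (use 2 in auto)
    then show ?thesis using 2 by simp
  next
    case 3
    have "((\<lambda>h::real. max 0 h ^ Suc m / h) \<longlongrightarrow> 0) (at 0)"
    proof (rule Lim_null_comparison)
      show "\<forall>\<^sub>F h::real in at 0. norm (max 0 h ^ Suc m / h) \<le> \<bar>h\<bar> ^ m"
        by (auto simp: eventually_at_filter max_def)
      show "((\<lambda>h. \<bar>h\<bar> ^ m) \<longlongrightarrow> 0) (at (0::real))"
        using assms by (auto intro!: tendsto_eq_intros)
    qed
    then show ?thesis
      using 3 assms by (simp add: has_field_derivative_iff power_0_left)
  qed
qed

text \<open>A power of a truncated paraboloid: its gradient is \<open>- 2 m z\<close> times the next
  lower power, so that integrating by parts only lowers the exponent and all kernels stay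
  explicit.\<close>

definition bump :: "nat \<Rightarrow> 'a::euclidean_space \<Rightarrow> real" where
  "bump m z = max 0 (1 - z \<bullet> z) ^ m"

lemma continuous_on_bump [continuous_intros]:
  "continuous_on S f \<Longrightarrow> continuous_on S (\<lambda>x. bump m (f x))"
  unfolding bump_def by (intro continuous_intros)

lemma bump_outside: "norm z \<ge> 1 \<Longrightarrow> m \<ge> 1 \<Longrightarrow> bump m z = 0"
  using abs_le_square_iff[of 1 "norm z"] by (auto simp: bump_def dot_square_norm)

lemma bump_bounds: "0 \<le> bump m z" "bump m z \<le> 1"
  by (auto simp: bump_def intro!: power_le_one)

lemma has_real_derivative_bump:
  assumes "m \<ge> 1"
  shows "((\<lambda>t. bump (Suc m) (y + t *\<^sub>R e)) has_real_derivative
     - (2 * real (Suc m)) * ((y + t *\<^sub>R e) \<bullet> e) * bump m (y + t *\<^sub>R e)) (at t)"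
proof -
  have "((\<lambda>t. 1 - (y + t *\<^sub>R e) \<bullet> (y + t *\<^sub>R e)) has_real_derivative - 2 * ((y + t *\<^sub>R e) \<bullet> e)) (at t)"
    by (simp add: inner_add_left inner_add_right inner_commute algebra_simps)
       (auto intro!: derivative_eq_intros simp: inner_commute)
  from DERIV_chain2[OF has_real_derivative_pos_part_power[OF assms] this]
  show ?thesis unfolding bump_def by (rule DERIV_cong) (simp add: algebra_simps)
qed

text \<open>Averages of the harmonic extension \<open>exp t *\<^sub>R u y\<close> over balls of one
  dimension more. The exponential is put into \<open>K\<close>, so that only the first component of
  \<open>z\<close> moves the argument of \<open>u\<close>.\<close>

definition kernel_mean ::
  "((real ^ 'n::finite) \<times> real \<Rightarrow> real) \<Rightarrow> real \<Rightarrow> (real ^ 'n \<Rightarrow> 'b::banach) \<Rightarrow> real ^ 'n \<Rightarrow> 'b" where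
  "kernel_mean K s u x = integral bigbox (\<lambda>z. K z *\<^sub>R u (x + s *\<^sub>R fst z))"

lemma kernel_mean_integrable:
  fixes K :: "(real ^ 'n::finite) \<times> real \<Rightarrow> real" and u :: "real ^ 'n \<Rightarrow> 'b::banach"
  assumes "continuous_on UNIV K" "continuous_on UNIV u"
  shows "(\<lambda>z. K z *\<^sub>R u (x + s *\<^sub>R fst z)) integrable_on bigbox"
  unfolding bigbox_def
  by (intro integrable_continuous continuous_intros continuous_on_compose2[OF assms(2)]
      continuous_on_subset[OF assms(1)]) auto

text \<open>Differentiation under the integral sign: the kernel does not depend on the centre
  \<open>x\<close>, so all derivatives fall on \<open>u\<close>.\<close>

lemma kernel_mean_partial_deriv:
  fixes u :: "real ^ 'n::finite \<Rightarrow> 'b::banach"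
  assumes K: "continuous_on UNIV K" and u: "Ck (Suc 0) u"
  shows "(kernel_mean K s u has_derivative
      (\<lambda>h. \<Sum>i\<in>UNIV. h $ i *\<^sub>R kernel_mean K s (partial_deriv i u) x)) (at x)"
proof -
  define a :: "(real^'n) \<times> real" where "a = - (2 *\<^sub>R One)"
  define b :: "(real^'n) \<times> real" where "b = 2 *\<^sub>R One"
  have Q: "bigbox = cbox a b"
    by (simp add: bigbox_def a_def b_def)
  have diff: "u differentiable (at y)" and cont: "continuous_on UNIV u" 
    and cont': "continuous_on UNIV (partial_deriv i u)" for y i
    using u by (simp_all add: C0_converges_def Ck_continuous)
  \<comment> \<open>The rule for differentiating under the integral asks for a derivative that is
    continuous as a bounded linear map; continuity of the partial derivatives supplies this.\<close>
  define D where "D y = Blinfun (frechet_derivative u (at y))" for y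
  have D: "blinfun_apply (D y) = frechet_derivative u (at y)" for y
    unfolding D_def using diff
    by (intro bounded_linear_Blinfun_apply has_derivative_bounded_linear) (auto simp: frechet_derivative_works)
  have Dcont: "continuous_on UNIV D"
    by (rule continuous_on_blinfun_componentwise)
      (use cont' in \<open>auto simp: D Basis_vec_def partial_deriv_def[abs_def]\<close>)
  define fx where "fx x z = K z *\<^sub>R D (x + s *\<^sub>R fst z)" for x z
  have fxc: "continuous_on (UNIV \<times> cbox a b) (\<lambda>(x, z). fx x z)"
    unfolding fx_def split_beta
    by (intro continuous_intros continuous_on_compose2[OF Dcont] continuous_on_compose2[OF K]) auto
  have "((\<lambda>x. integral (cbox a b) (\<lambda>z. K z *\<^sub>R u (x + s *\<^sub>R fst z))) has_derivative
      blinfun_apply (integral (cbox a b) (fx x))) (at x within UNIV)"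
  proof (rule leibniz_rule[OF _ _ fxc])
    fix x :: "real^'n" and z :: "(real^'n) \<times> real"
    have "(u has_derivative frechet_derivative u (at (x + s *\<^sub>R fst z))) (at (x + s *\<^sub>R fst z))"
      using diff frechet_derivative_works by blast
    moreover have "((\<lambda>x. x + s *\<^sub>R fst z) has_derivative (\<lambda>h. h)) (at x)"
      by (auto intro!: derivative_eq_intros)
    ultimately have "((\<lambda>x. u (x + s *\<^sub>R fst z)) has_derivative frechet_derivative u (at (x + s *\<^sub>R fst z))) (at x)"
      using has_derivative_compose by fastforce
    then show "((\<lambda>x. K z *\<^sub>R u (x + s *\<^sub>R fst z)) has_derivative blinfun_apply (fx x z)) (at x within UNIV)"
      by (auto simp: fx_def D scaleR_blinfun.rep_eq intro!: has_derivative_scaleR_right)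
    show "(\<lambda>z. K z *\<^sub>R u (x + s *\<^sub>R fst z)) integrable_on cbox a b"
      using kernel_mean_integrable[OF K cont] by (simp add: Q)
  qed auto
  then have A: "(kernel_mean K s u has_derivative blinfun_apply (integral (cbox a b) (fx x))) (at x)"
    by (simp add: kernel_mean_def[abs_def] Q)
  have fxi: "fx x integrable_on cbox a b"
    using continuous_on_compose2[OF fxc, of "cbox a b" "\<lambda>z. (x, z)"]
    by (intro integrable_continuous) (auto simp: continuous_on_Pair)
  have "partial_deriv i (kernel_mean K s u) x = kernel_mean K s (partial_deriv i u) x" for i
  proof -
    have "partial_deriv i (kernel_mean K s u) x = blinfun_apply (integral (cbox a b) (fx x)) (axis i 1)"
      by (rule partial_deriv_eq[OF A])
    also have "\<dots> = integral (cbox a b) (\<lambda>z. blinfun_apply (fx x z) (axis i 1))"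
      using integral_linear[OF fxi blinfun.bounded_linear_left[of "axis i 1"]] by (simp add: o_def)
    also have "\<dots> = kernel_mean K s (partial_deriv i u) x"
      by (simp add: kernel_mean_def Q fx_def scaleR_blinfun.rep_eq D partial_deriv_def)
    finally show ?thesis .
  qed
  moreover have "kernel_mean K s u differentiable (at x)"
    using A by (rule differentiableI)
  ultimately show ?thesis
    using has_derivative_partial_derivs[of "kernel_mean K s u" x] by simp
qed

lemma partial_deriv_kernel_mean:
  fixes u :: "real ^ 'n::finite \<Rightarrow> 'b::banach"
  assumes "continuous_on UNIV K" "Ck (Suc 0) u"
  shows "partial_deriv i (kernel_mean K s u) = kernel_mean K s (partial_deriv i u)"
  by (rule ext, subst partial_deriv_eq[OF kernel_mean_partial_deriv[OF assms]]) (simp add: sum_axis_scaleR)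

lemma Ck_kernel_mean:
  fixes u :: "real ^ 'n::finite \<Rightarrow> 'b::banach"
  assumes K: "continuous_on UNIV K"
  shows "Ck k u \<Longrightarrow> Ck k (kernel_mean K s u)"
proof (induction k arbitrary: u)
  case 0
  then have u: "continuous_on UNIV u" by (simp add: C0_converges_const)
  have "continuous_on UNIV (kernel_mean K s u)"
    unfolding kernel_mean_def[abs_def] bigbox_def
  proof (rule integral_continuous_on_param)
    show "continuous_on (UNIV \<times> cbox (- (2 *\<^sub>R One)) (2 *\<^sub>R One)) (\<lambda>(x, z). K z *\<^sub>R u (x + s *\<^sub>R fst z))"
      unfolding split_beta
      by (intro continuous_intros continuous_on_compose2[OF u] continuous_on_compose2[OF K]) auto
  qed
  then show ?case by (simp add: C0_converges_const)
next
  case (Suc k)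
  have "Ck (Suc 0) u" using Suc.prems by (rule Ck_converges_mono) simp
  from kernel_mean_partial_deriv[OF K this] show ?case
    by (rule Ck_SucI) (use Suc in \<open>auto simp: Ck_Suc simp del: Ck_converges.simps\<close>)
qed

definition helmholtz :: "(real ^ 'n::finite \<Rightarrow> 'b::real_normed_vector) \<Rightarrow> bool" where
  "helmholtz u \<longleftrightarrow> Ck 2 u \<and> (\<forall>x. laplacian u x + u x = 0)"

lemma Ck_2_partials:
  assumes "Ck 2 u"
  shows "Ck (Suc 0) u" "Ck (Suc 0) (partial_deriv i u)" "continuous_on UNIV u"
    "continuous_on UNIV (partial_deriv i u)" "continuous_on UNIV (partial_deriv j (partial_deriv i u))"
    "u differentiable (at x)" "partial_deriv i u differentiable (at x)"
proof -
  have *: "u differentiable (at x)" "Ck (Suc 0) (partial_deriv i u)" for x i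
    using assms unfolding numeral_2_eq_2 Ck_Suc[of "Suc 0"] by blast+
  then have **: "Ck 0 (partial_deriv j (partial_deriv i u))" "partial_deriv i u differentiable (at x)" for i j x
    unfolding Ck_Suc by blast+
  show "Ck (Suc 0) u" "continuous_on UNIV u"
    using Ck_converges_mono[OF assms, of "Suc 0"] Ck_continuous[OF assms] by simp_all
  show "Ck (Suc 0) (partial_deriv i u)" "u differentiable (at x)" "partial_deriv i u differentiable (at x)"
    using * ** by blast+
  show "continuous_on UNIV (partial_deriv i u)" "continuous_on UNIV (partial_deriv j (partial_deriv i u))"
    using Ck_continuous * ** by blast+
qed

lemma has_vector_derivative_along_line:
  fixes u :: "real ^ 'n::finite \<Rightarrow> 'b::real_normed_vector"
  assumes "\<And>x. u differentiable (at x)"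
  shows "((\<lambda>t. u (x + t *\<^sub>R y)) has_vector_derivative (\<Sum>i\<in>UNIV. y $ i *\<^sub>R partial_deriv i u (x + t *\<^sub>R y))) (at t)"
proof -
  have "((\<lambda>t. x + t *\<^sub>R y) has_derivative (\<lambda>h. h *\<^sub>R y)) (at t)"
    by (rule has_derivative_eq_rhs, (rule derivative_intros)+) simp
  from has_derivative_compose[OF this has_derivative_partial_derivs[OF assms]]
  have "((\<lambda>t. u (x + t *\<^sub>R y)) has_derivative (\<lambda>h. \<Sum>i\<in>UNIV. (h *\<^sub>R y) $ i *\<^sub>R partial_deriv i u (x + t *\<^sub>R y))) (at t)" .
  then show ?thesis
    by (simp add: has_vector_derivative_def scaleR_sum_right)
qed

section \<open>Integration by parts and the mean value identity\<close>

text \<open>The integrand is the derivative, in the direction of the last coordinate, of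
  \<open>bump (Suc m) z * exp (s * snd z)\<close> times \<open>w\<close>, which vanishes outside the
  unit ball.\<close>

lemma integral_by_parts_snd:
  fixes w :: "real ^ 'n::finite \<Rightarrow> 'b::banach"
  assumes m: "m \<ge> 1" and w: "continuous_on UNIV w"
  shows "integral bigbox (\<lambda>z. ((s * bump (Suc m) z - 2 * real (Suc m) * snd z * bump m z) * exp (s * snd z))
           *\<^sub>R w (x + s *\<^sub>R fst z)) = 0"
proof (rule integral_directional_derivative_eq_0)
  let ?g = "\<lambda>z. (bump (Suc m) z * exp (s * snd z)) *\<^sub>R w (x + s *\<^sub>R fst z)"
  let ?e = "(0, 1) :: (real^'n) \<times> real"
  show "continuous_on UNIV ?g"
    by (intro continuous_intros continuous_on_compose2[OF w]) auto
  show "continuous_on UNIV (\<lambda>z. ((s * bump (Suc m) z - 2 * real (Suc m) * snd z * bump m z) * exp (s * snd z))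
           *\<^sub>R w (x + s *\<^sub>R fst z))"
    by (intro continuous_intros continuous_on_compose2[OF w]) auto
  show "norm ?e = 1" by (simp add: norm_Pair)
  show "?g y = 0" if "norm y \<ge> 1" for y
    using bump_outside[OF that, of "Suc m"] by simp
  show "((\<lambda>t. ?g (y + t *\<^sub>R ?e)) has_vector_derivative
      ((s * bump (Suc m) (y + t *\<^sub>R ?e) - 2 * real (Suc m) * snd (y + t *\<^sub>R ?e) * bump m (y + t *\<^sub>R ?e))
        * exp (s * snd (y + t *\<^sub>R ?e))) *\<^sub>R w (x + s *\<^sub>R fst (y + t *\<^sub>R ?e))) (at t)" for y t
  proof -
    have "((\<lambda>t. exp (s * (snd y + t))) has_real_derivative s * exp (s * (snd y + t))) (at t)"
      by (auto intro!: derivative_eq_intros)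
    from DERIV_mult[OF has_real_derivative_bump[OF m, of y ?e] this]
    have "((\<lambda>t. bump (Suc m) (y + t *\<^sub>R ?e) * exp (s * (snd y + t))) has_real_derivative
      (s * bump (Suc m) (y + t *\<^sub>R ?e) - 2 * real (Suc m) * (snd y + t) * bump m (y + t *\<^sub>R ?e))
        * exp (s * (snd y + t))) (at t)"
      by (rule DERIV_cong) (simp add: algebra_simps inner_prod_def)
    from has_vector_derivative_scaleR[OF this has_vector_derivative_const[of "w (x + s *\<^sub>R fst y)"]]
    show ?thesis by simp
  qed
qed

text \<open>The same product differentiated in the direction of coordinate \<open>i\<close>; the
  factor \<open>s\<close> in front of the derivative of \<open>w\<close> comes from the dilation by
  \<open>s\<close>.\<close>

lemma integral_by_parts_fst:
  fixes w :: "real ^ 'n::finite \<Rightarrow> 'b::banach"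
  assumes m: "m \<ge> 1" and w: "Ck (Suc 0) w"
  shows "integral bigbox (\<lambda>z. (s * bump (Suc m) z * exp (s * snd z)) *\<^sub>R partial_deriv i w (x + s *\<^sub>R fst z)
           - (2 * real (Suc m) * fst z $ i * bump m z * exp (s * snd z)) *\<^sub>R w (x + s *\<^sub>R fst z)) = 0"
proof (rule integral_directional_derivative_eq_0)
  let ?g = "\<lambda>z. (bump (Suc m) z * exp (s * snd z)) *\<^sub>R w (x + s *\<^sub>R fst z)"
  let ?e = "(axis i 1, 0) :: (real^'n) \<times> real"
  have c: "continuous_on UNIV w" "continuous_on UNIV (partial_deriv i w)"
    using w by (auto simp: Ck_Suc Ck_0 Ck_continuous simp del: Ck_converges.simps intro: Ck_continuous[OF w])
  have d: "w differentiable (at x)" for x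
    using w by (auto simp: Ck_Suc simp del: Ck_converges.simps)
  show "continuous_on UNIV ?g"
    by (intro continuous_intros continuous_on_compose2[OF c(1)]) auto
  show "continuous_on UNIV (\<lambda>z. (s * bump (Suc m) z * exp (s * snd z)) *\<^sub>R partial_deriv i w (x + s *\<^sub>R fst z)
           - (2 * real (Suc m) * fst z $ i * bump m z * exp (s * snd z)) *\<^sub>R w (x + s *\<^sub>R fst z))"
    by (intro continuous_intros continuous_on_compose2[OF c(1)] continuous_on_compose2[OF c(2)]) auto
  show "norm ?e = 1" by (simp add: norm_Pair)
  show "?g y = 0" if "norm y \<ge> 1" for y
    using bump_outside[OF that, of "Suc m"] by simp
  show "((\<lambda>t. ?g (y + t *\<^sub>R ?e)) has_vector_derivative
     (s * bump (Suc m) (y + t *\<^sub>R ?e) * exp (s * snd (y + t *\<^sub>R ?e))) *\<^sub>R partial_deriv i w (x + s *\<^sub>R fst (y + t *\<^sub>R ?e))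
           - (2 * real (Suc m) * fst (y + t *\<^sub>R ?e) $ i * bump m (y + t *\<^sub>R ?e) * exp (s * snd (y + t *\<^sub>R ?e))) *\<^sub>R w (x + s *\<^sub>R fst (y + t *\<^sub>R ?e)))
     (at t)" for y t
  proof -
    from DERIV_cmult_right[OF has_real_derivative_bump[OF m, of y ?e t], of "exp (s * snd y)"]
    have 1: "((\<lambda>t. bump (Suc m) (y + t *\<^sub>R ?e) * exp (s * snd y)) has_real_derivative
      - (2 * real (Suc m) * (fst y $ i + t) * bump m (y + t *\<^sub>R ?e) * exp (s * snd y))) (at t)"
      by (rule DERIV_cong) (simp add: inner_prod_def inner_axis inner_add_left inner_axis_axis algebra_simps)
    have "(\<Sum>j\<in>UNIV. (s *\<^sub>R axis i (1::real)) $ j *\<^sub>R partial_deriv j w z) = s *\<^sub>R partial_deriv i w z" for z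
      using sum_axis_scaleR[of i "\<lambda>j. partial_deriv j w z"]
      by (simp flip: scaleR_scaleR scaleR_sum_right)
    with has_vector_derivative_along_line[OF d, of "x + s *\<^sub>R fst y" "s *\<^sub>R axis i 1" t]
    have 2: "((\<lambda>t. w (x + s *\<^sub>R (fst y + t *\<^sub>R axis i 1))) has_vector_derivative
      s *\<^sub>R partial_deriv i w (x + s *\<^sub>R (fst y + t *\<^sub>R axis i 1))) (at t)"
      by (simp add: algebra_simps)
    from has_vector_derivative_scaleR[OF 1 2]
    show ?thesis by (simp add: mult_ac)
  qed
qed

text \<open>The constant in the mean value identity: the total mass of the kernel at radius 0. The
  type argument carries the dimension.\<close>

definition bump_mass :: "'n::finite itself \<Rightarrow> real" where
  "bump_mass _ = integral (bigbox :: ((real ^ 'n) \<times> real) set) (bump 2)"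

lemma bump_mass_pos: "bump_mass TYPE('n::finite) > 0"
proof -
  let ?Q = "bigbox :: ((real ^ 'n) \<times> real) set"
  have c: "continuous_on ?Q (bump 2)"
    by (intro continuous_intros)
  have "(bump 2) integrable_on ?Q"
    using integrable_continuous c unfolding bigbox_def by blast
  then have "integral ?Q (bump 2) \<ge> 0"
    by (rule integral_nonneg) (simp add: bump_bounds)
  moreover have "integral ?Q (bump 2) \<noteq> 0"
  proof
    assume "integral ?Q (bump 2) = 0"
    moreover have "One \<bullet> b = 1" if "b \<in> Basis" for b :: "(real^'n) \<times> real"
      using that by (simp add: inner_sum_left inner_Basis)
    then have "box (- (2 *\<^sub>R One)) (2 *\<^sub>R One :: (real^'n) \<times> real) \<noteq> {}"
      unfolding box_ne_empty by simp
    ultimately have "\<forall>z\<in>?Q. bump 2 z = 0"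
      using integral_cbox_eq_0_iff[OF c[unfolded bigbox_def] _ bump_bounds(1)]
      unfolding bigbox_def by blast
    moreover have "0 \<in> ?Q"
      by (rule norm_le_2_imp_bigbox) simp
    ultimately show False by (auto simp: bump_def)
  qed
  ultimately show ?thesis by (simp add: bump_mass_def)
qed

text \<open>If \<open>u\<close> solves the Helmholtz equation, then \<open>(y, t) \<mapsto> exp t *\<^sub>R u y\<close> is harmonic. The derivative
  of its weighted mean over the ball of radius \<open>s\<close> vanishes because
  \<^term>\<open>z * bump 2 z\<close> is the gradient of \<^term>\<open>- bump 3 z / 6\<close>.\<close>

lemma helmholtz_mean_value:
  fixes u :: "real ^ 'n::finite \<Rightarrow> 'b::banach"
  assumes u: "helmholtz u"
  shows "kernel_mean (\<lambda>z. bump 2 z * exp (s * snd z)) s u x = bump_mass TYPE('n) *\<^sub>R u x"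
proof -
  let ?Q = "bigbox :: ((real ^ 'n) \<times> real) set"
  have C2: "Ck 2 u" and eq: "laplacian u x + u x = 0" for x
    using u by (auto simp: helmholtz_def)
  note cont = Ck_2_partials(3-5)[OF C2]
  define M where "M s = kernel_mean (\<lambda>z. bump 2 z * exp (s * snd z)) s u x" for s
  \<comment> \<open>The derivative in \<open>s\<close> of the integrand of \<open>M\<close>.\<close>
  define M' where "M' s z = (bump 2 z * exp (s * snd z)) *\<^sub>R (\<Sum>i\<in>UNIV. fst z $ i *\<^sub>R partial_deriv i u (x + s *\<^sub>R fst z))
      + (snd z * bump 2 z * exp (s * snd z)) *\<^sub>R u (x + s *\<^sub>R fst z)" for s and z :: "(real^'n) \<times> real"
  have M': "continuous_on UNIV (M' s)" for s
    unfolding M'_def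
    by (intro continuous_intros continuous_on_compose2[OF cont(1)] continuous_on_compose2[OF cont(2)]) auto
  have der: "(M has_vector_derivative integral ?Q (M' s)) (at s)" for s
    unfolding M_def kernel_mean_def bigbox_def
  proof (rule leibniz_rule_vector_derivative)
    fix s and z :: "(real^'n) \<times> real"
    have "((\<lambda>s. bump 2 z * exp (s * snd z)) has_real_derivative bump 2 z * (snd z * exp (s * snd z))) (at s)"
      by (auto intro!: derivative_eq_intros)
    from has_vector_derivative_scaleR[OF this has_vector_derivative_along_line[OF Ck_2_partials(6)[OF C2]]]
    show "((\<lambda>s. (bump 2 z * exp (s * snd z)) *\<^sub>R u (x + s *\<^sub>R fst z)) has_vector_derivative M' s z) (at s)"
      by (simp add: M'_def mult_ac)
  next
    show "continuous_on (UNIV \<times> cbox (- (2 *\<^sub>R One)) (2 *\<^sub>R One)) (\<lambda>(s, z). M' s z)"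
      unfolding split_beta M'_def
      by (intro continuous_intros continuous_on_compose2[OF cont(1)] continuous_on_compose2[OF cont(2)]) auto
    show "(\<lambda>z. (bump 2 z * exp (s * snd z)) *\<^sub>R u (x + s *\<^sub>R fst z)) integrable_on cbox (- (2 *\<^sub>R One)) (2 *\<^sub>R One)" for s
      by (intro integrable_continuous continuous_intros continuous_on_compose2[OF cont(1)]) auto
  qed auto
  have "integral ?Q (M' s) = 0" for s
  proof -
    define g where "g z = ((s * bump (Suc 2) z - 2 * real (Suc 2) * snd z * bump 2 z) * exp (s * snd z))
           *\<^sub>R u (x + s *\<^sub>R fst z)" for z :: "(real^'n) \<times> real"
    define h where "h i z = (s * bump (Suc 2) z * exp (s * snd z)) *\<^sub>R partial_deriv i (partial_deriv i u) (x + s *\<^sub>R fst z)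
           - (2 * real (Suc 2) * fst z $ i * bump 2 z * exp (s * snd z)) *\<^sub>R partial_deriv i u (x + s *\<^sub>R fst z)"
      for i and z :: "(real^'n) \<times> real"
    have "continuous_on ?Q g"
      unfolding g_def by (intro continuous_intros continuous_on_compose2[OF cont(1)]) auto
    then have gi: "g integrable_on ?Q"
      unfolding bigbox_def by (rule integrable_continuous)
    have "continuous_on ?Q (h i)" for i
      unfolding h_def by (intro continuous_intros continuous_on_compose2[OF cont(2)] continuous_on_compose2[OF cont(3)]) auto
    then have hi: "h i integrable_on ?Q" for i
      unfolding bigbox_def by (rule integrable_continuous)
    \<comment> \<open>The constant is twice the exponent 3 of the bump. What is left over on the
      right carries the factor \<open>laplacian u + u\<close>, which is 0.\<close>
    have "(-6) *\<^sub>R M' s z = g z + (\<Sum>i\<in>UNIV. h i z)" for z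
    proof -
      have "g z + (\<Sum>i\<in>UNIV. h i z) = (s * bump 3 z * exp (s * snd z)) *\<^sub>R (laplacian u (x + s *\<^sub>R fst z) + u (x + s *\<^sub>R fst z))
         - 6 *\<^sub>R M' s z"
        by (simp add: g_def h_def M'_def laplacian_def scaleR_sum_right sum_subtractf algebra_simps scaleR_add_right
            numeral_3_eq_3 eval_nat_numeral)
      then show ?thesis by (simp add: eq)
    qed
    then have "(-6) *\<^sub>R integral ?Q (M' s) = integral ?Q (\<lambda>z. g z + (\<Sum>i\<in>UNIV. h i z))"
      using integral_cmul[of "?Q" "-6" "M' s"] by simp
    also have "\<dots> = integral ?Q g + (\<Sum>i\<in>UNIV. integral ?Q (h i))"
      using gi hi by (simp add: integral_add integral_sum integrable_sum)
    also have "\<dots> = 0"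
      using integral_by_parts_snd[of 2 u s x] cont(1)
        integral_by_parts_fst[of 2 "partial_deriv i u" s i x for i, OF _ Ck_2_partials(2)[OF C2]]
      by (simp add: g_def[abs_def] h_def[abs_def])
    finally show ?thesis by simp
  qed
  with der have "(M has_vector_derivative 0) (at s)" for s
    by metis
  then obtain c where "\<And>s. M s = c"
    using has_vector_derivative_zero_constant[of UNIV M] by auto
  then have "M s = M 0" by simp
  \<comment> \<open>At radius 0 the kernel is \<open>bump 2\<close> and \<open>u\<close> is
    evaluated only at \<open>x\<close>.\<close>
  also have "M 0 = bump_mass TYPE('n) *\<^sub>R u x"
  proof -
    have "bump 2 integrable_on ?Q"
      unfolding bigbox_def by (intro integrable_continuous continuous_intros)
    from integral_linear[OF this bounded_linear_scaleR_left[of "u x"]] show ?thesis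
      by (simp add: M_def kernel_mean_def bump_mass_def o_def)
  qed
  finally show ?thesis by (simp add: M_def)
qed

section \<open>Derivatives of Helmholtz solutions as averages\<close>

text \<open>The result of differentiating the mean value identity and moving the derivative from
  \<open>u\<close> to the kernel: 4 is twice the exponent of \<open>bump 2\<close>, and the
  denominator combines the dilation with the mass.\<close>

definition gradient_kernel :: "'n::finite \<Rightarrow> real \<Rightarrow> (real ^ 'n) \<times> real \<Rightarrow> real" where
  "gradient_kernel i s z = 4 / (s * bump_mass TYPE('n)) * (fst z $ i * bump 1 z * exp (s * snd z))"

lemma continuous_on_gradient_kernel: "continuous_on S (gradient_kernel i s)"
  unfolding gradient_kernel_def[abs_def] by (intro continuous_intros)

text \<open>The right-hand side contains no derivative of \<open>u\<close>, so one derivative is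
  gained. Smoothness and the size of higher derivatives both rest on this gain.\<close>

lemma helmholtz_gradient:
  fixes u :: "real ^ 'n::finite \<Rightarrow> 'b::banach"
  assumes u: "helmholtz u" and s: "s > 0"
  shows "partial_deriv i u = kernel_mean (gradient_kernel i s) s u"
proof
  fix x
  let ?Q = "bigbox :: ((real ^ 'n) \<times> real) set" and ?c = "bump_mass TYPE('n)"
  let ?K = "\<lambda>z :: (real ^ 'n) \<times> real. bump 2 z * exp (s * snd z)"
  have C2: "Ck 2 u"
    using u by (auto simp: helmholtz_def)
  note cont = Ck_2_partials(3,4)[OF C2]
  have c: "?c > 0" by (rule bump_mass_pos)
  have K: "continuous_on UNIV ?K"
    by (intro continuous_intros)
  have "kernel_mean ?K s u = (\<lambda>x. ?c *\<^sub>R u x)"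
    using helmholtz_mean_value[OF u] by auto
  with partial_deriv_kernel_mean[OF K Ck_2_partials(1)[OF C2], of i s]
  have "kernel_mean ?K s (partial_deriv i u) x = partial_deriv i (\<lambda>x. ?c *\<^sub>R u x) x"
    by simp
  also have "\<dots> = ?c *\<^sub>R partial_deriv i u x"
    using Ck_2_partials(6)[OF C2]
    by (subst partial_deriv_eq[OF has_derivative_scaleR_right[OF has_derivative_partial_derivs]])
      (simp_all add: sum_axis_scaleR)
  finally have 1: "kernel_mean ?K s (partial_deriv i u) x = ?c *\<^sub>R partial_deriv i u x" .
  define f where "f z = ?K z *\<^sub>R partial_deriv i u (x + s *\<^sub>R fst z)" for z
  define g where "g z = gradient_kernel i s z *\<^sub>R u (x + s *\<^sub>R fst z)" for z
  have fg: "f integrable_on ?Q" "g integrable_on ?Q"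
    unfolding f_def g_def using cont K continuous_on_gradient_kernel kernel_mean_integrable by blast+
  have "0 = integral ?Q (\<lambda>z. s *\<^sub>R f z - (s * ?c) *\<^sub>R g z)"
    using integral_by_parts_fst[of 1 u s i x, OF _ Ck_2_partials(1)[OF C2]] s c
    by (simp add: f_def g_def gradient_kernel_def numeral_2_eq_2 mult_ac)
  also have "\<dots> = s *\<^sub>R integral ?Q f - (s * ?c) *\<^sub>R integral ?Q g"
    using fg by (simp add: integral_diff integrable_cmul)
  finally have "s *\<^sub>R (integral ?Q f - ?c *\<^sub>R integral ?Q g) = 0"
    by (simp add: algebra_simps)
  with s have "integral ?Q f = ?c *\<^sub>R integral ?Q g"
    by simp
  moreover have "integral ?Q f = ?c *\<^sub>R partial_deriv i u x"
    using 1 by (simp add: f_def[abs_def] kernel_mean_def)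
  ultimately show "partial_deriv i u x = kernel_mean (gradient_kernel i s) s u x"
    using c by (simp add: g_def[abs_def] kernel_mean_def)
qed

text \<open>The derivative is an average of translates of \<open>u\<close>, hence C^2 together with
  \<open>u\<close>, and averages of solutions are solutions. Iterated, this lifts a C^2 solution to
  a smooth one.\<close>

lemma helmholtz_partial_deriv:
  fixes u :: "real ^ 'n::finite \<Rightarrow> 'b::banach"
  assumes u: "helmholtz u"
  shows "helmholtz (partial_deriv i u)"
proof -
  let ?A = "kernel_mean (gradient_kernel i 1) 1 :: (real ^ 'n \<Rightarrow> 'b) \<Rightarrow> _"
  let ?Q = "bigbox :: ((real ^ 'n) \<times> real) set"
  have C2: "Ck 2 u" and eq: "laplacian u x + u x = 0" for x
    using u by (auto simp: helmholtz_def)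
  note K = continuous_on_gradient_kernel
  have A: "partial_deriv i u = ?A u"
    using helmholtz_gradient[OF u] by simp
  have pd: "partial_deriv j (partial_deriv j (?A u)) = ?A (partial_deriv j (partial_deriv j u))" for j
    using partial_deriv_kernel_mean[OF K] Ck_2_partials(1,2)[OF C2] by metis
  have "laplacian (?A u) x + ?A u x = 0" for x
  proof -
    let ?f = "\<lambda>w z. gradient_kernel i 1 z *\<^sub>R w (x + 1 *\<^sub>R fst z)"
    have int: "?f w integrable_on ?Q" if "continuous_on UNIV w" for w :: "real ^ 'n \<Rightarrow> 'b"
      using kernel_mean_integrable[OF K that] .
    have "laplacian (?A u) x + ?A u x = (\<Sum>j\<in>UNIV. integral ?Q (?f (partial_deriv j (partial_deriv j u)))) + integral ?Q (?f u)"
      by (simp add: laplacian_def pd kernel_mean_def)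
    also have "\<dots> = integral ?Q (\<lambda>z. (\<Sum>j\<in>UNIV. ?f (partial_deriv j (partial_deriv j u)) z) + ?f u z)"
      using int[OF Ck_2_partials(5)[OF C2]] int[OF Ck_2_partials(3)[OF C2]]
      by (subst integral_add, intro integrable_sum) (simp_all add: integral_sum)
    also have "\<dots> = integral ?Q (\<lambda>z. gradient_kernel i 1 z *\<^sub>R (laplacian u (x + 1 *\<^sub>R fst z) + u (x + 1 *\<^sub>R fst z)))"
      by (simp add: laplacian_def scaleR_add_right scaleR_sum_right)
    finally show ?thesis by (simp add: eq)
  qed
  moreover have "Ck 2 (?A u)"
    using Ck_kernel_mean[OF K C2] .
  ultimately show ?thesis
    unfolding A helmholtz_def by blast
qed

text \<open>One of the two partial derivatives is an average against a fixed kernel, and averaging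
  commutes with the other.\<close>

lemma helmholtz_partial_deriv_commute:
  fixes u :: "real ^ 'n::finite \<Rightarrow> 'b::banach"
  assumes u: "helmholtz u"
  shows "partial_deriv i (partial_deriv j u) = partial_deriv j (partial_deriv i u)"
proof -
  have "Ck (Suc 0) u"
    using u Ck_2_partials(1) by (auto simp: helmholtz_def)
  then have "partial_deriv i (kernel_mean (gradient_kernel j 1) 1 u) = kernel_mean (gradient_kernel j 1) 1 (partial_deriv i u)"
    by (rule partial_deriv_kernel_mean[OF continuous_on_gradient_kernel])
  then show ?thesis
    using helmholtz_gradient[OF u, of 1 j] helmholtz_gradient[OF helmholtz_partial_deriv[OF u], of 1 j] by simp
qed

lemma helmholtz_iterated_partial:
  fixes u :: "real ^ 'n::finite \<Rightarrow> 'b::banach"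
  shows "helmholtz u \<Longrightarrow> helmholtz (iterated_partial is u)"
  by (induction "is") (auto intro: helmholtz_partial_deriv)

lemma helmholtz_Ck:
  fixes u :: "real ^ 'n::finite \<Rightarrow> 'b::banach"
  shows "helmholtz u \<Longrightarrow> Ck k u"
proof (induction k arbitrary: u)
  case 0
  then show ?case using Ck_converges_mono[of 2 "\<lambda>_. u" u 0] by (simp add: helmholtz_def)
next
  case (Suc k)
  then show ?case
    unfolding Ck_Suc using helmholtz_partial_deriv Ck_2_partials(6) helmholtz_def by blast
qed

text \<open>Inside the unit ball the kernel is at most \<open>4 / (s * bump_mass) * exp s\<close>,
  outside it vanishes. The volume of \<open>bigbox\<close> serves as a crude bound for that of the
  ball.\<close>

lemma helmholtz_gradient_estimate:
  fixes u :: "real ^ 'n::finite \<Rightarrow> 'b::banach"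
  assumes u: "helmholtz u" and s: "s > 0" and M: "\<And>y. y \<in> cball x s \<Longrightarrow> norm (u y) \<le> M"
  shows "norm (partial_deriv i u x) \<le>
    4 * measure lborel (bigbox :: ((real ^ 'n) \<times> real) set) / bump_mass TYPE('n) * exp s / s * M"
proof -
  let ?Q = "bigbox :: ((real ^ 'n) \<times> real) set" and ?c = "bump_mass TYPE('n)"
  have c: "?c > 0" by (rule bump_mass_pos)
  have M0: "M \<ge> 0"
    using M[of x] s norm_ge_zero order_trans by (metis centre_in_cball less_imp_le)
  have "norm (partial_deriv i u x) \<le> (4 / (s * ?c) * exp s * M) * measure lborel ?Q"
    unfolding helmholtz_gradient[OF u s] kernel_mean_def bigbox_def
  proof (rule has_integral_bound[OF _ integrable_integral])
    have "continuous_on UNIV u"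
      using u Ck_2_partials(3) by (auto simp: helmholtz_def)
    from kernel_mean_integrable[OF continuous_on_gradient_kernel this]
    show "(\<lambda>z. gradient_kernel i s z *\<^sub>R u (x + s *\<^sub>R fst z)) integrable_on cbox (- (2 *\<^sub>R One)) (2 *\<^sub>R One)"
      unfolding bigbox_def .
    show "0 \<le> 4 / (s * ?c) * exp s * M"
      using s c M0 by simp
    fix z :: "(real ^ 'n) \<times> real"
    show "norm (gradient_kernel i s z *\<^sub>R u (x + s *\<^sub>R fst z)) \<le> 4 / (s * ?c) * exp s * M"
    proof (cases "norm z \<ge> 1")
      case True
      then show ?thesis using bump_outside[OF True, of 1] s c M0 by (simp add: gradient_kernel_def)
    next
      case False
      then have z: "norm (fst z) \<le> 1" "norm (snd z) \<le> 1"
        using norm_fst_le[of "fst z" "snd z"] norm_snd_le[of "snd z" "fst z"] by auto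
      have "\<bar>fst z $ i\<bar> \<le> 1"
        using component_le_norm_cart[of "fst z" i] z by linarith
      moreover have "\<bar>exp (s * snd z)\<bar> \<le> exp s"
        using z s by (simp add: mult_left_le)
      ultimately have "\<bar>fst z $ i * bump 1 z * exp (s * snd z)\<bar> \<le> 1 * 1 * exp s"
        unfolding abs_mult using bump_bounds[of 1 z] by (intro mult_mono) auto
      then have "\<bar>gradient_kernel i s z\<bar> \<le> 4 / (s * ?c) * exp s"
        using s c unfolding gradient_kernel_def abs_mult by (simp add: divide_right_mono)
      moreover have "norm (u (x + s *\<^sub>R fst z)) \<le> M"
        using z s by (intro M) (simp add: dist_norm)
      ultimately show ?thesis
        unfolding norm_scaleR using s c by (intro mult_mono) auto
    qed
  qed
  then show ?thesis by (simp add: mult_ac)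
qed

text \<open>Each derivative costs one step of length \<open>s\<close>, so \<open>u\<close> must be
  bounded on a ball of radius \<open>length is * s\<close>. The constant is chosen before
  \<open>u\<close> and \<open>s\<close>; the freedom in \<open>s\<close> is what later yields a
  convergent Taylor series.\<close>

lemma helmholtz_iterated_estimate:
  obtains C where "C > 0"
    "\<And>(u :: real ^ 'n::finite \<Rightarrow> 'b::banach) is x s M. helmholtz u \<Longrightarrow> s > 0 \<Longrightarrow>
       (\<And>y. y \<in> cball x (real (length is) * s) \<Longrightarrow> norm (u y) \<le> M) \<Longrightarrow>
       norm (iterated_partial is u x) \<le> (C * exp s / s) ^ length is * M"
proof -
  \<comment> \<open>The summand 1 makes the constant positive.\<close>
  define C where "C = 4 * measure lborel (bigbox :: ((real ^ 'n) \<times> real) set) / bump_mass TYPE('n) + 1"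
  have C: "C > 0"
    using bump_mass_pos[where 'n='n] by (simp add: C_def add_nonneg_pos)
  have "norm (iterated_partial is u x) \<le> (C * exp s / s) ^ length is * M"
    if u: "helmholtz u" and s: "s > 0" and "\<And>y. y \<in> cball x (real (length is) * s) \<Longrightarrow> norm (u y) \<le> M"
    for u :: "real ^ 'n \<Rightarrow> 'b" and "is" x s M
    using that(3)
  proof (induction "is" arbitrary: x)
    case Nil
    then show ?case by simp
  next
    case (Cons i "is")
    let ?B = "(C * exp s / s) ^ length is * M"
    have b: "norm (iterated_partial is u y) \<le> ?B" if y: "y \<in> cball x s" for y
    proof (rule Cons.IH)
      fix z assume "z \<in> cball y (real (length is) * s)"
      then have "z \<in> cball x (real (length (i # is)) * s)"
        using y dist_triangle[of x z y] by (simp add: algebra_simps)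
      then show "norm (u z) \<le> M" by (rule Cons.prems)
    qed
    have "?B \<ge> 0"
      using b[of x] s norm_ge_zero order_trans by (metis centre_in_cball less_imp_le)
    have "norm (iterated_partial (i # is) u x) \<le> (C - 1) * exp s / s * ?B"
      using helmholtz_gradient_estimate[OF helmholtz_iterated_partial[OF u, of "is"] s b, where i = i]
      by (simp add: C_def)
    also have "\<dots> \<le> C * exp s / s * ?B"
      using s \<open>?B \<ge> 0\<close> by (intro mult_right_mono divide_right_mono) auto
    finally show ?case by (simp add: mult_ac)
  qed
  with C that show thesis by blast
qed

section \<open>Taylor series of Helmholtz solutions\<close>

text \<open>The homogeneous part of degree j of the Taylor polynomial at 0, built by Euler's
  identity for homogeneous polynomials from those of the partial derivatives; no multi-indices
  appear.\<close>

primrec taylor_term :: "nat \<Rightarrow> (real ^ 'n::finite \<Rightarrow> 'b::real_normed_vector) \<Rightarrow> real ^ 'n \<Rightarrow> 'b" where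
  "taylor_term 0 u = (\<lambda>x. u 0)"
| "taylor_term (Suc j) u =
     (\<lambda>x. (1 / real (Suc j)) *\<^sub>R (\<Sum>i\<in>UNIV. x $ i *\<^sub>R taylor_term j (partial_deriv i u) x))"

lemma partial_deriv_const: "partial_deriv i (\<lambda>x. c) = (\<lambda>x. 0)"
  by (rule ext, subst partial_deriv_eq[OF has_derivative_const]) simp

lemma Ck_taylor_term: "Ck k (taylor_term j u)"
  by (induction j arbitrary: u) (auto intro!: Ck_converges_scaleR Ck_converges_sum Ck_component)

lemma taylor_term_scaleR: "taylor_term j u (r *\<^sub>R x) = r ^ j *\<^sub>R taylor_term j u x"
  by (induction j arbitrary: u) (simp_all add: scaleR_sum_right mult_ac)

lemma sum_component_taylor_term:
  "(\<Sum>i\<in>UNIV. x $ i *\<^sub>R taylor_term j (partial_deriv i u) x) = real (Suc j) *\<^sub>R taylor_term (Suc j) u x"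
  by simp

section \<open>Derivatives, Laplacian and parity of the Taylor terms\<close>

text \<open>As partial derivatives commute, differentiating the polynomial amounts to
  differentiating the function it comes from.\<close>

lemma has_derivative_taylor_term:
  fixes u :: "real ^ 'n::finite \<Rightarrow> 'b::banach"
  shows "helmholtz u \<Longrightarrow> (taylor_term (Suc j) u has_derivative
    (\<lambda>h. \<Sum>l\<in>UNIV. h $ l *\<^sub>R taylor_term j (partial_deriv l u) x)) (at x)"
proof (induction j arbitrary: u)
  case 0
  have "((\<lambda>x. \<Sum>i\<in>UNIV. x $ i *\<^sub>R partial_deriv i u 0) has_derivative
      (\<lambda>h. \<Sum>l\<in>UNIV. h $ l *\<^sub>R partial_deriv l u 0)) (at x)"
    by (intro has_derivative_sum has_derivative_scaleR_left bounded_linear_imp_has_derivative bounded_linear_vec_nth)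
  then show ?case by simp
next
  case (Suc j)
  have "((\<lambda>x. (1 / real (Suc (Suc j))) *\<^sub>R (\<Sum>i\<in>UNIV. x $ i *\<^sub>R taylor_term (Suc j) (partial_deriv i u) x)) has_derivative
    (\<lambda>h. (1 / real (Suc (Suc j))) *\<^sub>R (\<Sum>i\<in>UNIV. x $ i *\<^sub>R (\<Sum>l\<in>UNIV. h $ l *\<^sub>R taylor_term j (partial_deriv l (partial_deriv i u)) x)
       + h $ i *\<^sub>R taylor_term (Suc j) (partial_deriv i u) x))) (at x)"
    by (intro has_derivative_scaleR_right has_derivative_sum has_derivative_scaleR
        bounded_linear_imp_has_derivative[OF bounded_linear_vec_nth] Suc.IH helmholtz_partial_deriv Suc.prems)
  \<comment> \<open>Differentiating the explicit factor \<open>x $ i\<close> gives one copy of the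
    right-hand side; the inner terms give \<open>Suc j\<close> copies, by commuting derivatives and
    Euler's identity. The prefactor cancels their number.\<close>
  moreover have E: "(1 / real (Suc (Suc j))) *\<^sub>R (\<Sum>i\<in>UNIV. x $ i *\<^sub>R (\<Sum>l\<in>UNIV. h $ l *\<^sub>R taylor_term j (partial_deriv l (partial_deriv i u)) x)
       + h $ i *\<^sub>R taylor_term (Suc j) (partial_deriv i u) x)
     = (\<Sum>l\<in>UNIV. h $ l *\<^sub>R taylor_term (Suc j) (partial_deriv l u) x)" for h
  proof -
    have "(\<Sum>i\<in>UNIV. x $ i *\<^sub>R (\<Sum>l\<in>UNIV. h $ l *\<^sub>R taylor_term j (partial_deriv l (partial_deriv i u)) x))
      = (\<Sum>i\<in>UNIV. \<Sum>l\<in>UNIV. (h $ l * x $ i) *\<^sub>R taylor_term j (partial_deriv i (partial_deriv l u)) x)"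
      unfolding scaleR_sum_right scaleR_scaleR
      by (intro sum.cong refl, subst helmholtz_partial_deriv_commute[OF Suc.prems]) (simp add: mult.commute)
    also have "\<dots> = (\<Sum>l\<in>UNIV. h $ l *\<^sub>R (\<Sum>i\<in>UNIV. x $ i *\<^sub>R taylor_term j (partial_deriv i (partial_deriv l u)) x))"
      by (subst sum.swap) (simp add: scaleR_sum_right)
    also have "\<dots> = real (Suc j) *\<^sub>R (\<Sum>l\<in>UNIV. h $ l *\<^sub>R taylor_term (Suc j) (partial_deriv l u) x)"
      unfolding sum_component_taylor_term by (simp add: scaleR_sum_right mult.commute del: taylor_term.simps)
    finally have "(\<Sum>i\<in>UNIV. x $ i *\<^sub>R (\<Sum>l\<in>UNIV. h $ l *\<^sub>R taylor_term j (partial_deriv l (partial_deriv i u)) x)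
       + h $ i *\<^sub>R taylor_term (Suc j) (partial_deriv i u) x)
      = real (Suc j) *\<^sub>R (\<Sum>l\<in>UNIV. h $ l *\<^sub>R taylor_term (Suc j) (partial_deriv l u) x)
        + (\<Sum>l\<in>UNIV. h $ l *\<^sub>R taylor_term (Suc j) (partial_deriv l u) x)"
      by (simp add: sum.distrib del: taylor_term.simps)
    also have "\<dots> = real (Suc (Suc j)) *\<^sub>R (\<Sum>l\<in>UNIV. h $ l *\<^sub>R taylor_term (Suc j) (partial_deriv l u) x)"
      unfolding of_nat_Suc[of "Suc j"] scaleR_add_left scaleR_one by (rule add.commute)
    finally show ?thesis by (simp del: taylor_term.simps)
  qed
  ultimately show ?case
    unfolding taylor_term.simps(2)[of "Suc j"] by (simp only: E)
qed

lemma partial_deriv_taylor_term: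
  fixes u :: "real ^ 'n::finite \<Rightarrow> 'b::banach"
  shows "helmholtz u \<Longrightarrow> partial_deriv l (taylor_term (Suc j) u) = taylor_term j (partial_deriv l u)"
    "partial_deriv l (taylor_term 0 u) = (\<lambda>x. 0)"
  by (rule ext, subst partial_deriv_eq[OF has_derivative_taylor_term], assumption, rule sum_axis_scaleR)
    (simp add: partial_deriv_const)

text \<open>The Taylor terms of the two sides of the Helmholtz equation. Induction on the degree,
  using that third derivatives may be interchanged, reduces this to the equation at the
  origin.\<close>

lemma sum_taylor_term_second_partial:
  fixes u :: "real ^ 'n::finite \<Rightarrow> 'b::banach"
  shows "helmholtz u \<Longrightarrow> (\<Sum>l\<in>UNIV. taylor_term j (partial_deriv l (partial_deriv l u)) x) = - taylor_term j u x"
proof (induction j arbitrary: u)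
  case 0
  then show ?case
    by (auto simp: helmholtz_def laplacian_def eq_neg_iff_add_eq_0)
next
  case (Suc j)
  have "(\<Sum>l\<in>UNIV. taylor_term (Suc j) (partial_deriv l (partial_deriv l u)) x)
    = (1 / real (Suc j)) *\<^sub>R (\<Sum>i\<in>UNIV. x $ i *\<^sub>R (\<Sum>l\<in>UNIV. taylor_term j (partial_deriv i (partial_deriv l (partial_deriv l u))) x))"
    by (simp add: scaleR_sum_right) (rule sum.swap)
  also have "\<dots> = (1 / real (Suc j)) *\<^sub>R (\<Sum>i\<in>UNIV. x $ i *\<^sub>R (\<Sum>l\<in>UNIV. taylor_term j (partial_deriv l (partial_deriv l (partial_deriv i u))) x))"
  proof -
    have com: "partial_deriv i (partial_deriv l (partial_deriv l u)) = partial_deriv l (partial_deriv l (partial_deriv i u))" for i l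
      using helmholtz_partial_deriv_commute[OF helmholtz_partial_deriv[OF Suc.prems], of i l l]
        helmholtz_partial_deriv_commute[OF Suc.prems, of i l] by (rule trans[OF _ arg_cong])
    show ?thesis
      by (intro arg_cong[of _ _ "scaleR _"] sum.cong refl) (rule fun_cong[OF arg_cong[OF com, of "taylor_term j"]])
  qed
  also have "\<dots> = - taylor_term (Suc j) u x"
    using Suc.IH[OF helmholtz_partial_deriv[OF Suc.prems]] by (simp add: sum_negf)
  finally show ?case .
qed

lemma laplacian_taylor_term:
  fixes u :: "real ^ 'n::finite \<Rightarrow> 'b::banach"
  assumes u: "helmholtz u"
  shows "laplacian (taylor_term (Suc (Suc j)) u) x = - taylor_term j u x"
    "laplacian (taylor_term 0 u) x = 0" "laplacian (taylor_term (Suc 0) u) x = 0"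
  unfolding laplacian_def
  by (simp_all add: partial_deriv_taylor_term u helmholtz_partial_deriv sum_taylor_term_second_partial
      partial_deriv_const del: taylor_term.simps)

text \<open>The sign is kept as a power so that a derivative, which flips the parity, just raises
  \<open>p\<close> by one.\<close>

lemma taylor_term_parity:
  fixes u :: "real ^ 'n::finite \<Rightarrow> 'b::banach"
  shows "helmholtz u \<Longrightarrow> (\<And>x. u (- x) = (- 1) ^ p *\<^sub>R u x) \<Longrightarrow> odd (p + j) \<Longrightarrow> taylor_term j u x = 0"
proof (induction j arbitrary: u p)
  case 0
  have "u 0 = - u 0"
    using 0(2)[of 0] 0(3) by simp
  then show ?case by (simp add: eq_neg_iff_add_eq_0 flip: scaleR_2)
next
  case (Suc j)
  have d: "u differentiable (at x)" for x
    using Suc.prems(1) Ck_2_partials(6) by (auto simp: helmholtz_def)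
  have "taylor_term j (partial_deriv i u) x = 0" for i
  proof (rule Suc.IH[OF helmholtz_partial_deriv[OF Suc.prems(1)], of _ "Suc p"])
    fix y
    have "((\<lambda>x. u (- x)) has_derivative (\<lambda>h. \<Sum>i\<in>UNIV. (- h) $ i *\<^sub>R partial_deriv i u (- y))) (at y)"
      by (rule has_derivative_compose[OF has_derivative_minus[OF has_derivative_ident] has_derivative_partial_derivs[OF d]])
    from partial_deriv_eq[OF this, of i]
    have "partial_deriv i (\<lambda>x. u (- x)) y = - partial_deriv i u (- y)"
      by (simp add: sum_negf sum_axis_scaleR)
    moreover have "partial_deriv i (\<lambda>x. u (- x)) y = (- 1) ^ p *\<^sub>R partial_deriv i u y"
      unfolding Suc.prems(2)
      by (subst partial_deriv_eq[OF has_derivative_scaleR_right[OF has_derivative_partial_derivs[OF d]]])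
        (simp add: sum_axis_scaleR)
    ultimately show "partial_deriv i u (- y) = (- 1) ^ Suc p *\<^sub>R partial_deriv i u y"
      by (metis minus_equation_iff mult_minus1 power_Suc scaleR_minus_left)
  qed (use Suc.prems in simp)
  then show ?case by simp
qed

section \<open>Bounds for the Taylor terms and the remainder\<close>

lemma norm_sum_component_scaleR_le:
  fixes x :: "real ^ 'n::finite" and f :: "'n \<Rightarrow> 'b::real_normed_vector"
  assumes "\<And>i. norm (f i) \<le> B"
  shows "norm (\<Sum>i\<in>UNIV. x $ i *\<^sub>R f i) \<le> real CARD('n) * norm x * B"
proof -
  have "norm (\<Sum>i\<in>UNIV. x $ i *\<^sub>R f i) \<le> (\<Sum>i\<in>(UNIV::'n set). norm x * B)"
    using assms component_le_norm_cart[of x]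
    by (intro sum_norm_le) (auto intro!: mult_mono)
  then show ?thesis by simp
qed

text \<open>In each degree one factor \<open>CARD('n)\<close> pays for the sum over the
  coordinates.\<close>

lemma taylor_term_bound:
  fixes u :: "real ^ 'n::finite \<Rightarrow> 'b::real_normed_vector"
  shows "(\<And>is. length is = j \<Longrightarrow> norm (iterated_partial is u 0) \<le> M) \<Longrightarrow>
    norm (taylor_term j u x) \<le> (real CARD('n) * norm x) ^ j / fact j * M"
proof (induction j arbitrary: u)
  case 0
  then show ?case using 0[of "[]"] by simp
next
  case (Suc j)
  have "norm (taylor_term j (partial_deriv i u) x) \<le> (real CARD('n) * norm x) ^ j / fact j * M" for i
    using Suc.prems[of "is @ [i]" for "is"] by (intro Suc.IH) (simp add: iterated_partial_snoc)
  from norm_sum_component_scaleR_le[of "\<lambda>i. taylor_term j (partial_deriv i u) x", OF this]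
  have "norm (taylor_term (Suc j) u x)
      \<le> 1 / real (Suc j) * (real CARD('n) * norm x * ((real CARD('n) * norm x) ^ j / fact j * M))"
    unfolding taylor_term.simps(2) norm_scaleR by (intro mult_mono) auto
  also have "\<dots> = (real CARD('n) * norm x) ^ Suc j / fact (Suc j) * M"
    by simp
  finally show ?case .
qed

text \<open>Along the ray to \<open>x\<close> the derivative of the remainder combines the
  remainders of the partial derivatives with one term less; the induction hypothesis bounds these,
  and the bound is integrated.\<close>

lemma taylor_remainder:
  fixes u :: "real ^ 'n::finite \<Rightarrow> 'b::banach"
  shows "helmholtz u \<Longrightarrow> (\<And>is y. length is = m \<Longrightarrow> norm y \<le> \<rho> \<Longrightarrow> norm (iterated_partial is u y) \<le> M) \<Longrightarrow>
    norm x \<le> \<rho> \<Longrightarrow> norm (u x - (\<Sum>j<m. taylor_term j u x)) \<le> (real CARD('n) * norm x) ^ m / fact m * M"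
proof (induction m arbitrary: u x)
  case 0
  then show ?case using 0(2)[of "[]"] by simp
next
  case (Suc m)
  let ?n = "real CARD('n)"
  have d: "u differentiable (at x)" for x
    using Suc.prems(1) Ck_2_partials(6) by (auto simp: helmholtz_def)
  define e where "e t = u (t *\<^sub>R x) - (u 0 + (\<Sum>j<m. taylor_term (Suc j) u (t *\<^sub>R x)))" for t
  define e' where "e' t = (\<Sum>i\<in>UNIV. x $ i *\<^sub>R (partial_deriv i u (t *\<^sub>R x) - (\<Sum>j<m. taylor_term j (partial_deriv i u) (t *\<^sub>R x))))" for t
  have der: "(e has_vector_derivative e' t) (at t)" for t
  proof -
    have 1: "((\<lambda>y. u y - (u 0 + (\<Sum>j<m. taylor_term (Suc j) u y))) has_derivative
      (\<lambda>h. (\<Sum>i\<in>UNIV. h $ i *\<^sub>R partial_deriv i u (t *\<^sub>R x))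
        - (0 + (\<Sum>j<m. \<Sum>i\<in>UNIV. h $ i *\<^sub>R taylor_term j (partial_deriv i u) (t *\<^sub>R x))))) (at (t *\<^sub>R x))"
      by (intro has_derivative_diff has_derivative_add has_derivative_sum has_derivative_taylor_term
          has_derivative_const has_derivative_partial_derivs d Suc.prems(1))
    have 2: "((\<lambda>t. t *\<^sub>R x) has_derivative (\<lambda>h. h *\<^sub>R x)) (at t)"
      by (rule has_derivative_eq_rhs, (rule derivative_intros)+) simp
    have "(e has_derivative (\<lambda>h. (\<Sum>i\<in>UNIV. (h *\<^sub>R x) $ i *\<^sub>R partial_deriv i u (t *\<^sub>R x))
        - (0 + (\<Sum>j<m. \<Sum>i\<in>UNIV. (h *\<^sub>R x) $ i *\<^sub>R taylor_term j (partial_deriv i u) (t *\<^sub>R x))))) (at t)"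
      unfolding e_def[abs_def] by (rule has_derivative_compose[OF 2 1])
    moreover have "(\<Sum>j<m. \<Sum>i\<in>UNIV. (h *\<^sub>R x) $ i *\<^sub>R taylor_term j (partial_deriv i u) (t *\<^sub>R x))
      = h *\<^sub>R (\<Sum>i\<in>UNIV. x $ i *\<^sub>R (\<Sum>j<m. taylor_term j (partial_deriv i u) (t *\<^sub>R x)))" for h
      by (subst sum.swap) (simp add: scaleR_sum_right)
    ultimately show ?thesis
      unfolding has_vector_derivative_def e'_def
      by (simp add: scaleR_sum_right scaleR_diff_right sum_subtractf)
  qed
  \<comment> \<open>The antiderivative, along the ray, of the bound that the induction hypothesis
    provides.\<close>
  define \<phi> where "\<phi> t = (?n * norm x) ^ Suc m / fact (Suc m) * M * t ^ Suc m" for t :: real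
  have \<phi>: "(\<phi> has_vector_derivative ?n * norm x * ((?n * norm (t *\<^sub>R x)) ^ m / fact m * M)) (at t)" if "t > 0" for t
  proof -
    have "(\<phi> has_real_derivative (?n * norm x) ^ Suc m / fact (Suc m) * M * (real (Suc m) * t ^ m)) (at t)"
      unfolding \<phi>_def by (rule DERIV_cmult, rule DERIV_cong[OF DERIV_pow]) simp
    moreover have "(?n * norm x) ^ Suc m / fact (Suc m) * M * (real (Suc m) * t ^ m) =
        ?n * norm x * ((?n * norm (t *\<^sub>R x)) ^ m / fact m * M)"
    proof -
      have "(?n * norm (t *\<^sub>R x)) ^ m = (?n * norm x) ^ m * t ^ m"
        using that by (simp add: power_mult_distrib mult_ac)
      then show ?thesis by (simp only:) (simp add: divide_simps)
    qed
    ultimately show ?thesis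
      by (simp only: has_real_derivative_iff_has_vector_derivative)
  qed
  have "norm (e 1 - e 0) \<le> \<phi> 1 - \<phi> 0"
  proof (rule differentiable_bound_general)
    fix t :: real assume t: "0 < t" "t < 1"
    show "(e has_vector_derivative e' t) (at t)" by (rule der)
    show "(\<phi> has_vector_derivative ?n * norm x * ((?n * norm (t *\<^sub>R x)) ^ m / fact m * M)) (at t)"
      using \<phi> t by simp
    have "norm (t *\<^sub>R x) \<le> \<rho>"
      using t Suc.prems(3) mult_left_le_one_le[of "norm x" t] by simp
    then have "norm (partial_deriv i u (t *\<^sub>R x) - (\<Sum>j<m. taylor_term j (partial_deriv i u) (t *\<^sub>R x)))
        \<le> (?n * norm (t *\<^sub>R x)) ^ m / fact m * M" for i
      using Suc.prems(2)[of "is @ [i]" for "is"]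
      by (intro Suc.IH helmholtz_partial_deriv Suc.prems(1)) (simp_all add: iterated_partial_snoc)
    from norm_sum_component_scaleR_le[OF this]
    show "norm (e' t) \<le> ?n * norm x * ((?n * norm (t *\<^sub>R x)) ^ m / fact m * M)"
      unfolding e'_def .
  next
    show "continuous_on {0..1} e"
      by (intro continuous_at_imp_continuous_on ballI has_vector_derivative_continuous[OF der])
    show "continuous_on {0..1} \<phi>"
      unfolding \<phi>_def by (intro continuous_intros)
  qed simp
  moreover have "e 0 = 0"
    by (simp add: e_def)
  moreover have "e 1 = u x - (\<Sum>j<Suc m. taylor_term j u x)"
    unfolding e_def by (subst sum.lessThan_Suc_shift) (simp del: taylor_term.simps(2))
  ultimately show ?case by (simp add: \<phi>_def)
qed

text \<open>A single term of the series for \<open>exp (real m)\<close> is at most its sum; this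
  weak form of Stirling's formula is all that is needed of factorials.\<close>

lemma power_self_le_exp_fact: "real m ^ m \<le> exp (real m) * fact m"
proof -
  have "real m ^ m / fact m \<le> (\<Sum>k. real m ^ k / fact k)"
    using sum_le_suminf[of "\<lambda>k. real m ^ k / fact k" "{m}"] summable_exp[of "real m"] by (simp add: divide_inverse mult.commute)
  then show ?thesis
    by (simp add: exp_def divide_simps scaleR_conv_of_real)
qed

text \<open>A solution is bounded on every ball, so a total radius r can be divided among m
  derivatives; the resulting \<open>(C * m / r) ^ m\<close> is absorbed by \<open>fact m\<close>. A
  larger r gives a smaller ratio, which is why the series converges on balls of any size.\<close>

lemma taylor_geometric_bound:
  fixes u :: "real ^ 'n::finite \<Rightarrow> 'b::euclidean_space"
  assumes u: "helmholtz u" and \<rho>: "\<rho> > 0"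
  obtains K where "K \<ge> 0"
    "\<And>j x. norm x \<le> \<rho> \<Longrightarrow> norm (taylor_term j u x) \<le> K / 2 ^ j"
    "\<And>m x. norm x \<le> \<rho> \<Longrightarrow> norm (u x - (\<Sum>j<m. taylor_term j u x)) \<le> K / 2 ^ m"
proof -
  let ?n = "real CARD('n)"
  obtain C where C: "C > 0"
    "\<And>(u :: real ^ 'n \<Rightarrow> 'b) is x s M. helmholtz u \<Longrightarrow> s > 0 \<Longrightarrow>
       (\<And>y. y \<in> cball x (real (length is) * s) \<Longrightarrow> norm (u y) \<le> M) \<Longrightarrow>
       norm (iterated_partial is u x) \<le> (C * exp s / s) ^ length is * M"
    using helmholtz_iterated_estimate by blast
  have n: "?n > 0" by simp
  \<comment> \<open>Chosen so that \<open>CARD('n) * \<rho> * C / r * exp 1\<close> is one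
    half.\<close>
  define r where "r = 2 * exp 1 * ?n * \<rho> * C"
  have r: "r > 0" using C(1) \<rho> n unfolding r_def by (intro mult_pos_pos) auto
  have "compact (u ` cball 0 (\<rho> + r))"
    by (intro compact_continuous_image continuous_on_subset[OF Ck_continuous[OF helmholtz_Ck[OF u]]]) auto
  from compact_imp_bounded[OF this] obtain M where "\<forall>z\<in>u ` cball 0 (\<rho> + r). norm z \<le> M"
    unfolding bounded_iff by blast
  then have M: "norm (u y) \<le> M" if "norm y \<le> \<rho> + r" for y
    using that by auto
  have M0: "M \<ge> 0" using M[of 0] \<rho> r norm_ge_zero order_trans by (metis add_pos_pos less_imp_le norm_zero)
  define K where "K = exp r * M"
  have K: "K \<ge> 0" using M0 by (simp add: K_def)
  define B where "B m = (C * real m / r) ^ m * exp r * M" for m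
  have it: "norm (iterated_partial is u y) \<le> B (length is)" if y: "norm y \<le> \<rho>" for "is" y
  proof (cases "is = []")
    case True
    have "M \<le> exp r * M"
      using r M0 by (simp add: mult_le_cancel_right1)
    then show ?thesis using True M[of y] y r by (simp add: B_def)
  next
    case False
    let ?m = "real (length is)"
    have m: "?m > 0" using False by simp
    \<comment> \<open>The steps have length r divided by the number of derivatives, so that they add
      up to r and their exponentials multiply to \<open>exp r\<close>.\<close>
    have "norm (iterated_partial is u y) \<le> (C * exp (r / ?m) / (r / ?m)) ^ length is * M"
    proof (rule C(2)[OF u])
      fix z assume "z \<in> cball y (?m * (r / ?m))"
      then have "norm (z - y) \<le> r" using m by (simp add: dist_norm norm_minus_commute)
      then show "norm (u z) \<le> M"
        using y norm_triangle_ineq[of "z - y" y] by (intro M) simp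
    qed (use r m in simp)
    also have "\<dots> = B (length is)"
      using m exp_of_nat_mult[of "length is" "r / ?m"] by (simp add: B_def power_divide power_mult_distrib)
    finally show ?thesis .
  qed
  have B: "(?n * norm x) ^ m / fact m * B m \<le> K / 2 ^ m" if "norm x \<le> \<rho>" for x :: "real^'n" and m
  proof -
    have "(?n * norm x) ^ m / fact m * B m \<le> (?n * \<rho>) ^ m / fact m * B m"
      using that C(1) r M0 by (intro mult_right_mono divide_right_mono power_mono) (auto simp: B_def)
    also have "\<dots> = (?n * \<rho> * C / r) ^ m * (real m ^ m / fact m) * K"
      by (simp add: B_def K_def power_mult_distrib power_divide mult_ac)
    also have "\<dots> \<le> (?n * \<rho> * C / r) ^ m * exp 1 ^ m * K"
      using power_self_le_exp_fact[of m] exp_of_nat_mult[of m "1::real"] \<rho> C(1) r K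
      by (intro mult_right_mono mult_left_mono) (auto simp: field_simps)
    also have "\<dots> = (?n * \<rho> * C / r * exp 1) ^ m * K"
      by (simp only: power_mult_distrib)
    also have "?n * \<rho> * C / r * exp 1 = 1 / 2"
      using \<rho> C(1) n by (simp add: r_def)
    finally show ?thesis by (simp add: power_divide)
  qed
  show thesis
  proof (rule that[OF K])
    fix j x assume x: "norm (x::real^'n) \<le> \<rho>"
    have "norm (taylor_term j u x) \<le> (?n * norm x) ^ j / fact j * B j"
      using it[of 0] \<rho> by (intro taylor_term_bound) auto
    with B[OF x] show "norm (taylor_term j u x) \<le> K / 2 ^ j" by (rule order_trans[rotated])
    have "norm (u x - (\<Sum>i<j. taylor_term i u x)) \<le> (?n * norm x) ^ j / fact j * B j"
      using it by (intro taylor_remainder[OF u _ x]) auto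
    with B[OF x] show "norm (u x - (\<Sum>i<j. taylor_term i u x)) \<le> K / 2 ^ j" by (rule order_trans[rotated])
  qed
qed

section \<open>Composition and \<open>C\<^sup>k\<close> convergence\<close>

lemma has_derivative_vec_nth_compose:
  "(g has_derivative g') F \<Longrightarrow> ((\<lambda>x. g x $ l) has_derivative (\<lambda>h. g' h $ l)) F"
  by (rule bounded_linear.has_derivative[OF bounded_linear_vec_nth])

lemma Ck_converges_component:
  fixes G :: "nat \<Rightarrow> real ^ 'n::finite \<Rightarrow> real ^ 'm::finite"
  shows "Ck_converges k G g \<Longrightarrow> Ck_converges k (\<lambda>N x. G N x $ l) (\<lambda>x. g x $ l)"
proof (induction k arbitrary: G g)
  case 0
  have "uniform_limit X (\<lambda>N x. G N x $ l) (\<lambda>x. g x $ l) sequentially"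
    if "uniform_limit X G g sequentially" for X
    using that unfolding uniform_limit_iff
    by (elim all_forward imp_forward eventually_mono) (auto intro: le_less_trans[OF dist_vec_nth_le])
  with 0 show ?case
    by (auto simp: C0_converges_def intro!: continuous_on_component)
next
  case (Suc k)
  show ?case
  proof (rule Ck_converges_SucI)
    show "C0_converges (\<lambda>N x. G N x $ l) (\<lambda>x. g x $ l)"
      using Suc C0_if_Ck_converges Ck_converges_SucD by blast
    show "Ck_converges k (\<lambda>N x. partial_deriv i (G N) x $ l) (\<lambda>x. partial_deriv i g x $ l)" for i
      using Suc by auto
    have D: "((\<lambda>x. w x $ l) has_derivative (\<lambda>h. \<Sum>i\<in>UNIV. h $ i *\<^sub>R (partial_deriv i w x $ l))) (at x)"
      if "w differentiable (at x)" for w :: "real^'n \<Rightarrow> real^'m" and x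
      by (rule has_derivative_eq_rhs[OF has_derivative_vec_nth_compose[OF has_derivative_partial_derivs[OF that]]])
        simp
    show "((\<lambda>x. G N x $ l) has_derivative (\<lambda>h. \<Sum>i\<in>UNIV. h $ i *\<^sub>R (partial_deriv i (G N) x $ l))) (at x)" for N x
      using Suc.prems by (intro D) auto
    show "((\<lambda>x. g x $ l) has_derivative (\<lambda>h. \<Sum>i\<in>UNIV. h $ i *\<^sub>R (partial_deriv i g x $ l))) (at x)" for x
      using Suc.prems by (intro D) auto
  qed
qed

text \<open>For large N the points \<open>Y N x\<close> stay within distance 1 of a bounded set, and
  the limit is uniformly continuous on the enlarged ball; hence the map and its argument may vary
  together.\<close>

lemma C0_converges_compose:
  fixes F :: "nat \<Rightarrow> real ^ 'm::finite \<Rightarrow> 'b::real_normed_vector" and Y :: "nat \<Rightarrow> real ^ 'n::finite \<Rightarrow> real ^ 'm"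
  assumes F: "C0_converges F f" and Y: "C0_converges Y y"
  shows "C0_converges (\<lambda>N x. F N (Y N x)) (\<lambda>x. f (y x))"
  unfolding C0_converges_def
proof (intro conjI allI)
  show "continuous_on UNIV (\<lambda>x. F N (Y N x))" for N
    by (rule continuous_on_compose2[of UNIV "F N" UNIV "Y N"]) (use F Y in \<open>auto simp: C0_converges_def\<close>)
  show "continuous_on UNIV (\<lambda>x. f (y x))"
    by (rule continuous_on_compose2[of UNIV f UNIV y]) (use F Y in \<open>auto simp: C0_converges_def\<close>)
  fix \<rho>
  have "compact (y ` cball 0 \<rho>)"
    by (rule compact_continuous_image, rule continuous_on_subset[of UNIV]) (use Y in \<open>auto simp: C0_converges_def\<close>)
  from compact_imp_bounded[OF this] obtain B where "\<forall>z\<in>y ` cball 0 \<rho>. norm z \<le> B"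
    unfolding bounded_iff by blast
  then have B: "norm (y x) \<le> B" if "x \<in> cball 0 \<rho>" for x
    using that by blast
  have unif: "uniformly_continuous_on (cball 0 (B + 1)) f"
    by (rule compact_uniformly_continuous, rule continuous_on_subset[of UNIV]) (use F in \<open>auto simp: C0_converges_def\<close>)
  show "uniform_limit (cball 0 \<rho>) (\<lambda>N x. F N (Y N x)) (\<lambda>x. f (y x)) sequentially"
  proof (rule uniform_limitI)
    fix e :: real assume e: "e > 0"
    obtain d where d: "d > 0" "\<And>z z'. z \<in> cball 0 (B + 1) \<Longrightarrow> z' \<in> cball 0 (B + 1) \<Longrightarrow> dist z' z < d \<Longrightarrow> dist (f z') (f z) < e / 2"
      using unif e unfolding uniformly_continuous_on_def by (meson half_gt_zero)
    have "\<forall>\<^sub>F N in sequentially. \<forall>z\<in>cball 0 (B + 1). dist (F N z) (f z) < e / 2"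
      using F e unfolding C0_converges_def uniform_limit_iff by (meson half_gt_zero)
    moreover have "\<forall>\<^sub>F N in sequentially. \<forall>x\<in>cball 0 \<rho>. dist (Y N x) (y x) < min d 1"
      using Y d(1) unfolding C0_converges_def uniform_limit_iff by (meson min_less_iff_conj zero_less_one)
    ultimately show "\<forall>\<^sub>F N in sequentially. \<forall>x\<in>cball 0 \<rho>. dist (F N (Y N x)) (f (y x)) < e"
    proof eventually_elim
      case (elim N)
      show ?case
      proof
        fix x assume x: "x \<in> cball (0::real^'n) \<rho>"
        have yd: "dist (Y N x) (y x) < d" "dist (Y N x) (y x) < 1"
          using elim(2) x by auto
        have "norm (Y N x) \<le> B + 1"
          using B[OF x] yd(2) norm_triangle_ineq[of "Y N x - y x" "y x"] by (simp add: dist_norm)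
        moreover have "norm (y x) \<le> B + 1" using B[OF x] by simp
        ultimately have "dist (F N (Y N x)) (f (Y N x)) < e / 2" "dist (f (Y N x)) (f (y x)) < e / 2"
          using elim(1) d(2)[of "y x" "Y N x"] yd by auto
        then show "dist (F N (Y N x)) (f (y x)) < e"
          using dist_triangle_half_l dist_commute by (metis dist_triangle_lt add_less_cancel_left dist_triangle_half_r)
      qed
    qed
  qed
qed

lemma has_derivative_compose_partials:
  fixes q :: "real ^ 'm::finite \<Rightarrow> 'b::real_normed_vector" and Y :: "real^'n::finite \<Rightarrow> real^'m"
  assumes "q differentiable (at (Y x))" "Y differentiable (at x)"
  shows "((\<lambda>x. q (Y x)) has_derivative
    (\<lambda>h. \<Sum>i\<in>UNIV. h $ i *\<^sub>R (\<Sum>l\<in>UNIV. partial_deriv i Y x $ l *\<^sub>R partial_deriv l q (Y x)))) (at x)"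
proof (rule has_derivative_eq_rhs[OF has_derivative_compose[OF has_derivative_partial_derivs[OF assms(2)]
        has_derivative_partial_derivs[OF assms(1)]]], rule ext)
  fix h :: "real^'n"
  show "(\<Sum>l\<in>UNIV. (\<Sum>i\<in>UNIV. h $ i *\<^sub>R partial_deriv i Y x) $ l *\<^sub>R partial_deriv l q (Y x)) =
     (\<Sum>i\<in>UNIV. h $ i *\<^sub>R (\<Sum>l\<in>UNIV. partial_deriv i Y x $ l *\<^sub>R partial_deriv l q (Y x)))"
    by (simp add: scaleR_sum_right scaleR_sum_left) (rule sum.swap)
qed

lemma Ck_converges_compose:
  fixes F :: "nat \<Rightarrow> real ^ 'm::finite \<Rightarrow> 'b::real_normed_vector" and Y :: "nat \<Rightarrow> real ^ 'n::finite \<Rightarrow> real ^ 'm"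
  shows "Ck_converges k F f \<Longrightarrow> Ck_converges k Y y \<Longrightarrow> Ck_converges k (\<lambda>N x. F N (Y N x)) (\<lambda>x. f (y x))"
proof (induction k arbitrary: F f)
  case 0
  then show ?case by (simp add: C0_converges_compose)
next
  case (Suc k)
  have IH: "Ck_converges k (\<lambda>N x. partial_deriv l (F N) (Y N x)) (\<lambda>x. partial_deriv l f (y x))" for l
    by (rule Suc.IH[OF _ Ck_converges_SucD[OF Suc.prems(2)]]) (use Suc.prems(1) in simp)
  have d: "F N differentiable (at z)" "f differentiable (at z)" "Y N differentiable (at x)" "y differentiable (at x)" for N x z
    using Suc.prems by simp_all
  show ?case
  proof (rule Ck_converges_SucI[where
        F' = "\<lambda>i N x. \<Sum>l\<in>UNIV. partial_deriv i (Y N) x $ l *\<^sub>R partial_deriv l (F N) (Y N x)" and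
        f' = "\<lambda>i x. \<Sum>l\<in>UNIV. partial_deriv i y x $ l *\<^sub>R partial_deriv l f (y x)"])
    show "C0_converges (\<lambda>N x. F N (Y N x)) (\<lambda>x. f (y x))"
      by (rule C0_converges_compose) (use Suc.prems in simp_all)
    show "Ck_converges k (\<lambda>N x. \<Sum>l\<in>UNIV. partial_deriv i (Y N) x $ l *\<^sub>R partial_deriv l (F N) (Y N x))
        (\<lambda>x. \<Sum>l\<in>UNIV. partial_deriv i y x $ l *\<^sub>R partial_deriv l f (y x))" for i
      using Suc.prems by (intro Ck_converges_sum Ck_converges_scaleR Ck_converges_component IH) simp
  qed (intro has_derivative_compose_partials d)+
qed

lemma Ck_vecI:
  fixes Y :: "real ^ 'n::finite \<Rightarrow> real ^ 'm::finite"
  assumes "\<And>l. Ck k (\<lambda>x. Y x $ l)"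
  shows "Ck k Y"
proof -
  have "Y = (\<lambda>x. \<Sum>l\<in>UNIV. Y x $ l *\<^sub>R axis l 1)"
    by (simp add: fun_eq_iff vec_eq_iff axis_def if_distrib sum.If_cases cong: if_cong)
  moreover have "Ck k (\<lambda>x. \<Sum>l\<in>UNIV. Y x $ l *\<^sub>R axis l (1::real))"
    by (intro Ck_converges_sum Ck_converges_scaleR assms Ck_const)
  ultimately show ?thesis by metis
qed

lemma Ck_ident: "Ck k (\<lambda>x. x)"
  by (rule Ck_vecI) (rule Ck_component)

section \<open>Convergence of the rescaled eigenfunctions\<close>

text \<open>Hyperbolic functions of \<open>norm x\<close> must be seen to be smooth at the origin.
  They are entire functions of \<open>x \<bullet> x\<close>, and \<open>diffs\<close> yields the
  coefficients of the derived series.\<close>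

primrec cosh_sqrt_coeff :: "nat \<Rightarrow> nat \<Rightarrow> real" where
  "cosh_sqrt_coeff 0 = (\<lambda>n. inverse (fact (2 * n)))"
| "cosh_sqrt_coeff (Suc p) = diffs (cosh_sqrt_coeff p)"

text \<open>The \<open>p\<close>-th derivative of the entire function that is \<^term>\<open>cosh (sqrt s)\<close> for positive \<open>s\<close>.\<close>

definition cosh_sqrt :: "nat \<Rightarrow> real \<Rightarrow> real" where
  "cosh_sqrt p s = (\<Sum>n. cosh_sqrt_coeff p n * s ^ n)"

lemma summable_cosh_sqrt: "summable (\<lambda>n. cosh_sqrt_coeff p n * s ^ n)"
proof (induction p arbitrary: s)
  case 0
  show ?case
  proof (rule summable_comparison_test')
    show "summable (\<lambda>n. inverse (fact n) * \<bar>s\<bar> ^ n)" by (rule summable_exp)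
    show "norm (cosh_sqrt_coeff 0 n * s ^ n) \<le> inverse (fact n) * \<bar>s\<bar> ^ n" if "n \<ge> 0" for n
      by (simp add: abs_mult power_abs mult_right_mono fact_mono)
  qed
next
  case (Suc p)
  then show ?case by (simp add: termdiff_converges_all)
qed

lemma DERIV_cosh_sqrt: "(cosh_sqrt p has_real_derivative cosh_sqrt (Suc p) s) (at s)"
  unfolding cosh_sqrt_def[abs_def] cosh_sqrt_coeff.simps
  by (rule termdiffs_strong_converges_everywhere) (rule summable_cosh_sqrt)

lemma cosh_sqrt_0_square: "cosh_sqrt 0 (t\<^sup>2) = cosh t"
proof -
  have "(\<lambda>n. if even n then t ^ n /\<^sub>R fact n else 0) sums cosh t"
    by (rule cosh_converges)
  then have "(\<lambda>n. t ^ (2 * n) /\<^sub>R fact (2 * n)) sums cosh t"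
    by (subst (asm) sums_mono_reindex[of "\<lambda>n. 2 * n", symmetric]) (auto simp: strict_mono_def elim!: evenE)
  then have "(\<lambda>n. cosh_sqrt_coeff 0 n * (t\<^sup>2) ^ n) sums cosh t"
    by (simp add: power_mult)
  then show ?thesis
    by (simp add: cosh_sqrt_def sums_iff)
qed

text \<open>Differentiate the identity for cosh and compare the two derivatives.\<close>

lemma cosh_sqrt_1_square: "2 * t * cosh_sqrt 1 (t\<^sup>2) = sinh t"
proof -
  have "((\<lambda>t. cosh_sqrt 0 (t\<^sup>2)) has_real_derivative cosh_sqrt (Suc 0) (t\<^sup>2) * (2 * t)) (at t)"
    by (rule DERIV_chain2[OF DERIV_cosh_sqrt]) (auto intro!: derivative_eq_intros)
  then have "(cosh has_real_derivative cosh_sqrt (Suc 0) (t\<^sup>2) * (2 * t)) (at t)"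
    by (simp add: cosh_sqrt_0_square)
  from DERIV_unique[OF this has_field_derivative_cosh[OF DERIV_ident]]
  show ?thesis by (simp add: mult_ac)
qed

lemma cosh_sqrt_at_0: "cosh_sqrt 0 0 = 1" "cosh_sqrt 1 0 = 1 / 2"
  by (simp_all add: cosh_sqrt_def powser_zero diffs_def)

lemma cosh_sqrt_0_ge_1: "s \<ge> 0 \<Longrightarrow> cosh_sqrt 0 s \<ge> 1"
  using cosh_sqrt_0_square[of "sqrt s"] cosh_real_ge_1[of "sqrt s"] by simp

lemma has_derivative_inner_self:
  "((\<lambda>x::real^'n::finite. x \<bullet> x) has_derivative (\<lambda>h. \<Sum>i\<in>UNIV. h $ i *\<^sub>R (2 * x $ i))) (at x)"
  by (rule has_derivative_eq_rhs[OF has_derivative_inner[OF has_derivative_ident has_derivative_ident]])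
    (simp add: fun_eq_iff inner_vec_def sum_distrib_left mult_ac flip: sum.distrib)

lemma has_derivative_cosh_sqrt_inner:
  "((\<lambda>x::real^'n::finite. cosh_sqrt p (r * (x \<bullet> x))) has_derivative
      (\<lambda>h. \<Sum>i\<in>UNIV. h $ i *\<^sub>R (r * 2 * (x $ i * cosh_sqrt (Suc p) (r * (x \<bullet> x)))))) (at x)"
  by (rule has_derivative_eq_rhs[OF DERIV_compose_FDERIV[OF DERIV_cosh_sqrt
        has_derivative_mult_right[OF has_derivative_inner_self]]])
    (simp add: fun_eq_iff sum_distrib_left sum_distrib_right mult_ac)

lemma eventually_scaled_square_less:
  fixes r :: "nat \<Rightarrow> real"
  assumes r: "r \<longlonglongrightarrow> 0" and d: "d > 0"
  shows "\<forall>\<^sub>F N in sequentially. \<forall>x\<in>cball (0::'a::real_inner) \<rho>. \<bar>r N * (x \<bullet> x)\<bar> < d"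
proof -
  have "(\<lambda>N. \<bar>r N\<bar> * \<rho>\<^sup>2) \<longlonglongrightarrow> 0"
    using tendsto_mult_right[OF tendsto_rabs[OF r], of "\<rho>\<^sup>2"] by simp
  then have "\<forall>\<^sub>F N in sequentially. \<bar>r N\<bar> * \<rho>\<^sup>2 < d"
    using d order_tendstoD(2) by blast
  then show ?thesis
  proof eventually_elim
    case (elim N)
    show ?case
    proof
      fix x :: 'a assume "x \<in> cball 0 \<rho>"
      then have "x \<bullet> x \<le> \<rho>\<^sup>2"
        by (simp add: dot_square_norm power_mono)
      then have "\<bar>r N * (x \<bullet> x)\<bar> \<le> \<bar>r N\<bar> * \<rho>\<^sup>2"
        by (simp add: abs_mult mult_left_mono)
      with elim show "\<bar>r N * (x \<bullet> x)\<bar> < d" by linarith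
    qed
  qed
qed

text \<open>By the chain rule a derivative in \<open>x\<close> brings out a factor
  \<open>r N\<close>, so the derivatives of every positive order tend to 0.\<close>

lemma Ck_converges_cosh_sqrt:
  assumes r: "r \<longlonglongrightarrow> 0"
  shows "Ck_converges k (\<lambda>N (x::real^'n::finite). cosh_sqrt p (r N * (x \<bullet> x))) (\<lambda>x. cosh_sqrt p 0)"
proof (induction k arbitrary: p)
  case 0
  have "uniform_limit (cball 0 \<rho>) (\<lambda>N (x::real^'n). cosh_sqrt p (r N * (x \<bullet> x))) (\<lambda>x. cosh_sqrt p 0) sequentially" for \<rho>
  proof (rule uniform_limitI)
    fix e :: real assume "e > 0"
    then obtain d where d: "d > 0" "\<And>s. \<bar>s\<bar> < d \<Longrightarrow> \<bar>cosh_sqrt p s - cosh_sqrt p 0\<bar> < e"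
      using DERIV_isCont[OF DERIV_cosh_sqrt[of p 0]] unfolding continuous_at_eps_delta by (auto simp: dist_real_def)
    show "\<forall>\<^sub>F N in sequentially. \<forall>x\<in>cball (0::real^'n) \<rho>. dist (cosh_sqrt p (r N * (x \<bullet> x))) (cosh_sqrt p 0) < e"
      using eventually_scaled_square_less[OF r d(1), of \<rho>, where 'a = "real^'n"]
      by eventually_elim (use d(2) in \<open>simp add: dist_real_def\<close>)
  qed
  moreover have "continuous_on UNIV (\<lambda>x::real^'n. cosh_sqrt p (r N * (x \<bullet> x)))" for N
    by (intro continuous_at_imp_continuous_on ballI has_derivative_continuous[OF has_derivative_cosh_sqrt_inner])
  ultimately show ?case by (simp add: C0_converges_def)
next
  case (Suc k)
  show ?case
  proof (rule Ck_converges_SucI[where F' = "\<lambda>i N x. r N * 2 * (x $ i * cosh_sqrt (Suc p) (r N * (x \<bullet> x)))" and f' = "\<lambda>i x. 0"])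
    show "C0_converges (\<lambda>N (x::real^'n). cosh_sqrt p (r N * (x \<bullet> x))) (\<lambda>x. cosh_sqrt p 0)"
      using Suc.IH C0_if_Ck_converges by blast
    have "Ck_converges k (\<lambda>N (x::real^'n). r N * 2 * (x $ i * cosh_sqrt (Suc p) (r N * (x \<bullet> x))))
        (\<lambda>x. 0 * (x $ i * cosh_sqrt (Suc p) 0))" for i
      by (rule Ck_converges_mult[OF Ck_converges_const Ck_converges_mult[OF Ck_component Suc.IH]])
        (use tendsto_mult_right[OF r, of 2] in simp)
    then show "Ck_converges k (\<lambda>N (x::real^'n). r N * 2 * (x $ i * cosh_sqrt (Suc p) (r N * (x \<bullet> x)))) (\<lambda>x. 0)" for i
      by simp
  qed (simp_all add: has_derivative_cosh_sqrt_inner del: real_scaleR_def)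
qed

text \<open>Linear growth at 0 is the input for Bernoulli's inequality when a high power of the
  function is taken.\<close>

lemma cosh_sqrt_0_le_linear:
  obtains B where "B > 0" "\<And>s. 0 \<le> s \<Longrightarrow> s \<le> 1 \<Longrightarrow> cosh_sqrt 0 s \<le> 1 + B * s"
proof -
  have "continuous_on {0..1} (cosh_sqrt 1)"
    by (intro continuous_at_imp_continuous_on ballI DERIV_isCont[OF DERIV_cosh_sqrt])
  then have "compact (cosh_sqrt 1 ` {0..1})"
    by (intro compact_continuous_image) auto
  from compact_imp_bounded[OF this] obtain B where "\<forall>z\<in>cosh_sqrt 1 ` {0..1}. norm z \<le> B"
    unfolding bounded_iff by blast
  then have B: "\<bar>cosh_sqrt 1 s\<bar> \<le> B" if "0 \<le> s" "s \<le> 1" for s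
    using that by auto
  have "cosh_sqrt 0 s \<le> 1 + (B + 1) * s" if s: "0 \<le> s" "s \<le> 1" for s
  proof (cases "s = 0")
    case True
    then show ?thesis using cosh_sqrt_at_0 by simp
  next
    case False
    then obtain z where z: "0 < z" "z < s" "cosh_sqrt 0 s - cosh_sqrt 0 0 = (s - 0) * cosh_sqrt (Suc 0) z"
      using MVT2[of 0 s "cosh_sqrt 0" "cosh_sqrt (Suc 0)"] s DERIV_cosh_sqrt by auto
    have "cosh_sqrt 1 z \<le> B + 1"
      using B[of z] z s by auto
    then have "s * cosh_sqrt 1 z \<le> s * (B + 1)"
      using s by (intro mult_left_mono) auto
    then show ?thesis using z(3) cosh_sqrt_at_0 by (simp add: mult.commute)
  qed
  moreover have "B + 1 > 0" using B[of 0] by auto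
  ultimately show thesis using that by blast
qed

text \<open>Bernoulli's inequality places the power between \<open>1 - a N * (B * s)\<close> and 1,
  and a derivative brings out the factor \<open>a N * r N\<close>. So it is the product of exponent
  and scale that has to tend to 0.\<close>

lemma Ck_converges_cosh_sqrt_power:
  fixes a :: "nat \<Rightarrow> nat" and r :: "nat \<Rightarrow> real"
  assumes r0: "\<And>N. r N \<ge> 0" and r: "r \<longlonglongrightarrow> 0" and ar: "(\<lambda>N. real (a N) * r N) \<longlonglongrightarrow> 0"
  shows "Ck_converges k (\<lambda>N (x::real^'n::finite). inverse (cosh_sqrt 0 (r N * (x \<bullet> x))) ^ a N) (\<lambda>x. 1)"
proof (induction k)
  case 0
  have pos: "cosh_sqrt 0 (r N * (x \<bullet> x)) \<ge> 1" for N and x :: "real^'n"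
    using r0 by (intro cosh_sqrt_0_ge_1) simp
  obtain B where B: "B > 0" "\<And>s. 0 \<le> s \<Longrightarrow> s \<le> 1 \<Longrightarrow> cosh_sqrt 0 s \<le> 1 + B * s"
    using cosh_sqrt_0_le_linear by blast
  have "uniform_limit (cball 0 \<rho>) (\<lambda>N (x::real^'n). inverse (cosh_sqrt 0 (r N * (x \<bullet> x))) ^ a N) (\<lambda>x. 1) sequentially" for \<rho>
  proof (rule uniform_limitI)
    fix e :: real assume e: "e > 0"
    \<comment> \<open>\<open>s < 1\<close> permits the linear bound, and \<open>B * s < 1\<close>
      keeps the base of the Bernoulli power nonnegative.\<close>
    have "min 1 (1 / B) > 0" "e / B > 0" using B(1) e by auto
    from eventually_scaled_square_less[OF r this(1), of \<rho>, where 'a = "real^'n"]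
      eventually_scaled_square_less[OF ar this(2), of \<rho>, where 'a = "real^'n"]
    show "\<forall>\<^sub>F N in sequentially. \<forall>x\<in>cball (0::real^'n) \<rho>. dist (inverse (cosh_sqrt 0 (r N * (x \<bullet> x))) ^ a N) 1 < e"
    proof eventually_elim
      case (elim N)
      show ?case
      proof
        fix x :: "real^'n" assume x: "x \<in> cball 0 \<rho>"
        define s where "s = r N * (x \<bullet> x)"
        have s: "0 \<le> s" "s < 1" "B * s < 1" and as: "real (a N) * s < e / B"
          using elim x r0[of N] B(1) by (auto simp: s_def field_simps)
        let ?y = "inverse (cosh_sqrt 0 s)"
        have c: "cosh_sqrt 0 s \<ge> 1" using pos by (simp add: s_def)
        have "?y \<le> 1" "?y \<ge> 0" using c by (simp_all add: inverse_le_1_iff)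
        then have "?y ^ a N \<le> 1" by (simp add: power_le_one)
        have "1 - B * s \<le> inverse (1 + B * s)"
        proof -
          have "1 - t \<le> inverse (1 + t)" if "t \<ge> 0" for t :: real
          proof -
            have "(1 - t) * (1 + t) \<le> 1" by (simp add: algebra_simps)
            then show ?thesis using that by (simp add: inverse_eq_divide pos_le_divide_eq)
          qed
          then show ?thesis using s(1) B(1) by simp
        qed
        also have "\<dots> \<le> ?y"
          using B(2)[of s] s c by (intro le_imp_inverse_le) auto
        finally have "(1 - B * s) ^ a N \<le> ?y ^ a N"
          using s by (intro power_mono) auto
        moreover have "1 - real (a N) * (B * s) \<le> (1 - B * s) ^ a N"
          using Bernoulli_inequality[of "- (B * s)" "a N"] s by simp
        moreover have "real (a N) * (B * s) < e"
          using as B(1) by (simp add: field_simps)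
        ultimately show "dist (inverse (cosh_sqrt 0 (r N * (x \<bullet> x))) ^ a N) 1 < e"
          using \<open>?y ^ a N \<le> 1\<close> by (simp add: dist_real_def s_def)
      qed
    qed
  qed
  moreover have "continuous_on UNIV (\<lambda>x::real^'n. inverse (cosh_sqrt 0 (r N * (x \<bullet> x))) ^ a N)" for N
  proof (intro continuous_intros ballI)
    show "continuous_on UNIV (\<lambda>x::real^'n. cosh_sqrt 0 (r N * (x \<bullet> x)))"
      by (intro continuous_at_imp_continuous_on ballI has_derivative_continuous[OF has_derivative_cosh_sqrt_inner])
    show "cosh_sqrt 0 (r N * (x \<bullet> x)) \<noteq> 0" for x :: "real^'n"
      using pos[of N x] by linarith
  qed
  ultimately show ?case by (simp add: C0_converges_def)
next
  case (Suc k)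
  define P where "P N x = inverse (cosh_sqrt 0 (r N * (x \<bullet> x)))" for N and x :: "real^'n"
  have pos: "cosh_sqrt 0 (r N * (x \<bullet> x)) > 0" for N and x :: "real^'n"
    using r0 cosh_sqrt_0_ge_1[of "r N * (x \<bullet> x)"] by simp
  have P: "Ck_converges k P (\<lambda>x. inverse 1)"
    unfolding P_def[abs_def] using Ck_converges_cosh_sqrt[OF r, of k 0]
    by (intro Ck_converges_inverse pos) (auto simp: cosh_sqrt_at_0)
  \<comment> \<open>Differentiating \<open>P\<close> produces its square; one of these factors
    restores the exponent \<open>a N\<close>, so that the induction hypothesis applies to the
    derivative.\<close>
  let ?F' = "\<lambda>i N x. - (real (a N) * r N * 2) * (x $ i * cosh_sqrt (Suc 0) (r N * (x \<bullet> x)) * P N x) * P N x ^ a N"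
  show ?case
  proof (rule Ck_converges_SucI[where F' = ?F' and f' = "\<lambda>i x. 0"])
    show "C0_converges (\<lambda>N x. inverse (cosh_sqrt 0 (r N * (x \<bullet> x))) ^ a N) (\<lambda>x::real^'n. 1)"
      using Suc.IH C0_if_Ck_converges by blast
    have "Ck_converges k (?F' i) (\<lambda>x. - 0 * (x $ i * cosh_sqrt (Suc 0) 0 * inverse 1) * 1)" for i
    proof (intro Ck_converges_mult Ck_converges_const Ck_component Ck_converges_cosh_sqrt[OF r] P)
      show "(\<lambda>N. - (real (a N) * r N * 2)) \<longlonglongrightarrow> - 0"
        using tendsto_minus[OF tendsto_mult_right[OF ar, of 2]] by simp
      show "Ck_converges k (\<lambda>N x. P N x ^ a N) (\<lambda>x. 1)"
        using Suc.IH by (simp add: P_def)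
    qed
    then show "Ck_converges k (?F' i) (\<lambda>x. 0)" for i by simp
    fix N and x :: "real^'n"
    have "(P N has_derivative (\<lambda>h. - (P N x * (\<Sum>i\<in>UNIV. h $ i *\<^sub>R (r N * 2 * (x $ i * cosh_sqrt (Suc 0) (r N * (x \<bullet> x))))) * P N x))) (at x)"
      unfolding P_def using pos[of N x]
      by (intro Deriv.has_derivative_inverse has_derivative_cosh_sqrt_inner) simp
    from has_derivative_power[OF this, of "a N"]
    show "((\<lambda>x. inverse (cosh_sqrt 0 (r N * (x \<bullet> x))) ^ a N) has_derivative (\<lambda>h. \<Sum>i\<in>UNIV. h $ i *\<^sub>R ?F' i N x)) (at x)"
      unfolding P_def[symmetric]
    proof (rule has_derivative_eq_rhs, intro ext)
      fix h :: "real^'n"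
      have A: "real (a N) * (P N x * P N x ^ (a N - 1)) = real (a N) * P N x ^ a N"
        by (cases "a N") auto
      define S where "S = (\<Sum>i\<in>UNIV. h $ i *\<^sub>R (r N * 2 * (x $ i * cosh_sqrt (Suc 0) (r N * (x \<bullet> x)))))"
      have B: "of_nat (a N) * (- (P N x * S * P N x)) * P N x ^ (a N - 1) = - (real (a N) * (P N x * P N x ^ (a N - 1))) * P N x * S"
        by (simp add: mult_ac)
      have C: "(\<Sum>i\<in>UNIV. h $ i *\<^sub>R ?F' i N x) = - (real (a N) * P N x ^ a N) * P N x * S"
        unfolding S_def sum_distrib_left by (intro sum.cong refl) (simp add: mult_ac)
      show "of_nat (a N) * (- (P N x * (\<Sum>i\<in>UNIV. h $ i *\<^sub>R (r N * 2 * (x $ i * cosh_sqrt (Suc 0) (r N * (x \<bullet> x))))) * P N x)) * P N x ^ (a N - 1)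
        = (\<Sum>i\<in>UNIV. h $ i *\<^sub>R ?F' i N x)"
        unfolding S_def[symmetric] B C A ..
    qed
  qed simp
qed

section \<open>Weighted Taylor sums\<close>

text \<open>Dominated convergence for series: finitely many terms converge with their weights, and
  the rest is uniformly small because the weights are at most 1 and the terms decay
  geometrically.\<close>

lemma weighted_taylor_uniform_limit:
  fixes u :: "real ^ 'n::finite \<Rightarrow> 'b::euclidean_space"
  assumes u: "helmholtz u" and c: "\<And>N j. 0 \<le> c N j" "\<And>N j. c N j \<le> 1" "\<And>j. (\<lambda>N. c N j) \<longlonglongrightarrow> 1"
  shows "uniform_limit (cball 0 \<rho>) (\<lambda>N x. \<Sum>j<N + 2. c N j *\<^sub>R taylor_term j u x) u sequentially"
proof (rule uniform_limitI)
  fix e :: real assume e: "e > 0"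
  have "\<bar>\<rho>\<bar> + 1 > 0" by simp
  from taylor_geometric_bound[OF u this] obtain K where K: "K \<ge> 0"
    "\<And>j x. norm x \<le> \<bar>\<rho>\<bar> + 1 \<Longrightarrow> norm (taylor_term j u x) \<le> K / 2 ^ j"
    "\<And>m x. norm x \<le> \<bar>\<rho>\<bar> + 1 \<Longrightarrow> norm (u x - (\<Sum>j<m. taylor_term j u x)) \<le> K / 2 ^ m"
    by blast
  \<comment> \<open>Two parts of \<open>K / 2 ^ m\<close> are for the weighted terms from
    \<open>m\<close> on, one for the remainder of the unweighted series.\<close>
  have "(\<lambda>m. 3 * K * (1 / 2) ^ m) \<longlonglongrightarrow> 0"
    using tendsto_mult_left[OF LIMSEQ_power_zero[of "1 / 2 :: real"], of "3 * K"] by simp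
  then have "\<forall>\<^sub>F m in sequentially. 3 * K * (1 / 2) ^ m < e / 2"
    using e by (intro order_tendstoD(2)) auto
  then obtain m where m: "3 * K * (1 / 2) ^ m < e / 2"
    unfolding eventually_sequentially by blast
  have "(\<lambda>N. \<Sum>j<m. (1 - c N j) * K) \<longlonglongrightarrow> (\<Sum>j<m. (1 - 1) * K)"
    by (intro tendsto_intros c(3))
  then have "\<forall>\<^sub>F N in sequentially. (\<Sum>j<m. (1 - c N j) * K) < e / 2"
    using e by (intro order_tendstoD(2)) auto
  moreover have "\<forall>\<^sub>F N in sequentially. N \<ge> m"
    by (rule eventually_ge_at_top)
  ultimately show "\<forall>\<^sub>F N in sequentially. \<forall>x\<in>cball 0 \<rho>. dist (\<Sum>j<N + 2. c N j *\<^sub>R taylor_term j u x) (u x) < e"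
  proof eventually_elim
    case (elim N)
    show ?case
    proof
      fix x :: "real^'n" assume "x \<in> cball 0 \<rho>"
      then have x: "norm x \<le> \<bar>\<rho>\<bar> + 1" by simp
      have split: "{..<N + 2} = {..<m} \<union> {m..<N + 2}" using elim by auto
      have eq: "(\<Sum>j<N + 2. c N j *\<^sub>R taylor_term j u x) - u x =
          - (\<Sum>j<m. (1 - c N j) *\<^sub>R taylor_term j u x) + (\<Sum>j\<in>{m..<N + 2}. c N j *\<^sub>R taylor_term j u x)
          - (u x - (\<Sum>j<m. taylor_term j u x))"
        unfolding split by (subst sum.union_disjoint) (auto simp: scaleR_diff_left sum_subtractf)
      have "dist (\<Sum>j<N + 2. c N j *\<^sub>R taylor_term j u x) (u x) \<le>
          norm (\<Sum>j<m. (1 - c N j) *\<^sub>R taylor_term j u x) + norm (\<Sum>j\<in>{m..<N + 2}. c N j *\<^sub>R taylor_term j u x)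
          + norm (u x - (\<Sum>j<m. taylor_term j u x))"
      proof -
        have "norm (- a + b - c) \<le> norm a + norm b + norm c" for a b c :: 'b
          using norm_triangle_ineq4[of "- a + b" c] norm_triangle_ineq[of "- a" b] by simp
        then show ?thesis unfolding dist_norm eq .
      qed
      moreover have "norm (\<Sum>j<m. (1 - c N j) *\<^sub>R taylor_term j u x) \<le> (\<Sum>j<m. (1 - c N j) * K)"
      proof (rule sum_norm_le)
        fix j
        have "norm (taylor_term j u x) \<le> K"
          using K(2)[OF x, of j] divide_left_mono[OF one_le_power[of "2::real" j] K(1)] by simp
        then show "norm ((1 - c N j) *\<^sub>R taylor_term j u x) \<le> (1 - c N j) * K"
          using c(2)[of N j] by (simp add: mult_left_mono)
      qed
      moreover have "norm (\<Sum>j\<in>{m..<N + 2}. c N j *\<^sub>R taylor_term j u x) \<le> 2 * K * (1 / 2) ^ m"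
      proof -
        have "norm (\<Sum>j\<in>{m..<N + 2}. c N j *\<^sub>R taylor_term j u x) \<le> (\<Sum>j\<in>{m..<N + 2}. K * (1 / 2) ^ j)"
        proof (rule sum_norm_le)
          fix j
          have "norm (c N j *\<^sub>R taylor_term j u x) \<le> 1 * norm (taylor_term j u x)"
            unfolding norm_scaleR using c(1,2)[of N j] by (intro mult_right_mono) auto
          with K(2)[OF x, of j] show "norm (c N j *\<^sub>R taylor_term j u x) \<le> K * (1 / 2) ^ j"
            by (simp add: power_divide)
        qed
        also have "\<dots> = K * (\<Sum>j\<in>{m..<N + 2}. (1 / 2) ^ j)"
          by (rule sum_distrib_left[symmetric])
        also have "(\<Sum>j\<in>{m..<N + 2}. (1 / 2 :: real) ^ j) = 2 * ((1 / 2) ^ m - (1 / 2) ^ (N + 2))"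
        proof -
          have "(\<Sum>j\<in>{m..<m + k}. (1 / 2 :: real) ^ j) = 2 * ((1 / 2) ^ m - (1 / 2) ^ (m + k))" for k
            by (induction k) auto
          from this[of "N + 2 - m"] elim show ?thesis by simp
        qed
        also have "K * (2 * ((1 / 2) ^ m - (1 / 2) ^ (N + 2))) \<le> K * (2 * (1 / 2) ^ m)"
          using K(1) by (intro mult_left_mono) auto
        finally show ?thesis by simp
      qed
      moreover have "norm (u x - (\<Sum>j<m. taylor_term j u x)) \<le> K * (1 / 2) ^ m"
        using K(3)[OF x, of m] by (simp add: power_divide)
      ultimately show "dist (\<Sum>j<N + 2. c N j *\<^sub>R taylor_term j u x) (u x) < e"
        using elim(1) m by linarith
    qed
  qed
qed

text \<open>Differentiation lowers the degree of a Taylor term but not the index of its weight,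
  hence the shift \<open>s\<close>, over which the induction generalizes. The sum also loses a term,
  which \<open>c0\<close> allows to be added back with weight 0.\<close>

lemma Ck_converges_weighted_taylor:
  fixes u :: "real ^ 'n::finite \<Rightarrow> 'b::euclidean_space"
  assumes c: "\<And>N j. 0 \<le> c N j" "\<And>N j. c N j \<le> 1" "\<And>j. (\<lambda>N. c N j) \<longlonglongrightarrow> 1"
    and c0: "\<And>N j. j \<ge> N + 2 \<Longrightarrow> c N j = 0"
  shows "helmholtz u \<Longrightarrow> Ck_converges k (\<lambda>N x. \<Sum>j<N + 2. c N (j + s) *\<^sub>R taylor_term j u x) u"
proof (induction k arbitrary: u s)
  case 0
  have "continuous_on UNIV (\<lambda>x. \<Sum>j<N + 2. c N (j + s) *\<^sub>R taylor_term j u x)" for N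
    using Ck_continuous[OF Ck_taylor_term] by (intro continuous_intros) auto
  moreover have "uniform_limit (cball 0 \<rho>) (\<lambda>N x. \<Sum>j<N + 2. c N (j + s) *\<^sub>R taylor_term j u x) u sequentially" for \<rho>
    by (rule weighted_taylor_uniform_limit[of u "\<lambda>N j. c N (j + s)"]) (use 0 c in auto)
  ultimately show ?case
    using Ck_continuous[OF helmholtz_Ck[OF 0]] by (simp add: C0_converges_def)
next
  case (Suc k)
  show ?case
  proof (rule Ck_converges_SucI[where F' = "\<lambda>i N x. \<Sum>j<N + 2. c N (j + Suc s) *\<^sub>R taylor_term j (partial_deriv i u) x"
        and f' = "\<lambda>i. partial_deriv i u"])
    show "C0_converges (\<lambda>N x. \<Sum>j<N + 2. c N (j + s) *\<^sub>R taylor_term j u x) u"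
      using Suc.IH[OF Suc.prems] C0_if_Ck_converges by blast
    show "(u has_derivative (\<lambda>h. \<Sum>i\<in>UNIV. h $ i *\<^sub>R partial_deriv i u x)) (at x)" for x
      by (rule has_derivative_partial_derivs) (use Suc.prems Ck_2_partials(6) in \<open>auto simp: helmholtz_def\<close>)
    show "Ck_converges k (\<lambda>N x. \<Sum>j<N + 2. c N (j + Suc s) *\<^sub>R taylor_term j (partial_deriv i u) x) (partial_deriv i u)" for i
      by (rule Suc.IH[OF helmholtz_partial_deriv[OF Suc.prems]])
    fix N x
    have shift: "(\<Sum>j<N + 2. c N (j + s) *\<^sub>R taylor_term j u x) =
        c N s *\<^sub>R u 0 + (\<Sum>j<N + 1. c N (j + Suc s) *\<^sub>R taylor_term (Suc j) u x)" for x
      using sum.lessThan_Suc_shift[of "\<lambda>j. c N (j + s) *\<^sub>R taylor_term j u x" "N + 1"]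
      by (simp del: taylor_term.simps(2))
    have "((\<lambda>x. c N s *\<^sub>R u 0 + (\<Sum>j<N + 1. c N (j + Suc s) *\<^sub>R taylor_term (Suc j) u x)) has_derivative
        (\<lambda>h. 0 + (\<Sum>j<N + 1. c N (j + Suc s) *\<^sub>R (\<Sum>i\<in>UNIV. h $ i *\<^sub>R taylor_term j (partial_deriv i u) x)))) (at x)"
      by (intro has_derivative_add has_derivative_const has_derivative_sum has_derivative_scaleR_right
          has_derivative_taylor_term Suc.prems)
    moreover have "(\<Sum>j<N + 1. c N (j + Suc s) *\<^sub>R (\<Sum>i\<in>UNIV. h $ i *\<^sub>R taylor_term j (partial_deriv i u) x))
        = (\<Sum>i\<in>UNIV. h $ i *\<^sub>R (\<Sum>j<N + 2. c N (j + Suc s) *\<^sub>R taylor_term j (partial_deriv i u) x))" for h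
    proof -
      have "(\<Sum>j<N + 2. c N (j + Suc s) *\<^sub>R taylor_term j (partial_deriv i u) x)
        = (\<Sum>j<N + 1. c N (j + Suc s) *\<^sub>R taylor_term j (partial_deriv i u) x)" for i
        using c0[of N "N + 1 + Suc s"] by simp
      then show ?thesis
        by (simp only: scaleR_sum_right scaleR_scaleR) (subst sum.swap, simp only: mult.commute)
    qed
    ultimately show "((\<lambda>x. \<Sum>j<N + 2. c N (j + s) *\<^sub>R taylor_term j u x) has_derivative
        (\<lambda>h. \<Sum>i\<in>UNIV. h $ i *\<^sub>R (\<Sum>j<N + 2. c N (j + Suc s) *\<^sub>R taylor_term j (partial_deriv i u) x))) (at x)"
      unfolding shift by simp
  qed
qed

text \<open>The eigenvalue is \<open>\<kappa>\<^sup>2\<close> times the scale, and the weights, up to the factor \<open>\<lambda>\<^bsup>j / 2\<^esup>\<close>, solve the recursion that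
  cancels the terms \<open>\<tau>\<^bsup>- a - j - 2\<^esup> q\<^sub>j(Y)\<close> in the eigenvalue equation. It terminates because \<open>N - j\<close> is \<open>0\<close> for \<open>j \<ge> N\<close>.\<close>

definition oscillator_scale :: "nat \<Rightarrow> nat \<Rightarrow> real" where
  "oscillator_scale d N = real ((2 * N + d) * N\<^sup>2 + N * (N + 1))"

fun oscillator_weight :: "nat \<Rightarrow> nat \<Rightarrow> nat \<Rightarrow> real" where
  "oscillator_weight d N 0 = 1"
| "oscillator_weight d N (Suc 0) = 1"
| "oscillator_weight d N (Suc (Suc j)) =
     real ((N - j) * (2 * N\<^sup>2 + N + j + 1)) / oscillator_scale d N * oscillator_weight d N j"

section \<open>Bounds and limits of the weights\<close>

text \<open>For \<open>j \<le> N\<close> the right-hand side exceeds the left by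
  \<open>d * N\<^sup>2 + 2 * j * N\<^sup>2 + j\<^sup>2 + j\<close>.\<close>

lemma oscillator_weight_ratio_le:
  "(N - j) * (2 * N\<^sup>2 + N + j + 1) \<le> (2 * N + d) * N\<^sup>2 + N * (N + 1 :: nat)"
proof (cases "j \<le> N")
  case True
  then obtain m where N: "N = j + m" using le_Suc_ex by blast
  have "m * (2 * N\<^sup>2 + N + j + 1) \<le> 2 * N * N\<^sup>2 + N * (N + 1)"
    unfolding N by (simp add: algebra_simps power2_eq_square)
  then show ?thesis using N by (simp add: algebra_simps)
qed simp

lemma oscillator_weight_ratio_le_1:
  "real ((N - j) * (2 * N\<^sup>2 + N + j + 1)) / oscillator_scale d N \<le> 1"
proof -
  \<comment> \<open>For \<open>N = 0\<close> the scale is 0, and the quotient is then 0 by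
    convention.\<close>
  have "real p / real q \<le> 1" if "p \<le> q" for p q :: nat
    using that by (cases "q = 0") (auto simp: divide_le_eq)
  then show ?thesis unfolding oscillator_scale_def using oscillator_weight_ratio_le by blast
qed

lemma oscillator_weight_bounds: "0 \<le> oscillator_weight d N j" "oscillator_weight d N j \<le> 1"
proof (induction d N j rule: oscillator_weight.induct)
  case (3 d N j)
  let ?q = "real ((N - j) * (2 * N\<^sup>2 + N + j + 1)) / oscillator_scale d N"
  have q: "0 \<le> ?q" "?q \<le> 1"
    using oscillator_weight_ratio_le_1 by (auto simp: oscillator_scale_def)
  { case 1 then show ?case using q(1) 3(1) by (simp only: oscillator_weight.simps) (intro mult_nonneg_nonneg) }
  { case 2 then show ?case using q 3 by (simp only: oscillator_weight.simps) (intro mult_le_one) }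
qed auto

lemma oscillator_weight_eq_0: "j \<ge> N + 2 \<Longrightarrow> oscillator_weight d N j = 0"
proof (induction d N j rule: oscillator_weight.induct)
  case (3 d N j)
  then show ?case by simp
qed auto

text \<open>The number of factors in a weight depends on \<open>j\<close> only, and each factor
  differs from 1 by a term of order 1 / N.\<close>

lemma oscillator_weight_tendsto: "(\<lambda>N. oscillator_weight d N j) \<longlonglongrightarrow> 1"
proof (induction j rule: oscillator_weight.induct[of "\<lambda>_ _ j. (\<lambda>N. oscillator_weight d N j) \<longlonglongrightarrow> 1" d 0])
  case (3 d' N' j)
  define q where "q N = real ((N - j) * (2 * N\<^sup>2 + N + j + 1)) / oscillator_scale d N" for N
  \<comment> \<open>From \<open>1 - q N = ((d + 2 * j) * N^2 + j^2 + j) / D\<close>, where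
    \<open>D\<close> is at least \<open>N^3\<close> and the lower order terms are multiplied by
    \<open>N^2\<close>.\<close>
  define C where "C = real d + 2 * real j + real j ^ 2 + real j"
  have "\<bar>q N - 1\<bar> \<le> C * (1 / real N)" if N: "N \<ge> j" "N > 0" for N
  proof -
    define D where "D = (2 * real N + real d) * real N ^ 2 + real N * (real N + 1)"
    have D: "D \<ge> real N ^ 3" using N by (simp add: D_def power3_eq_cube power2_eq_square algebra_simps)
    have N1: "real N \<ge> 1" using N by simp
    then have D0: "D > 0" using D zero_less_power[of "real N" 3] by linarith
    define X where "X = (real N - real j) * (2 * real N ^ 2 + real N + real j + 1)"
    have "q N = X / D"
      unfolding q_def D_def X_def oscillator_scale_def
      by (simp only: of_nat_mult of_nat_add of_nat_diff[OF N(1)] of_nat_power of_nat_numeral of_nat_1)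
    then have "1 - q N = (D - X) / D"
      using D0 by (simp add: diff_divide_distrib)
    moreover have "D - X = (real d + 2 * real j) * real N ^ 2 + real j ^ 2 + real j"
      by (simp add: D_def X_def algebra_simps power2_eq_square)
    ultimately have "1 - q N = ((real d + 2 * real j) * real N ^ 2 + real j ^ 2 + real j) / D"
      by simp
    also have "\<dots> \<le> C * real N ^ 2 / D"
    proof (rule divide_right_mono)
      have "(real j ^ 2 + real j) * 1 \<le> (real j ^ 2 + real j) * real N ^ 2"
        using N1 by (intro mult_left_mono) auto
      then show "(real d + 2 * real j) * real N ^ 2 + real j ^ 2 + real j \<le> C * real N ^ 2"
        by (simp add: C_def algebra_simps)
    qed (use D0 in simp)
    also have "\<dots> \<le> C * real N ^ 2 / real N ^ 3"
      using D N1 by (intro divide_left_mono) (auto simp: C_def D0)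
    also have "\<dots> = C * (1 / real N)"
      using N1 by (simp add: power3_eq_cube power2_eq_square)
    finally have "1 - q N \<le> C * (1 / real N)" .
    moreover have "q N \<le> 1"
      unfolding q_def by (rule oscillator_weight_ratio_le_1)
    ultimately show ?thesis by linarith
  qed
  then have "\<forall>\<^sub>F N in sequentially. norm (q N - 1) \<le> C * (1 / real N)"
    by (intro eventually_sequentiallyI[of "Suc j"]) auto
  moreover have "(\<lambda>N. C * (1 / real N)) \<longlonglongrightarrow> 0"
    using tendsto_mult_left[OF lim_1_over_n, of C] by simp
  ultimately have "(\<lambda>N. q N - 1) \<longlonglongrightarrow> 0"
    by (rule Lim_null_comparison)
  then have "q \<longlonglongrightarrow> 1" by (simp add: LIM_zero_iff)
  from tendsto_mult[OF this 3] show ?case by (simp add: q_def)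
qed auto

text \<open>The eigenfunction along the exponential map: \<^term>\<open>cosh_sqrt 0 s\<close> is \<^term>\<open>cosh (sqrt s)\<close>
  and \<^term>\<open>2 * cosh_sqrt 1 s\<close> is \<^term>\<open>sinh (sqrt s) / sqrt s\<close>.\<close>

definition rescaled_eigenfunction ::
  "nat \<Rightarrow> (real ^ 'n::finite \<Rightarrow> 'b::euclidean_space) \<Rightarrow> real ^ 'n \<Rightarrow> 'b" where
  "rescaled_eigenfunction N u x =
    (let s = inverse (oscillator_scale CARD('n) N) * (x \<bullet> x); q = inverse (cosh_sqrt 0 s)
     in q ^ N\<^sup>2 *\<^sub>R (\<Sum>j<N + 2. oscillator_weight CARD('n) N j *\<^sub>R
          taylor_term j u ((2 * cosh_sqrt 1 s * q) *\<^sub>R x)))"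

lemma oscillator_scale_nonneg: "oscillator_scale d N \<ge> 0"
  by (simp add: oscillator_scale_def)

text \<open>The scale is at least the cube of N. The second limit is the smallness required by the
  exponent \<open>N\<^sup>2\<close> of the cosh factor.\<close>

lemma oscillator_scale_limits:
  "(\<lambda>N. inverse (oscillator_scale d N)) \<longlonglongrightarrow> 0"
  "(\<lambda>N. real (N\<^sup>2) * inverse (oscillator_scale d N)) \<longlonglongrightarrow> 0"
proof -
  have b: "oscillator_scale d N \<ge> real N ^ 3" for N
    by (simp add: oscillator_scale_def power3_eq_cube power2_eq_square algebra_simps)
  have 2: "\<bar>real (N\<^sup>2) * inverse (oscillator_scale d N)\<bar> \<le> 1 / real N" "\<bar>inverse (oscillator_scale d N)\<bar> \<le> 1 / real N" if N: "N > 0" for N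
  proof -
    have p: "real N ^ 3 > 0" using N by simp
    have "inverse (oscillator_scale d N) \<le> inverse (real N ^ 3)" "inverse (oscillator_scale d N) \<ge> 0"
      using b[of N] p oscillator_scale_nonneg[of d N] by (auto intro: le_imp_inverse_le)
    moreover from mult_left_mono[OF this(1), of "real (N\<^sup>2)"] have "real (N\<^sup>2) * inverse (oscillator_scale d N) \<le> 1 / real N"
      using N by (simp add: power3_eq_cube power2_eq_square field_simps)
    moreover have "1 * inverse (oscillator_scale d N) \<le> real (N\<^sup>2) * inverse (oscillator_scale d N)"
      using N calculation(2) by (intro mult_right_mono) auto
    ultimately show "\<bar>real (N\<^sup>2) * inverse (oscillator_scale d N)\<bar> \<le> 1 / real N" "\<bar>inverse (oscillator_scale d N)\<bar> \<le> 1 / real N"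
      by auto
  qed
  show "(\<lambda>N. inverse (oscillator_scale d N)) \<longlonglongrightarrow> 0" "(\<lambda>N. real (N\<^sup>2) * inverse (oscillator_scale d N)) \<longlonglongrightarrow> 0"
    by (rule Lim_null_comparison[OF _ lim_1_over_n], rule eventually_sequentiallyI[of 1], use 2 in auto)+
qed

text \<open>Three limits combine: the power of cosh tends to 1, the inner map
  \<open>h N x *\<^sub>R x\<close> to the identity, and the weighted sums to
  \<open>u\<close>.\<close>

lemma Ck_converges_rescaled_eigenfunction:
  fixes u :: "real ^ 'n::finite \<Rightarrow> 'b::euclidean_space"
  assumes u: "helmholtz u"
  shows "Ck_converges k (\<lambda>N. rescaled_eigenfunction N u) u"
proof -
  define r where "r N = inverse (oscillator_scale CARD('n) N)" for N
  have r0: "r N \<ge> 0" for N by (simp add: r_def oscillator_scale_def)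
  have r: "r \<longlonglongrightarrow> 0" "(\<lambda>N. real (N\<^sup>2) * r N) \<longlonglongrightarrow> 0"
    unfolding r_def[abs_def] by (rule oscillator_scale_limits)+
  define h where "h N x = 2 * cosh_sqrt 1 (r N * (x \<bullet> x)) * inverse (cosh_sqrt 0 (r N * (x \<bullet> x)))" for N and x :: "real^'n"
  have pos: "cosh_sqrt 0 (r N * (x \<bullet> x)) > 0" for N and x :: "real^'n"
    using r0 cosh_sqrt_0_ge_1[of "r N * (x \<bullet> x)"] by simp
  have "Ck_converges k h (\<lambda>x. 2 * cosh_sqrt 1 0 * inverse (cosh_sqrt 0 0))"
    unfolding h_def[abs_def]
    by (intro Ck_converges_mult Ck_const Ck_converges_inverse Ck_converges_cosh_sqrt r pos) (simp add: cosh_sqrt_at_0)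
  then have h: "Ck_converges k h (\<lambda>x. 1)"
    by (simp only: cosh_sqrt_at_0) simp
  have "Ck_converges k (\<lambda>N x. h N x *\<^sub>R x) (\<lambda>x. 1 *\<^sub>R x)"
    by (rule Ck_converges_scaleR[OF h Ck_ident])
  then have hx: "Ck_converges k (\<lambda>N x. h N x *\<^sub>R x) (\<lambda>x. x)" by simp
  have F: "Ck_converges k (\<lambda>N x. \<Sum>j<N + 2. oscillator_weight CARD('n) N (j + 0) *\<^sub>R taylor_term j u x) u"
    by (rule Ck_converges_weighted_taylor[OF oscillator_weight_bounds oscillator_weight_tendsto oscillator_weight_eq_0 u])
  have "Ck_converges k (\<lambda>N x. inverse (cosh_sqrt 0 (r N * (x \<bullet> x))) ^ N\<^sup>2 *\<^sub>R
      (\<Sum>j<N + 2. oscillator_weight CARD('n) N (j + 0) *\<^sub>R taylor_term j u (h N x *\<^sub>R x))) (\<lambda>x. 1 *\<^sub>R u x)"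
    by (rule Ck_converges_scaleR[OF Ck_converges_cosh_sqrt_power[OF r0 r] Ck_converges_compose[OF F hx]])
  then show ?thesis
    by (simp add: rescaled_eigenfunction_def[abs_def] Let_def r_def h_def)
qed

section \<open>The Laplace--Beltrami operator of hyperbolic space\<close>

lemma matrix_inv_eqI:
  fixes A B :: "real ^ 'n ^ 'n"
  assumes "A ** B = mat 1"
  shows "matrix_inv A = B"
proof -
  have BA: "B ** A = mat 1"
    using assms matrix_left_right_inverse by blast
  then have "A ** matrix_inv A = mat 1 \<and> matrix_inv A ** A = mat 1"
    unfolding matrix_inv_def using assms by (intro someI[of "\<lambda>A'. A ** A' = mat 1 \<and> A' ** A = mat 1"]) blast
  then show ?thesis
    using BA by (metis matrix_mul_assoc matrix_mul_lid matrix_mul_rid)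
qed

text \<open>An orthogonal matrix taking a coordinate axis to the direction of \<open>x\<close>
  diagonalizes the rank one perturbation.\<close>

lemma det_rank_one_update:
  fixes x :: "real ^ 'n"
  shows "det (\<chi> i j. (if i = j then 1 else 0) - c * x $ i * x $ j) = 1 - c * (x \<bullet> x)"
proof (cases "x = 0")
  case True
  then have "(\<chi> i j. (if i = j then 1 else 0) - c * x $ i * x $ j) = mat 1"
    by (simp add: mat_def vec_eq_iff)
  then show ?thesis using True by simp
next
  case False
  fix k :: 'n
  let ?G = "\<chi> i j. (if i = j then 1 else 0) - c * x $ i * x $ j"
  have "norm (x /\<^sub>R norm x) = 1" using False by simp
  then obtain A where A: "orthogonal_matrix A" "A *v axis k 1 = x /\<^sub>R norm x"
    using orthogonal_matrix_exists_basis by blast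
  define D where "D = (\<chi> i j. if i = j then (if i = k then 1 - c * (x \<bullet> x) else 1) else 0 :: real ^ 'n ^ 'n)"
  have xs: "x $ s = norm x * A $ s $ k" for s
  proof -
    have "A $ s $ k = (A *v axis k 1) $ s"
      by (simp add: matrix_vector_mult_def axis_def if_distrib cong: if_cong)
    then show ?thesis using False A(2) by simp
  qed
  have orth: "(\<Sum>s\<in>UNIV. A $ s $ k * A $ s $ i) = (if i = k then 1 else 0)" for i
  proof -
    have "(\<Sum>s\<in>UNIV. A $ s $ k * A $ s $ i) = (transpose A ** A) $ k $ i"
      by (simp add: matrix_matrix_mult_def transpose_def)
    then show ?thesis using A(1) by (simp add: orthogonal_matrix mat_def)
  qed
  have "(?G ** A) $ r $ i = (A ** D) $ r $ i" for r i
  proof -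
    have "(?G ** A) $ r $ i = (\<Sum>s\<in>UNIV. ((if r = s then 1 else 0) - c * x $ r * x $ s) * A $ s $ i)"
      unfolding matrix_matrix_mult_def by simp
    also have "\<dots> = (\<Sum>s\<in>UNIV. (if r = s then A $ s $ i else 0) - c * x $ r * norm x * (A $ s $ k * A $ s $ i))"
      by (intro sum.cong refl) (subst xs, auto simp: algebra_simps)
    also have "\<dots> = A $ r $ i - c * x $ r * norm x * (if i = k then 1 else 0)"
      by (simp add: sum_subtractf orth flip: sum_distrib_left)
    also have "\<dots> = A $ r $ i * (if i = k then 1 - c * (x \<bullet> x) else 1)"
      by (simp add: xs[of r] dot_square_norm power2_eq_square algebra_simps)
    also have "\<dots> = (A ** D) $ r $ i"
      unfolding matrix_matrix_mult_def D_def by (simp add: if_distrib cong: if_cong)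
    finally show ?thesis .
  qed
  then have "?G ** A = A ** D" unfolding vec_eq_iff by blast
  then have "det (?G ** A) = det (A ** D)" by (rule arg_cong)
  then have "det ?G * det A = det A * det D" unfolding det_mul .
  moreover have "det A \<noteq> 0" using det_orthogonal_matrix[OF A(1)] by auto
  ultimately have "det ?G = det D" by simp
  also have "\<dots> = (\<Prod>i\<in>UNIV. if i = k then 1 - c * (x \<bullet> x) else 1)"
    by (subst det_diagonal) (auto simp: D_def)
  also have "\<dots> = 1 - c * (x \<bullet> x)"
    by simp
  finally show ?thesis .
qed

lemma det_hyp_metric:
  fixes x :: "real ^ 'n::finite"
  assumes "\<kappa> > 0"
  shows "det (hyp_metric \<kappa> x) = 1 / (1 + \<kappa>\<^sup>2 * (x \<bullet> x))"
proof -
  have "1 + \<kappa>\<^sup>2 * (x \<bullet> x) > 0" by (simp add: add_pos_nonneg)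
  have "hyp_metric \<kappa> x = (\<chi> i j. (if i = j then 1 else 0) - \<kappa>\<^sup>2 / (1 + \<kappa>\<^sup>2 * (x \<bullet> x)) * x $ i * x $ j)"
    by (simp add: vec_eq_iff hyp_metric_component[OF assms])
  then have "det (hyp_metric \<kappa> x) = 1 - \<kappa>\<^sup>2 / (1 + \<kappa>\<^sup>2 * (x \<bullet> x)) * (x \<bullet> x)"
    by (simp only: det_rank_one_update)
  with \<open>1 + \<kappa>\<^sup>2 * (x \<bullet> x) > 0\<close> show ?thesis by (simp add: field_simps)
qed

text \<open>The Sherman-Morrison formula for a rank one perturbation of the identity; the inverse is
  polynomial in \<open>x\<close>.\<close>

lemma matrix_inv_hyp_metric:
  fixes x :: "real ^ 'n::finite"
  assumes "\<kappa> > 0"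
  shows "matrix_inv (hyp_metric \<kappa> x) = (\<chi> i j. (if i = j then 1 else 0) + \<kappa>\<^sup>2 * x $ i * x $ j)"
proof (rule matrix_inv_eqI)
  let ?B = "\<chi> i j. (if i = j then 1 else 0) + \<kappa>\<^sup>2 * x $ i * x $ j"
  let ?T = "1 + \<kappa>\<^sup>2 * (x \<bullet> x)"
  have T: "?T > 0" by (simp add: add_pos_nonneg)
  have "(hyp_metric \<kappa> x ** ?B) $ i $ j = (if i = j then 1 else 0)" for i j
  proof -
    define t where "t = \<kappa>\<^sup>2 / ?T"
    have t: "t * ?T = \<kappa>\<^sup>2" using T by (simp add: t_def)
    have "(hyp_metric \<kappa> x ** ?B) $ i $ j =
      (\<Sum>k\<in>UNIV. ((if i = k then 1 else 0) - t * x $ i * x $ k) * ((if k = j then 1 else 0) + \<kappa>\<^sup>2 * x $ k * x $ j))"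
      unfolding matrix_matrix_mult_def by (simp add: hyp_metric_component[OF assms] t_def)
    also have "\<dots> = (\<Sum>k\<in>UNIV. (if i = k then (if k = j then 1 else 0) + \<kappa>\<^sup>2 * x $ k * x $ j else 0)
       - (if k = j then t * x $ i * x $ k else 0) - t * \<kappa>\<^sup>2 * x $ i * x $ j * (x $ k * x $ k))"
      by (intro sum.cong refl) (auto simp: algebra_simps)
    also have "\<dots> = (if i = j then 1 else 0) + \<kappa>\<^sup>2 * x $ i * x $ j - t * x $ i * x $ j
        - t * \<kappa>\<^sup>2 * x $ i * x $ j * (x \<bullet> x)"
      by (simp add: sum_subtractf inner_vec_def flip: sum_distrib_left)
    also have "\<dots> = (if i = j then 1 else 0) + \<kappa>\<^sup>2 * x $ i * x $ j - x $ i * x $ j * (t * ?T)"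
      by (simp add: algebra_simps)
    also have "\<dots> = (if i = j then 1 else 0)"
      unfolding t by simp
    finally show ?thesis .
  qed
  then show "hyp_metric \<kappa> x ** ?B = mat 1"
    by (simp add: vec_eq_iff mat_def)
qed

section \<open>The Laplacian in nondivergence form\<close>

text \<open>The Laplace-Beltrami operator with the outer derivative carried out. The coefficients
  become polynomials, so that Leibniz and chain rules are mechanical.\<close>

definition hyp_laplacian :: "real \<Rightarrow> (real ^ 'n::finite \<Rightarrow> 'b::real_normed_vector) \<Rightarrow> real ^ 'n \<Rightarrow> 'b" where
  "hyp_laplacian \<kappa> f x = laplacian f x
     + \<kappa>\<^sup>2 *\<^sub>R (\<Sum>i\<in>UNIV. \<Sum>j\<in>UNIV. (x $ i * x $ j) *\<^sub>R partial_deriv i (partial_deriv j f) x)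
     + (\<kappa>\<^sup>2 * real CARD('n)) *\<^sub>R (\<Sum>i\<in>UNIV. x $ i *\<^sub>R partial_deriv i f x)"

lemma laplace_beltrami_hyp_metric:
  fixes f :: "real ^ 'n::finite \<Rightarrow> 'b::real_normed_vector"
  assumes \<kappa>: "\<kappa> > 0" and f: "Ck 2 f"
  shows "laplace_beltrami (hyp_metric \<kappa>) f x = hyp_laplacian \<kappa> f x"
proof -
  let ?Q = "\<lambda>y :: real ^ 'n. 1 + \<kappa>\<^sup>2 * (y \<bullet> y)"
  define T where "T = sqrt (?Q x)"
  have Q: "?Q y > 0" for y by (simp add: add_pos_nonneg)
  have T: "T > 0" "T\<^sup>2 = ?Q x" using Q[of x] by (simp_all add: T_def)
  have sd: "sqrt (det (hyp_metric \<kappa> y)) = inverse (sqrt (?Q y))" for y :: "real ^ 'n"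
    by (simp add: det_hyp_metric[OF \<kappa>] real_sqrt_divide inverse_eq_divide)
  let ?w = "\<lambda>i j y. inverse (sqrt (?Q y)) * ((if i = j then 1 else 0) + \<kappa>\<^sup>2 * y $ i * y $ j)"
  have "((\<lambda>y. inverse (sqrt (?Q y))) has_derivative (\<lambda>h. - (\<kappa>\<^sup>2 * (x \<bullet> h)) / T ^ 3)) (at x)"
  proof -
    have "((\<lambda>y. ?Q y) has_derivative (\<lambda>h. 0 + \<kappa>\<^sup>2 * (x \<bullet> h + h \<bullet> x))) (at x)"
      by (intro has_derivative_add has_derivative_const has_derivative_mult_right has_derivative_inner has_derivative_ident)
    from DERIV_compose_FDERIV[OF DERIV_real_sqrt[OF Q] this]
    have "((\<lambda>y. sqrt (?Q y)) has_derivative (\<lambda>h. \<kappa>\<^sup>2 * (x \<bullet> h) / T)) (at x)"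
      by (rule has_derivative_eq_rhs) (auto simp: fun_eq_iff T_def inner_commute field_simps)
    from Deriv.has_derivative_inverse[OF _ this]
    have "((\<lambda>y. inverse (sqrt (?Q y))) has_derivative (\<lambda>h. - (inverse T * (\<kappa>\<^sup>2 * (x \<bullet> h) / T) * inverse T))) (at x)"
      using T(1) unfolding T_def by simp
    then show ?thesis
      by (rule has_derivative_eq_rhs) (simp add: fun_eq_iff power3_eq_cube inverse_eq_divide)
  qed
  note inv = this
  have Tinv: "inverse (sqrt (?Q x)) = 1 / T" by (simp add: T_def inverse_eq_divide)
  have comp: "((\<lambda>y. y $ i) has_derivative (\<lambda>h. h $ i)) (at x)" for i
    by (rule bounded_linear_imp_has_derivative[OF bounded_linear_vec_nth])
  have w: "(?w i j has_derivative (\<lambda>h. 1 / T * (\<kappa>\<^sup>2 * (h $ i * x $ j + x $ i * h $ j))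
      - \<kappa>\<^sup>2 * (x \<bullet> h) / T ^ 3 * ((if i = j then 1 else 0) + \<kappa>\<^sup>2 * x $ i * x $ j))) (at x)" for i j
    by (rule has_derivative_eq_rhs[OF has_derivative_mult[OF inv has_derivative_add[OF has_derivative_const
            has_derivative_mult[OF has_derivative_mult_right[OF comp] comp]]]])
      (rule ext, simp only: Tinv, simp add: algebra_simps)
  have d: "partial_deriv j f differentiable (at x)" for j
    using Ck_2_partials(7)[OF f] .
  have ax: "axis i (1::real) $ j = (if i = j then 1 else 0)" for i j :: 'n
    by (simp add: axis_def)
  have pd: "partial_deriv i (\<lambda>y. \<Sum>j\<in>UNIV. ?w i j y *\<^sub>R partial_deriv j f y) x =
     (\<Sum>j\<in>UNIV. ?w i j x *\<^sub>R partial_deriv i (partial_deriv j f) x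
       + (1 / T * (\<kappa>\<^sup>2 * (x $ j + x $ i * (if i = j then 1 else 0)))
      - \<kappa>\<^sup>2 * x $ i / T ^ 3 * ((if i = j then 1 else 0) + \<kappa>\<^sup>2 * x $ i * x $ j)) *\<^sub>R partial_deriv j f x)" for i
    by (subst partial_deriv_eq[OF has_derivative_sum[OF has_derivative_scaleR[OF w has_derivative_partial_derivs[OF d]]]])
      (simp only: sum_axis_scaleR, simp add: inner_axis ax)
  have "laplace_beltrami (hyp_metric \<kappa>) f x =
    T *\<^sub>R (\<Sum>i\<in>UNIV. partial_deriv i (\<lambda>y. \<Sum>j\<in>UNIV. ?w i j y *\<^sub>R partial_deriv j f y) x)"
    unfolding laplace_beltrami_def sd matrix_inv_hyp_metric[OF \<kappa>] by (simp add: T_def inverse_eq_divide)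
  also have "\<dots> = (\<Sum>i\<in>UNIV. \<Sum>j\<in>UNIV. ((if i = j then 1 else 0) + \<kappa>\<^sup>2 * x $ i * x $ j) *\<^sub>R partial_deriv i (partial_deriv j f) x
       + (\<kappa>\<^sup>2 * (x $ j + x $ i * (if i = j then 1 else 0))
      - \<kappa>\<^sup>2 * x $ i / T\<^sup>2 * ((if i = j then 1 else 0) + \<kappa>\<^sup>2 * x $ i * x $ j)) *\<^sub>R partial_deriv j f x)"
    unfolding pd scaleR_sum_right
  proof (intro sum.cong refl)
    fix i j
    show "T *\<^sub>R (?w i j x *\<^sub>R partial_deriv i (partial_deriv j f) x
       + (1 / T * (\<kappa>\<^sup>2 * (x $ j + x $ i * (if i = j then 1 else 0)))
      - \<kappa>\<^sup>2 * x $ i / T ^ 3 * ((if i = j then 1 else 0) + \<kappa>\<^sup>2 * x $ i * x $ j)) *\<^sub>R partial_deriv j f x)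
     = ((if i = j then 1 else 0) + \<kappa>\<^sup>2 * x $ i * x $ j) *\<^sub>R partial_deriv i (partial_deriv j f) x
       + (\<kappa>\<^sup>2 * (x $ j + x $ i * (if i = j then 1 else 0))
      - \<kappa>\<^sup>2 * x $ i / T\<^sup>2 * ((if i = j then 1 else 0) + \<kappa>\<^sup>2 * x $ i * x $ j)) *\<^sub>R partial_deriv j f x"
      unfolding scaleR_add_right scaleR_scaleR T_def[symmetric]
      using T(1) by (intro arg_cong2[where f="(+)"] arg_cong2[where f="(*\<^sub>R)"] refl)
        (simp_all add: right_diff_distrib power3_eq_cube power2_eq_square)
  qed
  also have "\<dots> = (\<Sum>i\<in>UNIV. \<Sum>j\<in>UNIV. ((if i = j then 1 else 0) + \<kappa>\<^sup>2 * x $ i * x $ j) *\<^sub>R partial_deriv i (partial_deriv j f) x)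
     + (\<Sum>j\<in>UNIV. (\<Sum>i\<in>UNIV. \<kappa>\<^sup>2 * (x $ j + x $ i * (if i = j then 1 else 0))
      - \<kappa>\<^sup>2 * x $ i / T\<^sup>2 * ((if i = j then 1 else 0) + \<kappa>\<^sup>2 * x $ i * x $ j)) *\<^sub>R partial_deriv j f x)"
    unfolding sum.distrib scaleR_sum_left by (subst (2) sum.swap) (rule refl)
  also have "(\<Sum>i\<in>UNIV. \<Sum>j\<in>UNIV. ((if i = j then 1 else 0) + \<kappa>\<^sup>2 * x $ i * x $ j) *\<^sub>R partial_deriv i (partial_deriv j f) x)
     = laplacian f x + \<kappa>\<^sup>2 *\<^sub>R (\<Sum>i\<in>UNIV. \<Sum>j\<in>UNIV. (x $ i * x $ j) *\<^sub>R partial_deriv i (partial_deriv j f) x)"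
    by (simp add: scaleR_add_left sum.distrib laplacian_def scaleR_sum_right mult.assoc if_distrib[of "\<lambda>r. r *\<^sub>R _"] cong: if_cong)
  also have "(\<Sum>j\<in>UNIV. (\<Sum>i\<in>UNIV. \<kappa>\<^sup>2 * (x $ j + x $ i * (if i = j then 1 else 0))
      - \<kappa>\<^sup>2 * x $ i / T\<^sup>2 * ((if i = j then 1 else 0) + \<kappa>\<^sup>2 * x $ i * x $ j)) *\<^sub>R partial_deriv j f x)
    = (\<Sum>j\<in>UNIV. (\<kappa>\<^sup>2 * real CARD('n) * x $ j) *\<^sub>R partial_deriv j f x)"
  proof (intro sum.cong refl arg_cong2[where f="(*\<^sub>R)"])
    fix j
    have "(\<Sum>i\<in>UNIV. \<kappa>\<^sup>2 * (x $ j + x $ i * (if i = j then 1 else 0))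
      - \<kappa>\<^sup>2 * x $ i / T\<^sup>2 * ((if i = j then 1 else 0) + \<kappa>\<^sup>2 * x $ i * x $ j))
      = (\<Sum>i\<in>UNIV. \<kappa>\<^sup>2 * x $ j + (if i = j then \<kappa>\<^sup>2 * x $ i - \<kappa>\<^sup>2 * x $ i / T\<^sup>2 else 0) - \<kappa>\<^sup>2 / T\<^sup>2 * \<kappa>\<^sup>2 * x $ j * (x $ i * x $ i))"
      by (intro sum.cong refl) (auto simp: algebra_simps)
    also have "\<dots> = \<kappa>\<^sup>2 * real CARD('n) * x $ j + \<kappa>\<^sup>2 * x $ j - \<kappa>\<^sup>2 * x $ j / T\<^sup>2 - \<kappa>\<^sup>2 / T\<^sup>2 * \<kappa>\<^sup>2 * x $ j * (x \<bullet> x)"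
      by (simp add: sum_subtractf sum.distrib inner_vec_def flip: sum_distrib_left sum_divide_distrib)
    also have "\<dots> = \<kappa>\<^sup>2 * real CARD('n) * x $ j + \<kappa>\<^sup>2 * x $ j - \<kappa>\<^sup>2 * x $ j * (?Q x / T\<^sup>2)"
      by (simp add: add_divide_distrib algebra_simps)
    \<comment> \<open>The last two terms of the previous line cancel because \<open>T\<close> is the
      square root of \<open>?Q x\<close>.\<close>
    also have "\<dots> = \<kappa>\<^sup>2 * real CARD('n) * x $ j"
      using T Q[of x] by simp
    finally show "(\<Sum>i\<in>UNIV. \<kappa>\<^sup>2 * (x $ j + x $ i * (if i = j then 1 else 0))
      - \<kappa>\<^sup>2 * x $ i / T\<^sup>2 * ((if i = j then 1 else 0) + \<kappa>\<^sup>2 * x $ i * x $ j)) = \<kappa>\<^sup>2 * real CARD('n) * x $ j" .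
  qed
  finally show ?thesis
    by (simp add: hyp_laplacian_def scaleR_sum_right)
qed

section \<open>Leibniz and chain rules\<close>

lemma partial_deriv_scaleR_fun:
  fixes g :: "real ^ 'n::finite \<Rightarrow> 'b::real_normed_vector"
  assumes "f differentiable (at x)" "g differentiable (at x)"
  shows "partial_deriv i (\<lambda>x. f x *\<^sub>R g x) x = f x *\<^sub>R partial_deriv i g x + partial_deriv i f x *\<^sub>R g x"
  by (subst partial_deriv_eq[OF has_derivative_scaleR[OF has_derivative_partial_derivs[OF assms(1)]
          has_derivative_partial_derivs[OF assms(2)]]], simp only: sum_axis_scaleR)

lemma partial_deriv_add:
  fixes g :: "real ^ 'n::finite \<Rightarrow> 'b::real_normed_vector"
  assumes "f differentiable (at x)" "g differentiable (at x)"
  shows "partial_deriv i (\<lambda>x. f x + g x) x = partial_deriv i f x + partial_deriv i g x"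
  by (subst partial_deriv_eq[OF has_derivative_add[OF has_derivative_partial_derivs[OF assms(1)]
          has_derivative_partial_derivs[OF assms(2)]]], simp only: sum_axis_scaleR)

lemma partial_deriv_sum:
  fixes g :: "'j \<Rightarrow> real ^ 'n::finite \<Rightarrow> 'b::real_normed_vector"
  assumes "\<And>j. j \<in> A \<Longrightarrow> g j differentiable (at x)"
  shows "partial_deriv i (\<lambda>x. \<Sum>j\<in>A. g j x) x = (\<Sum>j\<in>A. partial_deriv i (g j) x)"
  by (subst partial_deriv_eq[OF has_derivative_sum[OF has_derivative_partial_derivs[OF assms]]],
      assumption, simp only: sum_axis_scaleR)

lemma partial_deriv_compose_vec:
  fixes q :: "real ^ 'm::finite \<Rightarrow> 'b::real_normed_vector" and Y :: "real^'n::finite \<Rightarrow> real^'m"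
  assumes "q differentiable (at (Y x))" "\<And>l. (\<lambda>x. Y x $ l) differentiable (at x)"
  shows "partial_deriv i (\<lambda>x. q (Y x)) x =
    (\<Sum>l\<in>UNIV. partial_deriv i (\<lambda>x. Y x $ l) x *\<^sub>R partial_deriv l q (Y x))"
  by (subst partial_deriv_eq[OF has_derivative_compose_vec[OF assms]], simp only: sum_axis_scaleR)

text \<open>The inner product of the two gradients in the hyperbolic metric, that is the inverse
  metric applied to the differentials; \<open>g\<close> may be vector valued.\<close>

definition hyp_gradient_product ::
  "real \<Rightarrow> (real ^ 'n::finite \<Rightarrow> real) \<Rightarrow> (real ^ 'n \<Rightarrow> 'b::real_normed_vector) \<Rightarrow> real ^ 'n \<Rightarrow> 'b" where
  "hyp_gradient_product \<kappa> f g x = (\<Sum>i\<in>UNIV. partial_deriv i f x *\<^sub>R partial_deriv i g x)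
     + \<kappa>\<^sup>2 *\<^sub>R ((\<Sum>i\<in>UNIV. x $ i * partial_deriv i f x) *\<^sub>R (\<Sum>j\<in>UNIV. x $ j *\<^sub>R partial_deriv j g x))"

text \<open>The two mixed sums coincide because the coefficients \<open>x $ i * x $ j\<close> are
  symmetric, whence the factor 2.\<close>

lemma hyp_laplacian_scaleR:
  fixes g :: "real ^ 'n::finite \<Rightarrow> 'b::real_normed_vector"
  assumes f: "Ck 2 f" and g: "Ck 2 g"
  shows "hyp_laplacian \<kappa> (\<lambda>x. f x *\<^sub>R g x) x =
    f x *\<^sub>R hyp_laplacian \<kappa> g x + hyp_laplacian \<kappa> f x *\<^sub>R g x + 2 *\<^sub>R hyp_gradient_product \<kappa> f g x"
proof -
  note df = Ck_2_partials(6,7)[OF f] and dg = Ck_2_partials(6,7)[OF g]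
  have p1: "partial_deriv j (\<lambda>x. f x *\<^sub>R g x) = (\<lambda>x. f x *\<^sub>R partial_deriv j g x + partial_deriv j f x *\<^sub>R g x)" for j
    by (rule ext, rule partial_deriv_scaleR_fun[OF df(1) dg(1)])
  have p2: "partial_deriv i (partial_deriv j (\<lambda>x. f x *\<^sub>R g x)) x =
    f x *\<^sub>R partial_deriv i (partial_deriv j g) x + partial_deriv i f x *\<^sub>R partial_deriv j g x
    + (partial_deriv j f x *\<^sub>R partial_deriv i g x + partial_deriv i (partial_deriv j f) x *\<^sub>R g x)" for i j
    unfolding p1 using df dg
    by (subst partial_deriv_add) (auto simp: partial_deriv_scaleR_fun intro!: differentiable_scaleR)
  define a where "a i = partial_deriv i f x" for i
  define b where "b i = partial_deriv i g x" for i
  define A where "A i j = partial_deriv i (partial_deriv j f) x" for i j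
  define B where "B i j = partial_deriv i (partial_deriv j g) x" for i j
  have 1: "laplacian (\<lambda>x. f x *\<^sub>R g x) x = f x *\<^sub>R (\<Sum>i\<in>UNIV. B i i) + (\<Sum>i\<in>UNIV. A i i) *\<^sub>R g x
      + 2 *\<^sub>R (\<Sum>i\<in>UNIV. a i *\<^sub>R b i)"
    unfolding laplacian_def p2 a_def[symmetric] b_def[symmetric] A_def[symmetric] B_def[symmetric]
    by (simp only: sum.distrib scaleR_2 scaleR_sum_right[symmetric] scaleR_sum_left[symmetric] add_ac)
  have s: "(\<Sum>i\<in>UNIV. \<Sum>j\<in>UNIV. (x $ i * x $ j) *\<^sub>R (a i *\<^sub>R b j)) = (\<Sum>i\<in>UNIV. x $ i * a i) *\<^sub>R (\<Sum>j\<in>UNIV. x $ j *\<^sub>R b j)"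
    unfolding scaleR_sum_left by (intro sum.cong refl) (simp add: scaleR_sum_right mult_ac)
  have s': "(\<Sum>i\<in>UNIV. \<Sum>j\<in>UNIV. (x $ i * x $ j) *\<^sub>R (a j *\<^sub>R b i)) = (\<Sum>i\<in>UNIV. x $ i * a i) *\<^sub>R (\<Sum>j\<in>UNIV. x $ j *\<^sub>R b j)"
    unfolding s[symmetric] by (subst sum.swap) (simp add: mult.commute)
  have 2: "(\<Sum>i\<in>UNIV. \<Sum>j\<in>UNIV. (x $ i * x $ j) *\<^sub>R partial_deriv i (partial_deriv j (\<lambda>x. f x *\<^sub>R g x)) x)
    = f x *\<^sub>R (\<Sum>i\<in>UNIV. \<Sum>j\<in>UNIV. (x $ i * x $ j) *\<^sub>R B i j) + (\<Sum>i\<in>UNIV. \<Sum>j\<in>UNIV. (x $ i * x $ j) * A i j) *\<^sub>R g x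
      + 2 *\<^sub>R ((\<Sum>i\<in>UNIV. x $ i * a i) *\<^sub>R (\<Sum>j\<in>UNIV. x $ j *\<^sub>R b j))"
  proof -
    have "(\<Sum>i\<in>UNIV. \<Sum>j\<in>UNIV. (x $ i * x $ j) *\<^sub>R partial_deriv i (partial_deriv j (\<lambda>x. f x *\<^sub>R g x)) x)
      = (\<Sum>i\<in>UNIV. \<Sum>j\<in>UNIV. f x *\<^sub>R ((x $ i * x $ j) *\<^sub>R B i j)) + (\<Sum>i\<in>UNIV. \<Sum>j\<in>UNIV. ((x $ i * x $ j) * A i j) *\<^sub>R g x)
      + (\<Sum>i\<in>UNIV. \<Sum>j\<in>UNIV. (x $ i * x $ j) *\<^sub>R (a i *\<^sub>R b j)) + (\<Sum>i\<in>UNIV. \<Sum>j\<in>UNIV. (x $ i * x $ j) *\<^sub>R (a j *\<^sub>R b i))"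
      unfolding p2 a_def[symmetric] b_def[symmetric] A_def[symmetric] B_def[symmetric]
        sum.distrib[symmetric]
      by (intro sum.cong refl) (simp add: scaleR_add_right mult_ac)
    then show ?thesis unfolding s s'
      by (simp only: scaleR_sum_right[symmetric] scaleR_sum_left[symmetric] scaleR_2 add.assoc)
  qed
  have 3: "(\<Sum>i\<in>UNIV. x $ i *\<^sub>R partial_deriv i (\<lambda>x. f x *\<^sub>R g x) x) =
      f x *\<^sub>R (\<Sum>i\<in>UNIV. x $ i *\<^sub>R b i) + (\<Sum>i\<in>UNIV. x $ i * a i) *\<^sub>R g x"
    unfolding p1 a_def[symmetric] b_def[symmetric]
    by (simp add: scaleR_add_right sum.distrib scaleR_sum_left scaleR_sum_right mult_ac)
  show ?thesis
    unfolding hyp_laplacian_def hyp_gradient_product_def 1 2 3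
    unfolding laplacian_def a_def[symmetric] b_def[symmetric] A_def[symmetric] B_def[symmetric] real_scaleR_def
    by (simp add: scaleR_add_right scaleR_add_left mult_ac)
qed

lemma hyp_laplacian_compose:
  fixes q :: "real ^ 'm::finite \<Rightarrow> 'b::real_normed_vector" and Y :: "real^'n::finite \<Rightarrow> real^'m"
  assumes q: "Ck 2 q" and Y: "\<And>l. Ck 2 (\<lambda>x. Y x $ l)"
  shows "hyp_laplacian \<kappa> (\<lambda>x. q (Y x)) x =
    (\<Sum>l\<in>UNIV. hyp_laplacian \<kappa> (\<lambda>x. Y x $ l) x *\<^sub>R partial_deriv l q (Y x))
    + (\<Sum>l\<in>UNIV. \<Sum>m\<in>UNIV. hyp_gradient_product \<kappa> (\<lambda>x. Y x $ m) (\<lambda>x. Y x $ l) x *\<^sub>R partial_deriv m (partial_deriv l q) (Y x))"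
proof -
  note dq = Ck_2_partials(6,7)[OF q] and dY = Ck_2_partials(6,7)[OF Y]
  have p1: "partial_deriv j (\<lambda>x. q (Y x)) = (\<lambda>x. \<Sum>l\<in>UNIV. partial_deriv j (\<lambda>x. Y x $ l) x *\<^sub>R partial_deriv l q (Y x))" for j
    by (rule ext, rule partial_deriv_compose_vec[OF dq(1) dY(1)])
  have dc: "(\<lambda>x. partial_deriv l q (Y x)) differentiable (at x)" for l x
    using has_derivative_compose_vec[OF dq(2) dY(1)] by (rule differentiableI)
  have p2: "partial_deriv i (partial_deriv j (\<lambda>x. q (Y x))) x =
    (\<Sum>l\<in>UNIV. partial_deriv i (partial_deriv j (\<lambda>x. Y x $ l)) x *\<^sub>R partial_deriv l q (Y x))
    + (\<Sum>l\<in>UNIV. \<Sum>m\<in>UNIV. (partial_deriv j (\<lambda>x. Y x $ l) x * partial_deriv i (\<lambda>x. Y x $ m) x) *\<^sub>R partial_deriv m (partial_deriv l q) (Y x))" for i j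
    unfolding p1 using dc dY
    by (subst partial_deriv_sum)
      (auto simp: partial_deriv_scaleR_fun partial_deriv_compose_vec[OF dq(2) dY(1)] sum.distrib scaleR_sum_right add.commute
        intro!: differentiable_scaleR)
  define a where "a i l = partial_deriv i (\<lambda>x. Y x $ l) x" for i l
  define A where "A i j l = partial_deriv i (partial_deriv j (\<lambda>x. Y x $ l)) x" for i j l
  define b where "b l = partial_deriv l q (Y x)" for l
  define B where "B m l = partial_deriv m (partial_deriv l q) (Y x)" for m l
  note abbr = a_def[symmetric] A_def[symmetric] b_def[symmetric] B_def[symmetric]
  have swap3: "(\<Sum>i\<in>UNIV. \<Sum>l\<in>UNIV. \<Sum>m\<in>UNIV. f i l m) = (\<Sum>l\<in>UNIV. \<Sum>m\<in>UNIV. \<Sum>i\<in>UNIV. f i l m)"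
    for f :: "'n \<Rightarrow> 'm \<Rightarrow> 'm \<Rightarrow> 'b"
    by (subst sum.swap) (intro sum.cong refl, rule sum.swap)
  have swap2: "(\<Sum>i\<in>UNIV. \<Sum>j\<in>UNIV. \<Sum>l\<in>UNIV. f i j l) = (\<Sum>l\<in>UNIV. \<Sum>i\<in>UNIV. \<Sum>j\<in>UNIV. f i j l)"
    for f :: "'n \<Rightarrow> 'n \<Rightarrow> 'm \<Rightarrow> 'b"
  proof -
    have "(\<Sum>i\<in>UNIV. \<Sum>j\<in>UNIV. \<Sum>l\<in>UNIV. f i j l) = (\<Sum>i\<in>UNIV. \<Sum>l\<in>UNIV. \<Sum>j\<in>UNIV. f i j l)"
      by (intro sum.cong refl, rule sum.swap)
    also have "\<dots> = (\<Sum>l\<in>UNIV. \<Sum>i\<in>UNIV. \<Sum>j\<in>UNIV. f i j l)" by (rule sum.swap)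
    finally show ?thesis .
  qed
  have 1: "laplacian (\<lambda>x. q (Y x)) x = (\<Sum>l\<in>UNIV. (\<Sum>i\<in>UNIV. A i i l) *\<^sub>R b l)
      + (\<Sum>l\<in>UNIV. \<Sum>m\<in>UNIV. (\<Sum>i\<in>UNIV. a i m * a i l) *\<^sub>R B m l)"
    unfolding laplacian_def p2 abbr sum.distrib
    by (subst sum.swap, subst swap3) (simp add: scaleR_sum_left mult.commute)
  have 2: "(\<Sum>i\<in>UNIV. \<Sum>j\<in>UNIV. (x $ i * x $ j) *\<^sub>R partial_deriv i (partial_deriv j (\<lambda>x. q (Y x))) x)
     = (\<Sum>l\<in>UNIV. (\<Sum>i\<in>UNIV. \<Sum>j\<in>UNIV. x $ i * x $ j * A i j l) *\<^sub>R b l)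
      + (\<Sum>l\<in>UNIV. \<Sum>m\<in>UNIV. ((\<Sum>i\<in>UNIV. x $ i * a i m) * (\<Sum>j\<in>UNIV. x $ j * a j l)) *\<^sub>R B m l)"
  proof -
    have "(\<Sum>i\<in>UNIV. \<Sum>j\<in>UNIV. (x $ i * x $ j) *\<^sub>R partial_deriv i (partial_deriv j (\<lambda>x. q (Y x))) x)
      = (\<Sum>i\<in>UNIV. \<Sum>j\<in>UNIV. \<Sum>l\<in>UNIV. (x $ i * x $ j * A i j l) *\<^sub>R b l)
      + (\<Sum>i\<in>UNIV. \<Sum>j\<in>UNIV. \<Sum>l\<in>UNIV. \<Sum>m\<in>UNIV. ((x $ i * a i m) * (x $ j * a j l)) *\<^sub>R B m l)"
      unfolding p2 abbr sum.distrib[symmetric] scaleR_add_right scaleR_sum_right scaleR_scaleR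
      by (intro sum.cong refl arg_cong2[where f="(+)"]) (simp_all add: mult_ac)
    also have "(\<Sum>i\<in>UNIV. \<Sum>j\<in>UNIV. \<Sum>l\<in>UNIV. \<Sum>m\<in>UNIV. ((x $ i * a i m) * (x $ j * a j l)) *\<^sub>R B m l)
      = (\<Sum>l\<in>UNIV. \<Sum>m\<in>UNIV. \<Sum>i\<in>UNIV. \<Sum>j\<in>UNIV. ((x $ i * a i m) * (x $ j * a j l)) *\<^sub>R B m l)"
      by (simp only: swap3)
    finally show ?thesis
      unfolding swap2 by (simp add: scaleR_sum_left sum_product)
  qed
  have 3: "(\<Sum>i\<in>UNIV. x $ i *\<^sub>R partial_deriv i (\<lambda>x. q (Y x)) x) = (\<Sum>l\<in>UNIV. (\<Sum>i\<in>UNIV. x $ i * a i l) *\<^sub>R b l)"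
    unfolding p1 abbr scaleR_sum_right by (subst sum.swap) (simp add: scaleR_sum_left)
  show ?thesis
    unfolding hyp_laplacian_def hyp_gradient_product_def 1 2 3
    unfolding laplacian_def abbr real_scaleR_def
    by (simp add: scaleR_sum_right scaleR_add_left sum.distrib algebra_simps)
qed

section \<open>Linear functions of Minkowski space\<close>

text \<open>The time coordinate of the point of the hyperboloid over \<open>x\<close>.\<close>

definition hyp_height :: "real \<Rightarrow> real ^ 'n::finite \<Rightarrow> real" where
  "hyp_height \<kappa> x = sqrt (1 / \<kappa>\<^sup>2 + x \<bullet> x)"

text \<open>The restriction to the hyperboloid of a linear function of Minkowski space. Laplacians
  and gradient products of such functions depend only on their values and on Minkowski products of
  their coefficients.\<close>

definition ambient_linear :: "real \<Rightarrow> real ^ 'n::finite \<Rightarrow> real \<Rightarrow> real ^ 'n \<Rightarrow> real" where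
  "ambient_linear \<kappa> a a\<^sub>0 x = a \<bullet> x + a\<^sub>0 * hyp_height \<kappa> x"

lemma hyp_height_props:
  assumes "\<kappa> > 0"
  shows "hyp_height \<kappa> x > 0" "(hyp_height \<kappa> x)\<^sup>2 = 1 / \<kappa>\<^sup>2 + x \<bullet> x" "\<kappa>\<^sup>2 * (x \<bullet> x) = \<kappa>\<^sup>2 * (hyp_height \<kappa> x)\<^sup>2 - 1"
proof -
  have pos: "1 / \<kappa>\<^sup>2 + x \<bullet> x > 0"
    using assms by (simp add: add_pos_nonneg)
  then show "hyp_height \<kappa> x > 0" "(hyp_height \<kappa> x)\<^sup>2 = 1 / \<kappa>\<^sup>2 + x \<bullet> x"
    by (simp_all add: hyp_height_def)
  then show "\<kappa>\<^sup>2 * (x \<bullet> x) = \<kappa>\<^sup>2 * (hyp_height \<kappa> x)\<^sup>2 - 1"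
    using assms by (simp add: algebra_simps)
qed

lemma has_derivative_hyp_height_inner:
  assumes "\<kappa> > 0"
  shows "(hyp_height \<kappa> has_derivative (\<lambda>h. x \<bullet> h / hyp_height \<kappa> x)) (at x)"
proof -
  have pos: "1 / \<kappa>\<^sup>2 + x \<bullet> x > 0"
    using assms by (simp add: add_pos_nonneg)
  have "((\<lambda>y. 1 / \<kappa>\<^sup>2 + y \<bullet> y) has_derivative (\<lambda>h. 0 + (x \<bullet> h + h \<bullet> x))) (at x)"
    by (intro has_derivative_add has_derivative_const has_derivative_inner has_derivative_ident)
  from DERIV_compose_FDERIV[OF DERIV_real_sqrt[OF pos] this] show ?thesis
    unfolding hyp_height_def[abs_def]
    by (rule has_derivative_eq_rhs) (simp add: fun_eq_iff inner_commute field_simps)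
qed

lemma has_derivative_hyp_height:
  assumes "\<kappa> > 0"
  shows "(hyp_height \<kappa> has_derivative (\<lambda>h. \<Sum>i\<in>UNIV. h $ i *\<^sub>R (x $ i * inverse (hyp_height \<kappa> x)))) (at x)"
  by (rule has_derivative_eq_rhs[OF has_derivative_hyp_height_inner[OF assms]])
    (simp add: fun_eq_iff inner_vec_def divide_inverse sum_distrib_left mult_ac)

lemma Ck_hyp_height:
  assumes "\<kappa> > 0"
  shows "Ck k (hyp_height \<kappa> :: real ^ 'n::finite \<Rightarrow> real)"
proof (induction k)
  case 0
  show ?case unfolding Ck_0
    by (intro continuous_at_imp_continuous_on ballI has_derivative_continuous[OF has_derivative_hyp_height[OF assms]])
next
  case (Suc k)
  show ?case
    by (rule Ck_SucI[OF has_derivative_hyp_height[OF assms]])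
      (intro Ck_converges_mult Ck_component Ck_converges_inverse hyp_height_props(1)[OF assms] Suc)
qed

lemma Ck_ambient_linear:
  assumes "\<kappa> > 0"
  shows "Ck k (ambient_linear \<kappa> a a\<^sub>0)"
  unfolding ambient_linear_def[abs_def] inner_vec_def inner_real_def
  by (intro Ck_converges_add Ck_converges_sum Ck_converges_mult Ck_const Ck_component Ck_hyp_height assms)

lemma has_derivative_ambient_linear:
  assumes "\<kappa> > 0"
  shows "(ambient_linear \<kappa> a a\<^sub>0 has_derivative (\<lambda>h. a \<bullet> h + a\<^sub>0 * (x \<bullet> h / hyp_height \<kappa> x))) (at x)"
  unfolding ambient_linear_def[abs_def]
  by (intro has_derivative_add has_derivative_mult_right has_derivative_hyp_height_inner[OF assms]
      has_derivative_inner_right has_derivative_ident)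

lemma partial_deriv_ambient_linear:
  assumes \<kappa>: "\<kappa> > 0"
  shows "partial_deriv i (ambient_linear \<kappa> a a\<^sub>0) = (\<lambda>x. a $ i + a\<^sub>0 * (x $ i * inverse (hyp_height \<kappa> x)))"
  by (rule ext, subst partial_deriv_eq[OF has_derivative_ambient_linear[OF \<kappa>]])
    (simp add: inner_axis divide_inverse)

lemma second_partial_deriv_ambient_linear:
  assumes \<kappa>: "\<kappa> > 0"
  shows "partial_deriv i (partial_deriv j (ambient_linear \<kappa> a a\<^sub>0)) x =
    a\<^sub>0 * ((if i = j then 1 else 0) / hyp_height \<kappa> x - x $ i * x $ j / hyp_height \<kappa> x ^ 3)"
proof -
  let ?S = "hyp_height \<kappa>"
  have S: "?S x > 0" using hyp_height_props(1)[OF \<kappa>] .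
  have "((\<lambda>x. a $ j + a\<^sub>0 * (x $ j * inverse (?S x))) has_derivative
    (\<lambda>h. 0 + a\<^sub>0 * (x $ j * (- (inverse (?S x) * (x \<bullet> h / ?S x) * inverse (?S x))) + h $ j * inverse (?S x)))) (at x)"
    using S by (intro has_derivative_add has_derivative_const has_derivative_mult_right has_derivative_mult
        Deriv.has_derivative_inverse has_derivative_hyp_height_inner[OF \<kappa>]
        bounded_linear_imp_has_derivative[OF bounded_linear_vec_nth]) auto
  from partial_deriv_eq[OF this, of i] show ?thesis
    unfolding partial_deriv_ambient_linear[OF \<kappa>] using S
    by (simp add: inner_axis) (auto simp: axis_def field_simps power3_eq_cube)
qed

text \<open>The hyperbolic counterpart of spherical harmonics of degree one. The relation
  \<open>1 + \<kappa>\<^sup>2 * w = \<kappa>\<^sup>2 * s\<^sup>2\<close> collapses all quotients by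
  the height.\<close>

lemma hyp_laplacian_ambient_linear:
  fixes x :: "real ^ 'n::finite"
  assumes \<kappa>: "\<kappa> > 0"
  shows "hyp_laplacian \<kappa> (ambient_linear \<kappa> a a\<^sub>0) x = \<kappa>\<^sup>2 * real CARD('n) * ambient_linear \<kappa> a a\<^sub>0 x"
proof -
  let ?n = "real CARD('n)"
  define s where "s = hyp_height \<kappa> x"
  define w where "w = x \<bullet> x"
  have s: "s > 0" "\<kappa>\<^sup>2 * w = \<kappa>\<^sup>2 * s\<^sup>2 - 1"
    using hyp_height_props[OF \<kappa>] by (simp_all add: s_def w_def)
  have w: "(\<Sum>i\<in>UNIV. x $ i * x $ i) = w" by (simp add: w_def inner_vec_def)
  have 1: "laplacian (ambient_linear \<kappa> a a\<^sub>0) x = a\<^sub>0 * (?n / s - w / s ^ 3)"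
    unfolding laplacian_def second_partial_deriv_ambient_linear[OF \<kappa>] s_def[symmetric]
    by (simp add: sum_distrib_left[symmetric] sum_subtractf sum_divide_distrib[symmetric] w)
  have 2: "(\<Sum>i\<in>UNIV. \<Sum>j\<in>UNIV. (x $ i * x $ j) *\<^sub>R partial_deriv i (partial_deriv j (ambient_linear \<kappa> a a\<^sub>0)) x)
    = a\<^sub>0 * (w / s - w\<^sup>2 / s ^ 3)"
  proof -
    have "(\<Sum>i\<in>UNIV. \<Sum>j\<in>UNIV. (x $ i * x $ j) *\<^sub>R partial_deriv i (partial_deriv j (ambient_linear \<kappa> a a\<^sub>0)) x)
      = (\<Sum>i\<in>UNIV. \<Sum>j\<in>UNIV. (if i = j then a\<^sub>0 / s * (x $ i * x $ i) else 0) - a\<^sub>0 / s ^ 3 * ((x $ i * x $ i) * (x $ j * x $ j)))"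
      unfolding second_partial_deriv_ambient_linear[OF \<kappa>] s_def[symmetric]
      by (intro sum.cong refl) (auto simp: algebra_simps)
    also have "\<dots> = a\<^sub>0 / s * w - a\<^sub>0 / s ^ 3 * (w * w)"
      by (simp only: sum_subtractf sum_distrib_left[symmetric] sum_distrib_right[symmetric] w sum.delta' finite if_True UNIV_I)
    finally show ?thesis by (simp add: algebra_simps power2_eq_square)
  qed
  have 3: "(\<Sum>i\<in>UNIV. x $ i *\<^sub>R partial_deriv i (ambient_linear \<kappa> a a\<^sub>0) x) = a \<bullet> x + a\<^sub>0 * (w / s)"
    unfolding partial_deriv_ambient_linear[OF \<kappa>] s_def[symmetric] w[symmetric] inner_vec_def
    by (simp add: algebra_simps sum.distrib sum_distrib_left sum_divide_distrib divide_inverse)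
  have "?n / s - w / s ^ 3 + \<kappa>\<^sup>2 * (w / s - w\<^sup>2 / s ^ 3) + \<kappa>\<^sup>2 * ?n * (w / s) =
    ?n / s * (1 + \<kappa>\<^sup>2 * w) - w / s ^ 3 * (1 + \<kappa>\<^sup>2 * w) + \<kappa>\<^sup>2 * w / s"
    by (simp add: algebra_simps power2_eq_square add_divide_distrib)
  also have "\<dots> = ?n / s * (\<kappa>\<^sup>2 * s\<^sup>2) - w / s ^ 3 * (\<kappa>\<^sup>2 * s\<^sup>2) + \<kappa>\<^sup>2 * w / s"
    using s(2) by simp
  also have "\<dots> = \<kappa>\<^sup>2 * ?n * s"
    using s(1) by (simp add: field_simps power2_eq_square power3_eq_cube)
  finally have e: "?n / s - w / s ^ 3 + \<kappa>\<^sup>2 * (w / s - w\<^sup>2 / s ^ 3) + \<kappa>\<^sup>2 * ?n * (w / s) = \<kappa>\<^sup>2 * ?n * s" .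
  have "hyp_laplacian \<kappa> (ambient_linear \<kappa> a a\<^sub>0) x =
    a\<^sub>0 * (?n / s - w / s ^ 3 + \<kappa>\<^sup>2 * (w / s - w\<^sup>2 / s ^ 3) + \<kappa>\<^sup>2 * ?n * (w / s)) + \<kappa>\<^sup>2 * ?n * (a \<bullet> x)"
    unfolding hyp_laplacian_def 1 2 3 by (simp add: algebra_simps)
  then show ?thesis
    unfolding e by (simp add: ambient_linear_def s_def algebra_simps)
qed

text \<open>The tangential part of the Minkowski product of the coefficient vectors. The position
  vector is normal with square \<open>- 1 / \<kappa>^2\<close>, so removing the normal components
  adds \<open>\<kappa>^2\<close> times the product of the two functions.\<close>

lemma hyp_gradient_product_ambient_linear:
  fixes x :: "real ^ 'n::finite"
  assumes \<kappa>: "\<kappa> > 0"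
  shows "hyp_gradient_product \<kappa> (ambient_linear \<kappa> a a\<^sub>0) (ambient_linear \<kappa> b b\<^sub>0) x =
    a \<bullet> b - a\<^sub>0 * b\<^sub>0 + \<kappa>\<^sup>2 * ambient_linear \<kappa> a a\<^sub>0 x * ambient_linear \<kappa> b b\<^sub>0 x"
proof -
  define s where "s = hyp_height \<kappa> x"
  define w where "w = x \<bullet> x"
  have s: "s > 0" "\<kappa>\<^sup>2 * w = \<kappa>\<^sup>2 * s\<^sup>2 - 1"
    using hyp_height_props[OF \<kappa>] by (simp_all add: s_def w_def)
  have sums: "(\<Sum>i\<in>UNIV. x $ i * x $ i) = w" "(\<Sum>i\<in>UNIV. a $ i * x $ i) = a \<bullet> x" "(\<Sum>i\<in>UNIV. b $ i * x $ i) = b \<bullet> x"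
     "(\<Sum>i\<in>UNIV. a $ i * b $ i) = a \<bullet> b" for a b
    by (simp_all add: w_def inner_vec_def)
  have 1: "(\<Sum>i\<in>UNIV. partial_deriv i (ambient_linear \<kappa> a a\<^sub>0) x *\<^sub>R partial_deriv i (ambient_linear \<kappa> b b\<^sub>0) x)
    = a \<bullet> b + b\<^sub>0 / s * (a \<bullet> x) + a\<^sub>0 / s * (b \<bullet> x) + a\<^sub>0 / s * (b\<^sub>0 / s) * w"
  proof -
    have "(\<Sum>i\<in>UNIV. partial_deriv i (ambient_linear \<kappa> a a\<^sub>0) x *\<^sub>R partial_deriv i (ambient_linear \<kappa> b b\<^sub>0) x)
      = (\<Sum>i\<in>UNIV. a $ i * b $ i + b\<^sub>0 / s * (a $ i * x $ i) + a\<^sub>0 / s * (b $ i * x $ i) + a\<^sub>0 / s * (b\<^sub>0 / s) * (x $ i * x $ i))"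
      unfolding partial_deriv_ambient_linear[OF \<kappa>] s_def[symmetric]
      by (intro sum.cong refl) (simp add: algebra_simps divide_inverse)
    then show ?thesis
      by (simp only: sum.distrib sum_distrib_left[symmetric] sums)
  qed
  have 2: "(\<Sum>i\<in>UNIV. x $ i * partial_deriv i (ambient_linear \<kappa> a a\<^sub>0) x) = a \<bullet> x + a\<^sub>0 / s * w" for a a\<^sub>0
  proof -
    have "(\<Sum>i\<in>UNIV. x $ i * partial_deriv i (ambient_linear \<kappa> a a\<^sub>0) x) = (\<Sum>i\<in>UNIV. a $ i * x $ i + a\<^sub>0 / s * (x $ i * x $ i))"
      unfolding partial_deriv_ambient_linear[OF \<kappa>] s_def[symmetric]
      by (intro sum.cong refl) (simp add: algebra_simps divide_inverse)
    then show ?thesis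
      by (simp only: sum.distrib sum_distrib_left[symmetric] sums)
  qed
  define A where "A = a \<bullet> x"
  define B where "B = b \<bullet> x"
  have "b\<^sub>0 / s * A + a\<^sub>0 / s * B + a\<^sub>0 / s * (b\<^sub>0 / s) * w + \<kappa>\<^sup>2 * ((A + a\<^sub>0 / s * w) * (B + b\<^sub>0 / s * w))
    = \<kappa>\<^sup>2 * (A * B) + (1 + \<kappa>\<^sup>2 * w) * (b\<^sub>0 / s * A + a\<^sub>0 / s * B) + a\<^sub>0 / s * (b\<^sub>0 / s) * w * (1 + \<kappa>\<^sup>2 * w)"
    by (simp add: algebra_simps add_divide_distrib)
  also have "\<dots> = \<kappa>\<^sup>2 * (A * B) + \<kappa>\<^sup>2 * s\<^sup>2 * (b\<^sub>0 / s * A + a\<^sub>0 / s * B) + a\<^sub>0 / s * (b\<^sub>0 / s) * w * (\<kappa>\<^sup>2 * s\<^sup>2)"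
    using s(2) by simp
  also have "\<dots> = \<kappa>\<^sup>2 * (A * B) + \<kappa>\<^sup>2 * s * (b\<^sub>0 * A + a\<^sub>0 * B) + a\<^sub>0 * b\<^sub>0 * (\<kappa>\<^sup>2 * w)"
    using s(1) by (simp add: field_simps power2_eq_square)
  also have "\<dots> = - a\<^sub>0 * b\<^sub>0 + \<kappa>\<^sup>2 * (A + a\<^sub>0 * s) * (B + b\<^sub>0 * s)"
    unfolding s(2) by (simp add: algebra_simps power2_eq_square)
  finally show ?thesis
    unfolding hyp_gradient_product_def 1
    unfolding real_scaleR_def 2
    unfolding ambient_linear_def s_def[symmetric] A_def[symmetric] B_def[symmetric]
    by simp
qed

lemma partial_deriv_inverse_power:
  fixes f :: "real ^ 'n::finite \<Rightarrow> real"
  assumes "f differentiable (at x)" "f x > 0"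
  shows "partial_deriv i (\<lambda>x. inverse (f x) ^ m) x = - (real m * inverse (f x) ^ Suc m) * partial_deriv i f x"
proof -
  have "((\<lambda>x. inverse (f x)) has_derivative (\<lambda>h. - (inverse (f x) * (\<Sum>i\<in>UNIV. h $ i *\<^sub>R partial_deriv i f x) * inverse (f x)))) (at x)"
    using assms by (intro Deriv.has_derivative_inverse has_derivative_partial_derivs) auto
  from partial_deriv_eq[OF has_derivative_power[OF this, of m], of i]
  show ?thesis
    by (cases m) (simp_all only: sum_axis_scaleR, simp_all)
qed

lemma hyp_laplacian_inverse_power:
  fixes f :: "real ^ 'n::finite \<Rightarrow> real"
  assumes f: "Ck 2 f" and pos: "\<And>x. f x > 0"
  shows "hyp_laplacian \<kappa> (\<lambda>x. inverse (f x) ^ m) x =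
    real m * real (Suc m) * inverse (f x) ^ (m + 2) * hyp_gradient_product \<kappa> f f x
    - real m * inverse (f x) ^ Suc m * hyp_laplacian \<kappa> f x"
proof -
  note df = Ck_2_partials(6,7)[OF f]
  have p1: "partial_deriv i (\<lambda>x. inverse (f x) ^ m) = (\<lambda>x. (- real m * inverse (f x) ^ Suc m) *\<^sub>R partial_deriv i f x)" for i m
    by (rule ext, subst partial_deriv_inverse_power[OF df(1) pos]) simp
  have "Ck 2 (\<lambda>x. - real m * inverse (f x) ^ Suc m)"
    by (intro Ck_converges_mult Ck_const Ck_converges_power Ck_converges_inverse pos f)
  then have d: "(\<lambda>x. - real m * inverse (f x) ^ Suc m) differentiable (at x)"
    by (rule Ck_2_partials(6))
  have p0: "partial_deriv i (\<lambda>x. - real m * inverse (f x) ^ Suc m) x = real m * real (Suc m) * inverse (f x) ^ (m + 2) * partial_deriv i f x" for i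
  proof -
    have d': "(\<lambda>x. inverse (f x) ^ Suc m) differentiable (at x)"
      by (rule Ck_2_partials(6), intro Ck_converges_power Ck_converges_inverse pos f)
    have "partial_deriv i (\<lambda>x. - real m *\<^sub>R inverse (f x) ^ Suc m) x = - real m * partial_deriv i (\<lambda>x. inverse (f x) ^ Suc m) x"
      by (subst partial_deriv_scaleR_fun[OF _ d']) (simp_all add: partial_deriv_const)
    also have "\<dots> = real m * real (Suc m) * inverse (f x) ^ (m + 2) * partial_deriv i f x"
      by (subst partial_deriv_inverse_power[OF df(1) pos]) (simp add: mult_ac)
    finally show ?thesis by simp
  qed
  have p2: "partial_deriv i (partial_deriv j (\<lambda>x. inverse (f x) ^ m)) x =
    real m * real (Suc m) * inverse (f x) ^ (m + 2) * (partial_deriv i f x * partial_deriv j f x)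
    - real m * inverse (f x) ^ Suc m * partial_deriv i (partial_deriv j f) x" for i j
    unfolding p1 by (subst partial_deriv_scaleR_fun[OF d df(2)], subst p0) (simp add: mult_ac)
  define a where "a i = partial_deriv i f x" for i
  define A where "A i j = partial_deriv i (partial_deriv j f) x" for i j
  define M where "M = real m * real (Suc m) * inverse (f x) ^ (m + 2)"
  define K where "K = real m * inverse (f x) ^ Suc m"
  have 1: "laplacian (\<lambda>x. inverse (f x) ^ m) x = M * (\<Sum>i\<in>UNIV. a i * a i) - K * (\<Sum>i\<in>UNIV. A i i)"
    unfolding laplacian_def p2 a_def[symmetric] A_def[symmetric] M_def[symmetric] K_def[symmetric]
    by (simp add: sum_subtractf sum_distrib_left)
  have 2: "(\<Sum>i\<in>UNIV. \<Sum>j\<in>UNIV. (x $ i * x $ j) *\<^sub>R partial_deriv i (partial_deriv j (\<lambda>x. inverse (f x) ^ m)) x)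
    = M * ((\<Sum>i\<in>UNIV. x $ i * a i) * (\<Sum>j\<in>UNIV. x $ j * a j)) - K * (\<Sum>i\<in>UNIV. \<Sum>j\<in>UNIV. x $ i * x $ j * A i j)"
  proof -
    have "(\<Sum>i\<in>UNIV. \<Sum>j\<in>UNIV. (x $ i * x $ j) *\<^sub>R partial_deriv i (partial_deriv j (\<lambda>x. inverse (f x) ^ m)) x)
      = (\<Sum>i\<in>UNIV. \<Sum>j\<in>UNIV. M * ((x $ i * a i) * (x $ j * a j)) - K * (x $ i * x $ j * A i j))"
      unfolding p2 a_def[symmetric] A_def[symmetric] M_def[symmetric] K_def[symmetric]
      by (intro sum.cong refl) (simp add: algebra_simps)
    then show ?thesis
      by (simp only: sum_subtractf sum_distrib_left[symmetric] sum_product)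
  qed
  have 3: "(\<Sum>i\<in>UNIV. x $ i *\<^sub>R partial_deriv i (\<lambda>x. inverse (f x) ^ m) x) = - K * (\<Sum>i\<in>UNIV. x $ i * a i)"
    unfolding p1 a_def[symmetric] K_def sum_distrib_left by (intro sum.cong refl) simp
  show ?thesis
    unfolding hyp_laplacian_def hyp_gradient_product_def 1 2 3
    unfolding laplacian_def a_def[symmetric] A_def[symmetric] M_def[symmetric] K_def[symmetric] real_scaleR_def
    by (simp add: algebra_simps)
qed

lemma hyp_gradient_product_inverse_power:
  fixes f :: "real ^ 'n::finite \<Rightarrow> real" and g :: "real ^ 'n \<Rightarrow> 'b::real_normed_vector"
  assumes "f differentiable (at x)" "f x > 0"
  shows "hyp_gradient_product \<kappa> (\<lambda>x. inverse (f x) ^ m) g x =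
    - (real m * inverse (f x) ^ Suc m) *\<^sub>R hyp_gradient_product \<kappa> f g x"
proof -
  have "(\<Sum>i\<in>UNIV. x $ i * partial_deriv i (\<lambda>x. inverse (f x) ^ m) x) = - (real m * inverse (f x) ^ Suc m) * (\<Sum>i\<in>UNIV. x $ i * partial_deriv i f x)"
    unfolding partial_deriv_inverse_power[OF assms] sum_distrib_left by (intro sum.cong refl) simp
  moreover have "(\<Sum>i\<in>UNIV. partial_deriv i (\<lambda>x. inverse (f x) ^ m) x *\<^sub>R partial_deriv i g x)
    = - (real m * inverse (f x) ^ Suc m) *\<^sub>R (\<Sum>i\<in>UNIV. partial_deriv i f x *\<^sub>R partial_deriv i g x)"
    unfolding partial_deriv_inverse_power[OF assms] scaleR_sum_right by (intro sum.cong refl) simp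
  ultimately show ?thesis
    unfolding hyp_gradient_product_def by (simp only: scaleR_add_right scaleR_scaleR mult_ac)
qed

lemma hyp_gradient_product_compose:
  fixes q :: "real ^ 'm::finite \<Rightarrow> 'b::real_normed_vector" and Y :: "real^'n::finite \<Rightarrow> real^'m"
  assumes "q differentiable (at (Y x))" "\<And>l. (\<lambda>x. Y x $ l) differentiable (at x)"
  shows "hyp_gradient_product \<kappa> f (\<lambda>x. q (Y x)) x =
    (\<Sum>l\<in>UNIV. hyp_gradient_product \<kappa> f (\<lambda>x. Y x $ l) x *\<^sub>R partial_deriv l q (Y x))"
proof -
  define b where "b l = partial_deriv l q (Y x)" for l
  define a where "a i l = partial_deriv i (\<lambda>x. Y x $ l) x" for i l
  define E where "E = (\<Sum>i\<in>UNIV. x $ i * partial_deriv i f x)"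
  have 1: "(\<Sum>i\<in>UNIV. partial_deriv i f x *\<^sub>R (\<Sum>l\<in>UNIV. a i l *\<^sub>R b l)) = (\<Sum>l\<in>UNIV. (\<Sum>i\<in>UNIV. partial_deriv i f x * a i l) *\<^sub>R b l)"
    unfolding scaleR_sum_right scaleR_sum_left by (subst sum.swap) simp
  have 2: "(\<Sum>i\<in>UNIV. x $ i *\<^sub>R (\<Sum>l\<in>UNIV. a i l *\<^sub>R b l)) = (\<Sum>l\<in>UNIV. (\<Sum>i\<in>UNIV. x $ i * a i l) *\<^sub>R b l)"
    unfolding scaleR_sum_right scaleR_sum_left by (subst sum.swap) simp
  show ?thesis
    unfolding hyp_gradient_product_def partial_deriv_compose_vec[where q = q and Y = Y, OF assms] a_def[symmetric] b_def[symmetric]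
      E_def[symmetric] 1 2 real_scaleR_def
    by (simp add: scaleR_add_left sum.distrib scaleR_sum_right mult.assoc)
qed

text \<open>Euler's identity for a homogeneous polynomial of degree j.\<close>

lemma sum_component_partial_deriv_taylor_term:
  fixes u :: "real ^ 'n::finite \<Rightarrow> 'b::banach"
  assumes u: "helmholtz u"
  shows "(\<Sum>l\<in>UNIV. y $ l *\<^sub>R partial_deriv l (taylor_term j u) y) = real j *\<^sub>R taylor_term j u y"
proof (cases j)
  case 0
  then show ?thesis by (simp only: partial_deriv_taylor_term(2)) simp
next
  case (Suc i)
  then show ?thesis
    by (simp only: partial_deriv_taylor_term(1)[OF u] sum_component_taylor_term)
qed

text \<open>Euler's identity applied twice, first to the derivatives, which have degree
  \<open>j - 1\<close>.\<close>

lemma sum_component_second_partial_deriv_taylor_term: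
  fixes u :: "real ^ 'n::finite \<Rightarrow> 'b::banach"
  assumes u: "helmholtz u"
  shows "(\<Sum>l\<in>UNIV. \<Sum>m\<in>UNIV. (y $ m * y $ l) *\<^sub>R partial_deriv m (partial_deriv l (taylor_term j u)) y)
    = (real j * (real j - 1)) *\<^sub>R taylor_term j u y"
proof (cases j)
  case 0
  then show ?thesis by (simp only: partial_deriv_taylor_term(2) partial_deriv_const) simp
next
  case (Suc i)
  have "(\<Sum>l\<in>UNIV. \<Sum>m\<in>UNIV. (y $ m * y $ l) *\<^sub>R partial_deriv m (partial_deriv l (taylor_term j u)) y)
    = (\<Sum>l\<in>UNIV. y $ l *\<^sub>R (\<Sum>m\<in>UNIV. y $ m *\<^sub>R partial_deriv m (taylor_term i (partial_deriv l u)) y))"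
    unfolding Suc partial_deriv_taylor_term(1)[OF u] by (simp add: scaleR_sum_right mult.commute)
  also have "\<dots> = real i *\<^sub>R (\<Sum>l\<in>UNIV. y $ l *\<^sub>R taylor_term i (partial_deriv l u) y)"
    unfolding sum_component_partial_deriv_taylor_term[OF helmholtz_partial_deriv[OF u]]
    by (simp add: scaleR_sum_right mult.commute)
  also have "\<dots> = (real j * (real j - 1)) *\<^sub>R taylor_term j u y"
    unfolding sum_component_taylor_term Suc by (simp add: mult.commute del: taylor_term.simps)
  finally show ?thesis .
qed

section \<open>Coordinates adapted to a base point\<close>

text \<open>The theorem allows an arbitrary base point and an arbitrary frame there for every
  \<open>\<kappa>\<close>; Minkowski coordinates relative to the frame treat all of them
  alike.\<close>

locale hyp_frame =
  fixes \<kappa> :: real and p :: "real ^ 'n::finite" and J :: "real ^ 'n \<Rightarrow> real ^ 'n"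
  assumes \<kappa>: "\<kappa> > 0" and J: "tangent_isometry (hyp_metric \<kappa>) p J"
begin

text \<open>In Minkowski space, \<open>\<tau>\<close> is \<open>cosh (\<kappa> \<rho>)\<close> and \<open>Y\<close> are the coordinates with respect to the
  orthonormal frame that \<open>J\<close> defines in the tangent space of the hyperboloid at \<open>p\<close>.\<close>

definition \<tau> :: "real ^ 'n \<Rightarrow> real" where
  "\<tau> = ambient_linear \<kappa> (- (\<kappa>\<^sup>2 *\<^sub>R p)) (\<kappa>\<^sup>2 * hyp_height \<kappa> p)"

definition Y_coord :: "'n \<Rightarrow> real ^ 'n \<Rightarrow> real" where
  "Y_coord l = ambient_linear \<kappa> (J (axis l 1)) (- ((p \<bullet> J (axis l 1)) / hyp_height \<kappa> p))"

definition Y :: "real ^ 'n \<Rightarrow> real ^ 'n" where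
  "Y x = (\<chi> l. Y_coord l x)"

lemma Y_component: "(\<lambda>x. Y x $ l) = Y_coord l"
  by (simp add: Y_def)

text \<open>The lift of \<open>J u\<close> to the tangent space of the hyperboloid has time
  component \<open>(p \<bullet> J u) / hyp_height \<kappa> p\<close>, so this is orthonormality of
  the lifted frame in the Minkowski form.\<close>

lemma metric_J: "J u \<bullet> J w - (p \<bullet> J u) * (p \<bullet> J w) / (hyp_height \<kappa> p)\<^sup>2 = u \<bullet> w"
proof -
  have "J u \<bullet> J w - \<kappa>\<^sup>2 * (p \<bullet> J u) * (p \<bullet> J w) / (1 + \<kappa>\<^sup>2 * (p \<bullet> p)) = u \<bullet> w"
    using J unfolding tangent_isometry_def metric_inner_hyp_metric[OF \<kappa>] by blast
  moreover have "1 + \<kappa>\<^sup>2 * (p \<bullet> p) = \<kappa>\<^sup>2 * (hyp_height \<kappa> p)\<^sup>2"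
    using hyp_height_props(3)[OF \<kappa>, of p] by simp
  ultimately show ?thesis using \<kappa> by simp
qed

lemma Ck_\<tau>: "Ck k \<tau>" and Ck_Y_coord: "Ck k (Y_coord l)"
  unfolding \<tau>_def Y_coord_def by (rule Ck_ambient_linear[OF \<kappa>])+

lemma \<tau>_eq: "\<tau> x = \<kappa>\<^sup>2 * (hyp_height \<kappa> x * hyp_height \<kappa> p - x \<bullet> p)"
  by (simp add: \<tau>_def ambient_linear_def algebra_simps inner_commute)

text \<open>A quadratic relation obtained by eliminating the product of the two heights. It is
  arranged so that a factor \<open>\<tau> x - 1\<close> can be split off later.\<close>

lemma \<tau>_square:
  "(\<tau> x)\<^sup>2 - 1 = \<kappa>\<^sup>2 * (x \<bullet> x + p \<bullet> p - 2 * (x \<bullet> p)) + \<kappa> ^ 4 * ((x \<bullet> x) * (p \<bullet> p) - (x \<bullet> p)\<^sup>2)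
     - 2 * \<kappa>\<^sup>2 * (x \<bullet> p) * (\<tau> x - 1)"
proof -
  let ?S = "hyp_height \<kappa> x" and ?P = "hyp_height \<kappa> p"
  have "(\<tau> x)\<^sup>2 = \<kappa> ^ 4 * (?S\<^sup>2 * ?P\<^sup>2 - 2 * (x \<bullet> p) * (?S * ?P) + (x \<bullet> p)\<^sup>2)"
    unfolding \<tau>_eq by (simp add: power2_eq_square algebra_simps power4_eq_xxxx)
  also have "\<dots> = (\<kappa>\<^sup>2 * ?S\<^sup>2) * (\<kappa>\<^sup>2 * ?P\<^sup>2) - 2 * \<kappa>\<^sup>2 * (x \<bullet> p) * (\<kappa>\<^sup>2 * (?S * ?P)) + \<kappa> ^ 4 * (x \<bullet> p)\<^sup>2"
    by (simp add: algebra_simps power2_eq_square power4_eq_xxxx)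
  also have "\<kappa>\<^sup>2 * ?S\<^sup>2 = 1 + \<kappa>\<^sup>2 * (x \<bullet> x)"
    using hyp_height_props(3)[OF \<kappa>, of x] by simp
  also have "\<kappa>\<^sup>2 * ?P\<^sup>2 = 1 + \<kappa>\<^sup>2 * (p \<bullet> p)"
    using hyp_height_props(3)[OF \<kappa>, of p] by simp
  also have "\<kappa>\<^sup>2 * (?S * ?P) = \<tau> x + \<kappa>\<^sup>2 * (x \<bullet> p)"
    unfolding \<tau>_eq by (simp add: algebra_simps)
  finally show ?thesis
    by (simp add: algebra_simps power2_eq_square power4_eq_xxxx)
qed

lemma \<tau>_pos: "\<tau> x > 0"
proof -
  let ?S = "hyp_height \<kappa> x" and ?P = "hyp_height \<kappa> p"
  have "norm x < ?S" "norm p < ?P"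
    unfolding hyp_height_def norm_eq_sqrt_inner using \<kappa> by simp_all
  then have "norm x * norm p < ?S * ?P"
    by (intro mult_strict_mono') auto
  then have "x \<bullet> p < ?S * ?P"
    using norm_cauchy_schwarz[of x p] by linarith
  then show ?thesis unfolding \<tau>_eq using \<kappa> by simp
qed

text \<open>The coefficient vector of \<open>\<tau>\<close> has Minkowski square
  \<open>- \<kappa>^2\<close>; those of the \<open>Y_coord\<close> are orthonormal and orthogonal to
  it.\<close>

lemma gradient_products:
  "hyp_gradient_product \<kappa> \<tau> \<tau> x = \<kappa>\<^sup>2 * ((\<tau> x)\<^sup>2 - 1)"
  "hyp_gradient_product \<kappa> \<tau> (Y_coord l) x = \<kappa>\<^sup>2 * \<tau> x * Y_coord l x"
  "hyp_gradient_product \<kappa> (Y_coord m) (Y_coord l) x = (if m = l then 1 else 0) + \<kappa>\<^sup>2 * Y_coord m x * Y_coord l x"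
proof -
  let ?P = "hyp_height \<kappa> p"
  have P: "?P > 0" using hyp_height_props(1)[OF \<kappa>] .
  have "\<kappa>\<^sup>2 * (p \<bullet> p) - \<kappa>\<^sup>2 * ?P\<^sup>2 = - 1"
    using hyp_height_props(3)[OF \<kappa>, of p] by simp
  then have "\<kappa>\<^sup>2 * (\<kappa>\<^sup>2 * (p \<bullet> p) - \<kappa>\<^sup>2 * ?P\<^sup>2) = - \<kappa>\<^sup>2" by simp
  then have 1: "\<kappa>\<^sup>2 *\<^sub>R p \<bullet> \<kappa>\<^sup>2 *\<^sub>R p - \<kappa>\<^sup>2 * ?P * (\<kappa>\<^sup>2 * ?P) = - \<kappa>\<^sup>2"
    by (simp add: algebra_simps power2_eq_square)
  show "hyp_gradient_product \<kappa> \<tau> \<tau> x = \<kappa>\<^sup>2 * ((\<tau> x)\<^sup>2 - 1)"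
    unfolding \<tau>_def hyp_gradient_product_ambient_linear[OF \<kappa>] using 1
    by (simp add: power2_eq_square algebra_simps)
  show "hyp_gradient_product \<kappa> \<tau> (Y_coord l) x = \<kappa>\<^sup>2 * \<tau> x * Y_coord l x"
    unfolding \<tau>_def Y_coord_def hyp_gradient_product_ambient_linear[OF \<kappa>] using P by simp
  have "J (axis m 1) \<bullet> J (axis l 1) - p \<bullet> J (axis m 1) * (p \<bullet> J (axis l 1)) / ?P\<^sup>2 = (if m = l then 1 else 0)"
    unfolding metric_J by (simp add: inner_axis_axis)
  then show "hyp_gradient_product \<kappa> (Y_coord m) (Y_coord l) x = (if m = l then 1 else 0) + \<kappa>\<^sup>2 * Y_coord m x * Y_coord l x"
    unfolding Y_coord_def hyp_gradient_product_ambient_linear[OF \<kappa>] by (simp add: power2_eq_square)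
qed

text \<open>For \<open>m = a + j\<close> the coefficient of \<open>inverse (\<tau> x) ^ m\<close> is
  \<open>\<kappa>^2 * a * (a + 1 - d)\<close> whatever \<open>j\<close> is. This is the reason for
  raising the power of \<open>\<tau>\<close> with the degree: all degrees share one eigenvalue, and
  \<open>j\<close> survives only in the term with two more powers.\<close>

lemma hyp_laplacian_taylor_term:
  fixes u :: "real ^ 'n \<Rightarrow> 'b::banach"
  assumes u: "helmholtz u"
  shows "hyp_laplacian \<kappa> (\<lambda>x. inverse (\<tau> x) ^ m *\<^sub>R taylor_term j u (Y x)) x =
    inverse (\<tau> x) ^ m *\<^sub>R laplacian (taylor_term j u) (Y x)
    + (\<kappa>\<^sup>2 * ((real m - real j) * (real m - real j + 1 - real CARD('n)) * inverse (\<tau> x) ^ m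
       - real m * real (Suc m) * inverse (\<tau> x) ^ (m + 2))) *\<^sub>R taylor_term j u (Y x)"
proof -
  let ?n = "real CARD('n)" and ?t = "\<tau> x" and ?q = "taylor_term j u" and ?y = "Y x"
  let ?L = "laplacian ?q ?y" and ?Q = "?q ?y"
  have t: "?t > 0" by (rule \<tau>_pos)
  have yc: "Y_coord l x = ?y $ l" for l by (simp add: Y_def)
  have q2: "Ck 2 ?q" by (rule Ck_taylor_term)
  have qd: "?q differentiable (at z)" for z using Ck_2_partials(6)[OF q2] .
  have Y2: "Ck 2 (\<lambda>x. Y x $ l)" for l unfolding Y_component by (rule Ck_Y_coord)
  have Yd: "(\<lambda>x. Y x $ l) differentiable (at x)" for l using Ck_2_partials(6)[OF Y2] .
  have hl: "hyp_laplacian \<kappa> (Y_coord l) x = \<kappa>\<^sup>2 * ?n * ?y $ l" for l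
    unfolding yc[symmetric] Y_coord_def by (rule hyp_laplacian_ambient_linear[OF \<kappa>])
  \<comment> \<open>In the chain rule the identity part of the gradient products of
    \<open>Y_coord\<close> gives the flat Laplacian; the rest is evaluated by Euler's
    identities.\<close>
  have A: "hyp_laplacian \<kappa> (\<lambda>x. ?q (Y x)) x = ?L + (\<kappa>\<^sup>2 * (real j * (real j - 1 + ?n))) *\<^sub>R ?Q"
  proof -
    have "(\<Sum>l\<in>UNIV. hyp_laplacian \<kappa> (\<lambda>x. Y x $ l) x *\<^sub>R partial_deriv l ?q ?y)
      = (\<kappa>\<^sup>2 * ?n) *\<^sub>R (\<Sum>l\<in>UNIV. ?y $ l *\<^sub>R partial_deriv l ?q ?y)"
      unfolding Y_component scaleR_sum_right
      by (intro sum.cong refl) (simp only: hl scaleR_scaleR)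
    moreover have "(\<Sum>l\<in>UNIV. \<Sum>m\<in>UNIV. hyp_gradient_product \<kappa> (\<lambda>x. Y x $ m) (\<lambda>x. Y x $ l) x *\<^sub>R partial_deriv m (partial_deriv l ?q) ?y)
      = ?L + \<kappa>\<^sup>2 *\<^sub>R (\<Sum>l\<in>UNIV. \<Sum>m\<in>UNIV. (?y $ m * ?y $ l) *\<^sub>R partial_deriv m (partial_deriv l ?q) ?y)"
      unfolding Y_component gradient_products laplacian_def yc
      by (simp add: scaleR_add_left sum.distrib scaleR_sum_right mult.assoc if_distrib[of "\<lambda>r. r *\<^sub>R _"] cong: if_cong)
    ultimately have "hyp_laplacian \<kappa> (\<lambda>x. ?q (Y x)) x =
        (\<kappa>\<^sup>2 * ?n) *\<^sub>R real j *\<^sub>R ?Q + (?L + \<kappa>\<^sup>2 *\<^sub>R (real j * (real j - 1)) *\<^sub>R ?Q)"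
      unfolding hyp_laplacian_compose[where q = ?q and Y = Y, OF q2 Y2]
        sum_component_partial_deriv_taylor_term[OF u] sum_component_second_partial_deriv_taylor_term[OF u]
      by (simp only:)
    also have "\<dots> = ?L + (\<kappa>\<^sup>2 * ?n * real j + \<kappa>\<^sup>2 * (real j * (real j - 1))) *\<^sub>R ?Q"
      by (simp only: scaleR_add_left scaleR_scaleR add_ac)
    also have "\<kappa>\<^sup>2 * ?n * real j + \<kappa>\<^sup>2 * (real j * (real j - 1)) = \<kappa>\<^sup>2 * (real j * (real j - 1 + ?n))"
      by (simp add: algebra_simps)
    finally show ?thesis .
  qed
  have B: "hyp_laplacian \<kappa> (\<lambda>x. inverse (\<tau> x) ^ m) x =
      \<kappa>\<^sup>2 * (real m * (real (Suc m) - ?n) * inverse ?t ^ m - real m * real (Suc m) * inverse ?t ^ (m + 2))"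
  proof -
    have "hyp_laplacian \<kappa> \<tau> x = \<kappa>\<^sup>2 * ?n * ?t"
      unfolding \<tau>_def by (rule hyp_laplacian_ambient_linear[OF \<kappa>])
    moreover have "inverse ?t ^ (m + 2) * ?t\<^sup>2 = inverse ?t ^ m * (inverse ?t * ?t)\<^sup>2"
      by (simp only: power_add power_mult_distrib mult.assoc)
    then have "inverse ?t ^ (m + 2) * ?t\<^sup>2 = inverse ?t ^ m"
      using t by simp
    moreover have "inverse ?t ^ Suc m * ?t = inverse ?t ^ m"
      using t by simp
    moreover have "real m * real (Suc m) * a * (\<kappa>\<^sup>2 * (?t\<^sup>2 - 1)) - real m * b * (\<kappa>\<^sup>2 * ?n * ?t) =
        \<kappa>\<^sup>2 * (real m * real (Suc m) * (a * ?t\<^sup>2) - real m * real (Suc m) * a - real m * ?n * (b * ?t))" for a b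
      by (simp add: algebra_simps)
    moreover have "real m * real (Suc m) * c - real m * real (Suc m) * a - real m * ?n * c =
        real m * (real (Suc m) - ?n) * c - real m * real (Suc m) * a" for a c :: real
      by (simp add: algebra_simps)
    ultimately show ?thesis
      unfolding hyp_laplacian_inverse_power[OF Ck_\<tau> \<tau>_pos] gradient_products by (simp only:)
  qed
  have C: "hyp_gradient_product \<kappa> (\<lambda>x. inverse (\<tau> x) ^ m) (\<lambda>x. ?q (Y x)) x =
      - (\<kappa>\<^sup>2 * (real m * real j * inverse ?t ^ m)) *\<^sub>R ?Q"
  proof -
    have "hyp_gradient_product \<kappa> \<tau> (\<lambda>x. ?q (Y x)) x = (\<kappa>\<^sup>2 * ?t) *\<^sub>R (\<Sum>l\<in>UNIV. ?y $ l *\<^sub>R partial_deriv l ?q ?y)"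
      unfolding hyp_gradient_product_compose[where q = ?q and Y = Y, OF qd Yd] Y_component gradient_products yc
      by (simp add: scaleR_sum_right)
    also have "\<dots> = (\<kappa>\<^sup>2 * ?t * real j) *\<^sub>R ?Q"
      unfolding sum_component_partial_deriv_taylor_term[OF u] by simp
    finally have g: "hyp_gradient_product \<kappa> \<tau> (\<lambda>x. ?q (Y x)) x = (\<kappa>\<^sup>2 * ?t * real j) *\<^sub>R ?Q" .
    have i: "inverse ?t ^ Suc m * ?t = inverse ?t ^ m" using t by simp
    have "- (real m * a) * (\<kappa>\<^sup>2 * ?t * real j) = - (\<kappa>\<^sup>2 * (real m * real j * (a * ?t)))" for a
      by (simp add: algebra_simps)
    from this[of "inverse ?t ^ Suc m"] have "- (real m * inverse ?t ^ Suc m) * (\<kappa>\<^sup>2 * ?t * real j) = - (\<kappa>\<^sup>2 * (real m * real j * inverse ?t ^ m))"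
      unfolding i .
    then show ?thesis
      unfolding hyp_gradient_product_inverse_power[OF Ck_2_partials(6)[OF Ck_\<tau>] \<tau>_pos] g
      by (simp only: scaleR_scaleR)
  qed
  have "hyp_laplacian \<kappa> (\<lambda>x. inverse (\<tau> x) ^ m *\<^sub>R ?q (Y x)) x =
    inverse ?t ^ m *\<^sub>R ?L + (inverse ?t ^ m * (\<kappa>\<^sup>2 * (real j * (real j - 1 + ?n)))
      + \<kappa>\<^sup>2 * (real m * (real (Suc m) - ?n) * inverse ?t ^ m - real m * real (Suc m) * inverse ?t ^ (m + 2))
      - 2 * (\<kappa>\<^sup>2 * (real m * real j * inverse ?t ^ m))) *\<^sub>R ?Q"
  proof -
    have "Ck 2 (\<lambda>x. inverse (\<tau> x) ^ m)" "Ck 2 (\<lambda>x. ?q (Y x))"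
      by (intro Ck_converges_power Ck_converges_inverse Ck_\<tau> \<tau>_pos, rule Ck_compose_vec[where Y = Y, OF q2 Y2])
    then show ?thesis
      unfolding hyp_laplacian_scaleR[OF \<open>Ck 2 (\<lambda>x. inverse (\<tau> x) ^ m)\<close> \<open>Ck 2 (\<lambda>x. ?q (Y x))\<close>] A B C
      by (simp only: scaleR_add_right scaleR_scaleR scaleR_add_left scaleR_minus_left scaleR_minus_right mult_minus_right
          add.assoc diff_conv_add_uminus)
  qed
  also have "inverse ?t ^ m * (\<kappa>\<^sup>2 * (real j * (real j - 1 + ?n)))
      + \<kappa>\<^sup>2 * (real m * (real (Suc m) - ?n) * inverse ?t ^ m - real m * real (Suc m) * inverse ?t ^ (m + 2))
      - 2 * (\<kappa>\<^sup>2 * (real m * real j * inverse ?t ^ m))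
    = \<kappa>\<^sup>2 * ((real m - real j) * (real m - real j + 1 - ?n) * inverse ?t ^ m
       - real m * real (Suc m) * inverse ?t ^ (m + 2))"
    by (simp add: algebra_simps)
  finally show ?thesis .
qed

end

section \<open>Geodesics and distance\<close>

lemma metric_inner_hyp_metric_height:
  assumes "\<kappa> > 0"
  shows "metric_inner (hyp_metric \<kappa>) x u w = u \<bullet> w - (x \<bullet> u) * (x \<bullet> w) / (hyp_height \<kappa> x)\<^sup>2"
proof -
  have "1 + \<kappa>\<^sup>2 * (x \<bullet> x) = \<kappa>\<^sup>2 * (hyp_height \<kappa> x)\<^sup>2"
    using hyp_height_props(3)[OF assms, of x] by simp
  then show ?thesis
    unfolding metric_inner_hyp_metric[OF assms] using assms by simp
qed

text \<open>The metric is the identity minus the square of the gradient \<open>b\<close> of the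
  height. Its derivatives are products of \<open>b\<close> with the Hessian \<open>H\<close> of the
  height, and all but \<open>H i j * b l\<close> cancel in the symbol; raising the index turns
  \<open>b\<close> into a multiple of \<open>x\<close>.\<close>

lemma christoffel_hyp_metric:
  fixes x :: "real ^ 'n::finite"
  assumes \<kappa>: "\<kappa> > 0"
  shows "christoffel (hyp_metric \<kappa>) k i j x =
    - (\<kappa>\<^sup>2 * hyp_height \<kappa> x * x $ k * ((if i = j then 1 else 0) / hyp_height \<kappa> x - x $ i * x $ j / hyp_height \<kappa> x ^ 3))"
proof -
  let ?S = "hyp_height \<kappa>"
  define b where "b l y = y $ l * inverse (?S y)" for l and y :: "real ^ 'n"
  define H where "H i j = (if i = j then 1 else 0) / ?S x - x $ i * x $ j / ?S x ^ 3" for i j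
  have S: "?S y > 0" for y :: "real ^ 'n" using hyp_height_props(1)[OF \<kappa>] .
  have b: "b l = partial_deriv l (ambient_linear \<kappa> 0 1)" for l
    unfolding partial_deriv_ambient_linear[OF \<kappa>] b_def[abs_def] by simp
  have Hb: "partial_deriv i (b l) x = H i l" for i l
    unfolding b second_partial_deriv_ambient_linear[OF \<kappa>] H_def by simp
  have bd: "b l differentiable (at x)" for l
    unfolding b by (rule Ck_2_partials(7)[OF Ck_ambient_linear[OF \<kappa>]])
  have Hsym: "H i j = H j i" for i j by (auto simp: H_def mult.commute)
  have G: "(\<lambda>y. hyp_metric \<kappa> y $ j $ l) = (\<lambda>y. (if j = l then 1 else 0) + (- b j y) *\<^sub>R b l y)" for j l
  proof
    fix y :: "real ^ 'n"
    have e: "1 + \<kappa>\<^sup>2 * (y \<bullet> y) = \<kappa>\<^sup>2 * (?S y)\<^sup>2"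
      using hyp_height_props(3)[OF \<kappa>, of y] by simp
    show "hyp_metric \<kappa> y $ j $ l = (if j = l then 1 else 0) + (- b j y) *\<^sub>R b l y"
      unfolding hyp_metric_component[OF \<kappa>] b_def e using \<kappa> S[of y]
      by (simp add: field_simps power2_eq_square)
  qed
  have mb: "(\<lambda>y. - b j y) differentiable (at x)" "partial_deriv i (\<lambda>y. - b j y) x = - H i j" for i j
    using differentiable_minus[OF bd] partial_deriv_eq[OF has_derivative_minus[OF has_derivative_partial_derivs[OF bd]]]
    by (simp_all only: sum_axis_scaleR Hb)
  have dG: "partial_deriv i (\<lambda>y. hyp_metric \<kappa> y $ j $ l) x = - (b j x * H i l + H i j * b l x)" for i j l
  proof -
    have "partial_deriv i (\<lambda>y. (if j = l then 1 else 0) + (- b j y) *\<^sub>R b l y) x =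
        partial_deriv i (\<lambda>y. if j = l then 1 else 0) x + partial_deriv i (\<lambda>y. (- b j y) *\<^sub>R b l y) x"
      by (rule partial_deriv_add[OF differentiable_const differentiable_scaleR[OF mb(1) bd]])
    then show ?thesis
      unfolding G partial_deriv_scaleR_fun[OF mb(1) bd] mb(2) Hb partial_deriv_const by simp
  qed
  have "(\<Sum>l\<in>UNIV. ((if k = l then 1 else 0) + \<kappa>\<^sup>2 * x $ k * x $ l) * (2 * (H i j * b l x)))
    = 2 * H i j * inverse (?S x) * (x $ k * (1 + \<kappa>\<^sup>2 * (x \<bullet> x)))"
  proof -
    have "(\<Sum>l\<in>UNIV. ((if k = l then 1 else 0) + \<kappa>\<^sup>2 * x $ k * x $ l) * (2 * (H i j * b l x)))
      = (\<Sum>l\<in>UNIV. 2 * H i j * inverse (?S x) * ((if k = l then x $ l else 0) + \<kappa>\<^sup>2 * x $ k * (x $ l * x $ l)))"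
      unfolding b_def by (intro sum.cong refl) (auto simp: algebra_simps)
    also have "\<dots> = 2 * H i j * inverse (?S x) * (x $ k + \<kappa>\<^sup>2 * x $ k * (x \<bullet> x))"
      by (simp add: sum.distrib inner_vec_def flip: sum_distrib_left)
    finally show ?thesis by (simp add: algebra_simps)
  qed
  also have "1 + \<kappa>\<^sup>2 * (x \<bullet> x) = \<kappa>\<^sup>2 * (?S x)\<^sup>2"
    using hyp_height_props(3)[OF \<kappa>, of x] by simp
  finally have *: "(\<Sum>l\<in>UNIV. ((if k = l then 1 else 0) + \<kappa>\<^sup>2 * x $ k * x $ l) * (2 * (H i j * b l x)))
    = 2 * (\<kappa>\<^sup>2 * ?S x * x $ k * H i j)"
    using S[of x] by (simp add: power2_eq_square)
  have "christoffel (hyp_metric \<kappa>) k i j x = (\<Sum>l\<in>UNIV. ((if k = l then 1 else 0) + \<kappa>\<^sup>2 * x $ k * x $ l) *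
      (- (b j x * H i l + H i j * b l x) - (b i x * H j l + H j i * b l x) + (b i x * H l j + H l i * b j x))) / 2"
    unfolding christoffel_def dG matrix_inv_hyp_metric[OF \<kappa>]
    by (intro arg_cong2[where f="(/)"] arg_cong2[where f="(*)"] sum.cong refl) (simp_all add: algebra_simps)
  also have "\<dots> = - (\<Sum>l\<in>UNIV. ((if k = l then 1 else 0) + \<kappa>\<^sup>2 * x $ k * x $ l) * (2 * (H i j * b l x))) / 2"
  proof -
    have "- (b j x * H i l + H i j * b l x) - (b i x * H j l + H j i * b l x) + (b i x * H l j + H l i * b j x)
        = - (2 * (H i j * b l x))" for l
      unfolding Hsym[of l i] Hsym[of l j] Hsym[of j i] by (simp add: algebra_simps)
    then show ?thesis by (simp only: mult_minus_right sum_negf)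
  qed
  finally show ?thesis unfolding * by (simp add: H_def)
qed

text \<open>The acceleration is a multiple of the position, as for the hyperboloid in Minkowski
  space. With constant speed the geodesic equation is in effect linear.\<close>

lemma geodesic_acceleration:
  fixes x u :: "real ^ 'n::finite"
  assumes \<kappa>: "\<kappa> > 0"
  shows "(\<chi> k. - (\<Sum>i\<in>UNIV. \<Sum>j\<in>UNIV. christoffel (hyp_metric \<kappa>) k i j x * u $ i * u $ j))
    = (\<kappa>\<^sup>2 * metric_inner (hyp_metric \<kappa>) x u u) *\<^sub>R x"
proof -
  define s where "s = hyp_height \<kappa> x"
  have s: "s > 0" using hyp_height_props(1)[OF \<kappa>] by (simp add: s_def)
  have "- (\<Sum>i\<in>UNIV. \<Sum>j\<in>UNIV. christoffel (hyp_metric \<kappa>) k i j x * u $ i * u $ j) = \<kappa>\<^sup>2 * metric_inner (hyp_metric \<kappa>) x u u * x $ k" for k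
  proof -
    have "- (\<Sum>i\<in>UNIV. \<Sum>j\<in>UNIV. christoffel (hyp_metric \<kappa>) k i j x * u $ i * u $ j)
      = (\<Sum>i\<in>UNIV. \<Sum>j\<in>UNIV. (if i = j then \<kappa>\<^sup>2 * x $ k * (u $ i * u $ i) else 0) - \<kappa>\<^sup>2 * x $ k / s\<^sup>2 * ((x $ i * u $ i) * (x $ j * u $ j)))"
      unfolding christoffel_hyp_metric[OF \<kappa>] s_def[symmetric] sum_negf[symmetric]
      using s by (intro sum.cong refl) (auto simp: algebra_simps power2_eq_square power3_eq_cube)
    also have "\<dots> = \<kappa>\<^sup>2 * x $ k * (u \<bullet> u) - \<kappa>\<^sup>2 * x $ k / s\<^sup>2 * ((x \<bullet> u) * (x \<bullet> u))"
      by (simp only: sum_subtractf sum_distrib_left[symmetric] sum_distrib_right[symmetric] sum.delta' finite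
          if_True UNIV_I inner_vec_def inner_real_def)
    finally show ?thesis
      unfolding metric_inner_hyp_metric_height[OF \<kappa>] s_def[symmetric] by (simp add: algebra_simps)
  qed
  then show ?thesis by (simp add: vec_eq_iff)
qed

text \<open>The value at \<open>\<omega> = 0\<close> is the limit, so that constant geodesics are
  covered by the same formula.\<close>

definition sinh_quotient :: "real \<Rightarrow> real \<Rightarrow> real" where
  "sinh_quotient \<omega> t = (if \<omega> = 0 then t else sinh (\<omega> * t) / \<omega>)"

lemma has_real_derivative_sinh_quotient:
  "(sinh_quotient \<omega> has_real_derivative cosh (\<omega> * t)) (at t within T)"
  unfolding sinh_quotient_def[abs_def]
  by (cases "\<omega> = 0") (auto intro!: derivative_eq_intros)

lemma has_real_derivative_cosh_scaled:
  "((\<lambda>t. cosh (\<omega> * t)) has_real_derivative \<omega>\<^sup>2 * sinh_quotient \<omega> t) (at t within T)"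
  unfolding sinh_quotient_def
  by (cases "\<omega> = 0") (auto intro!: derivative_eq_intros simp: power2_eq_square)

lemma cosh_square_sinh_quotient: "(cosh (\<omega> * t))\<^sup>2 - \<omega>\<^sup>2 * (sinh_quotient \<omega> t)\<^sup>2 = 1"
  using hyperbolic_pythagoras[of "\<omega> * t"] by (auto simp: sinh_quotient_def power_divide)

text \<open>The solution of the linear equation with coefficient \<open>\<omega>\<^sup>2\<close>,
  starting at \<open>p\<close> with velocity \<open>w\<close>. For a geodesic,
  \<open>\<omega>\<close> is \<open>\<kappa>\<close> times the speed up to sign.\<close>

definition hyp_geodesic :: "real \<Rightarrow> real ^ 'n::finite \<Rightarrow> real ^ 'n \<Rightarrow> real \<Rightarrow> real ^ 'n" where
  "hyp_geodesic \<omega> p w t = cosh (\<omega> * t) *\<^sub>R p + sinh_quotient \<omega> t *\<^sub>R w"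

definition hyp_geodesic_velocity :: "real \<Rightarrow> real ^ 'n::finite \<Rightarrow> real ^ 'n \<Rightarrow> real \<Rightarrow> real ^ 'n" where
  "hyp_geodesic_velocity \<omega> p w t = (\<omega>\<^sup>2 * sinh_quotient \<omega> t) *\<^sub>R p + cosh (\<omega> * t) *\<^sub>R w"

lemma has_vector_derivative_hyp_geodesic:
  "(hyp_geodesic \<omega> p w has_vector_derivative hyp_geodesic_velocity \<omega> p w t) (at t within T)"
  "(hyp_geodesic_velocity \<omega> p w has_vector_derivative \<omega>\<^sup>2 *\<^sub>R hyp_geodesic \<omega> p w t) (at t within T)"
proof -
  show "(hyp_geodesic \<omega> p w has_vector_derivative hyp_geodesic_velocity \<omega> p w t) (at t within T)"
    unfolding hyp_geodesic_def[abs_def] hyp_geodesic_velocity_def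
    using has_vector_derivative_add[OF has_vector_derivative_scaleR[OF has_real_derivative_cosh_scaled has_vector_derivative_const[of p]]
        has_vector_derivative_scaleR[OF has_real_derivative_sinh_quotient has_vector_derivative_const[of w]]]
    by simp
  show "(hyp_geodesic_velocity \<omega> p w has_vector_derivative \<omega>\<^sup>2 *\<^sub>R hyp_geodesic \<omega> p w t) (at t within T)"
    unfolding hyp_geodesic_def hyp_geodesic_velocity_def[abs_def]
    using has_vector_derivative_add[OF has_vector_derivative_scaleR[OF DERIV_cmult[OF has_real_derivative_sinh_quotient, of "\<omega>\<^sup>2"] has_vector_derivative_const[of p]]
        has_vector_derivative_scaleR[OF has_real_derivative_cosh_scaled has_vector_derivative_const[of w]]]
    by (simp add: scaleR_add_right)
qed

text \<open>The height should satisfy the same linear equation as the position, which suggests the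
  bracket in the first claim. The argument gives it up to sign, enough for the speed; the sign is
  settled in \<open>exp_map_coordinates\<close>.\<close>

lemma hyp_geodesic_speed:
  fixes p w :: "real ^ 'n::finite"
  assumes \<kappa>: "\<kappa> > 0" and \<omega>: "\<omega>\<^sup>2 = \<kappa>\<^sup>2 * metric_inner (hyp_metric \<kappa>) p w w"
  shows "(hyp_height \<kappa> (hyp_geodesic \<omega> p w t))\<^sup>2 =
      (cosh (\<omega> * t) * hyp_height \<kappa> p + sinh_quotient \<omega> t * ((p \<bullet> w) / hyp_height \<kappa> p))\<^sup>2"
    "metric_inner (hyp_metric \<kappa>) (hyp_geodesic \<omega> p w t) (hyp_geodesic_velocity \<omega> p w t) (hyp_geodesic_velocity \<omega> p w t)
      = metric_inner (hyp_metric \<kappa>) p w w"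
proof -
  define C where "C = cosh (\<omega> * t)"
  define D where "D = sinh_quotient \<omega> t"
  define P where "P = hyp_height \<kappa> p"
  define b where "b = (p \<bullet> w) / P"
  define c where "c = metric_inner (hyp_metric \<kappa>) p w w"
  let ?\<gamma> = "hyp_geodesic \<omega> p w t" and ?u = "hyp_geodesic_velocity \<omega> p w t"
  have P: "P > 0" "P\<^sup>2 = 1 / \<kappa>\<^sup>2 + p \<bullet> p"
    using hyp_height_props[OF \<kappa>, of p] by (simp_all add: P_def)
  have Pb: "P * b = p \<bullet> w" using P by (simp add: b_def)
  have c: "c = w \<bullet> w - b\<^sup>2"
    unfolding c_def metric_inner_hyp_metric_height[OF \<kappa>] P_def[symmetric] b_def
    by (simp add: power_divide power2_eq_square)
  have CD: "C\<^sup>2 = 1 + \<kappa>\<^sup>2 * c * D\<^sup>2"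
    using cosh_square_sinh_quotient[of \<omega> t] \<omega> by (simp add: C_def D_def c_def)
  have g: "?\<gamma> = C *\<^sub>R p + D *\<^sub>R w" "?u = (\<kappa>\<^sup>2 * c * D) *\<^sub>R p + C *\<^sub>R w"
    by (simp_all add: hyp_geodesic_def hyp_geodesic_velocity_def C_def D_def \<omega> c_def)
  have pp: "p \<bullet> p = P\<^sup>2 - 1 / \<kappa>\<^sup>2" and ww: "w \<bullet> w = c + b\<^sup>2" and pw: "p \<bullet> w = P * b" and wp: "w \<bullet> p = P * b"
    using P c Pb by (simp_all add: inner_commute)
  note inn = inner_add_left inner_add_right inner_scaleR_left inner_scaleR_right pp ww pw wp
  have gg: "?\<gamma> \<bullet> ?\<gamma> = (C * P + D * b)\<^sup>2 - 1 / \<kappa>\<^sup>2"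
  proof -
    have "?\<gamma> \<bullet> ?\<gamma> = (C * P + D * b)\<^sup>2 - (C\<^sup>2 - \<kappa>\<^sup>2 * c * D\<^sup>2) / \<kappa>\<^sup>2"
      unfolding g inn using \<kappa> by (simp add: field_simps power2_eq_square)
    then show ?thesis using CD by simp
  qed
  have gu: "?\<gamma> \<bullet> ?u = (C * P + D * b) * (\<kappa>\<^sup>2 * c * D * P + C * b)"
    unfolding g inn using \<kappa> by (simp add: field_simps power2_eq_square)
  have uu: "?u \<bullet> ?u = (\<kappa>\<^sup>2 * c * D * P + C * b)\<^sup>2 + c"
  proof -
    have "?u \<bullet> ?u = (\<kappa>\<^sup>2 * c * D * P + C * b)\<^sup>2 + c * (C\<^sup>2 - \<kappa>\<^sup>2 * c * D\<^sup>2)"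
      unfolding g inn using \<kappa> by (simp add: field_simps power2_eq_square)
    then show ?thesis using CD by simp
  qed
  have h: "(hyp_height \<kappa> ?\<gamma>)\<^sup>2 = (C * P + D * b)\<^sup>2"
    unfolding hyp_height_props(2)[OF \<kappa>] gg by simp
  then show "(hyp_height \<kappa> ?\<gamma>)\<^sup>2 = (cosh (\<omega> * t) * hyp_height \<kappa> p + sinh_quotient \<omega> t * ((p \<bullet> w) / hyp_height \<kappa> p))\<^sup>2"
    by (simp add: C_def D_def P_def b_def)
  have "(C * P + D * b)\<^sup>2 > 0"
    using hyp_height_props(1)[OF \<kappa>, of ?\<gamma>] h by (metis zero_less_power)
  then have "C * P + D * b \<noteq> 0" by auto
  then have "((C * P + D * b) * (\<kappa>\<^sup>2 * c * D * P + C * b)) * ((C * P + D * b) * (\<kappa>\<^sup>2 * c * D * P + C * b)) / (C * P + D * b)\<^sup>2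
      = (\<kappa>\<^sup>2 * c * D * P + C * b)\<^sup>2"
    by (simp add: power2_eq_square)
  then show "metric_inner (hyp_metric \<kappa>) ?\<gamma> ?u ?u = metric_inner (hyp_metric \<kappa>) p w w"
    unfolding metric_inner_hyp_metric_height[OF \<kappa>, of ?\<gamma>] h gu uu c_def[symmetric] by simp
qed

lemma geodesic_on_hyp_geodesic:
  fixes p w :: "real ^ 'n::finite"
  assumes \<kappa>: "\<kappa> > 0" and \<omega>: "\<omega>\<^sup>2 = \<kappa>\<^sup>2 * metric_inner (hyp_metric \<kappa>) p w w"
  shows "geodesic_on (hyp_metric \<kappa>) T (hyp_geodesic \<omega> p w) (hyp_geodesic_velocity \<omega> p w)"
  unfolding geodesic_on_def geodesic_acceleration[OF \<kappa>] hyp_geodesic_speed(2)[OF \<kappa> \<omega>] \<omega>[symmetric]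
  using has_vector_derivative_hyp_geodesic by blast

text \<open>The squared speed \<open>c\<close> of any solution is constant; this makes the equation
  linear, and two first integrals then determine the solution.\<close>

lemma geodesic_on_unique:
  fixes \<gamma> u :: "real \<Rightarrow> real ^ 'n::finite"
  assumes \<kappa>: "\<kappa> > 0" and geo: "geodesic_on (hyp_metric \<kappa>) {0..1} \<gamma> u"
    and \<omega>: "\<omega>\<^sup>2 = \<kappa>\<^sup>2 * metric_inner (hyp_metric \<kappa>) (\<gamma> 0) (u 0) (u 0)"
    and t: "t \<in> {0..1}"
  shows "\<gamma> t = hyp_geodesic \<omega> (\<gamma> 0) (u 0) t"
proof -
  define c where "c t = metric_inner (hyp_metric \<kappa>) (\<gamma> t) (u t) (u t)" for t
  have d\<gamma>: "(\<gamma> has_vector_derivative u t) (at t within {0..1})"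
    and du: "(u has_vector_derivative (\<kappa>\<^sup>2 * c t) *\<^sub>R \<gamma> t) (at t within {0..1})" if "t \<in> {0..1}" for t
    using geo that unfolding geodesic_on_def geodesic_acceleration[OF \<kappa>] c_def by auto
  have Q: "1 / \<kappa>\<^sup>2 + \<gamma> t \<bullet> \<gamma> t > 0" for t
    using \<kappa> by (simp add: add_pos_nonneg)
  have c: "c t = u t \<bullet> u t - (\<gamma> t \<bullet> u t) * (\<gamma> t \<bullet> u t) / (1 / \<kappa>\<^sup>2 + \<gamma> t \<bullet> \<gamma> t)" for t
    unfolding c_def metric_inner_hyp_metric_height[OF \<kappa>] hyp_height_props(2)[OF \<kappa>] ..
  have inner_deriv: "((\<lambda>t. f t \<bullet> g t) has_real_derivative f t \<bullet> g' + f' \<bullet> g t) (at t within T)"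
    if "(f has_vector_derivative f') (at t within T)" "(g has_vector_derivative g') (at t within T)"
    for f g :: "real \<Rightarrow> real ^ 'n" and f' g' t T
    using has_derivative_inner[OF that[unfolded has_vector_derivative_def]]
    unfolding has_field_derivative_def by (rule has_derivative_eq_rhs) (simp add: fun_eq_iff algebra_simps)
  have "(c has_vector_derivative 0) (at t within {0..1})" if t: "t \<in> {0..1}" for t
  proof -
    let ?q = "1 / \<kappa>\<^sup>2 + \<gamma> t \<bullet> \<gamma> t" and ?k = "\<kappa>\<^sup>2 * c t"
    define A where "A = \<gamma> t \<bullet> u t"
    define B where "B = u t \<bullet> u t"
    define W where "W = \<gamma> t \<bullet> \<gamma> t"
    have q: "1 / \<kappa>\<^sup>2 + W > 0" using Q by (simp add: W_def)
    have s: "u t \<bullet> \<gamma> t = A" by (simp add: A_def inner_commute)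
    have 1: "((\<lambda>t. u t \<bullet> u t) has_real_derivative 2 * ?k * A) (at t within {0..1})"
      using inner_deriv[OF du[OF t] du[OF t]] by (simp add: s A_def mult_ac)
    have 2: "((\<lambda>t. \<gamma> t \<bullet> u t) has_real_derivative ?k * W + B) (at t within {0..1})"
      using inner_deriv[OF d\<gamma>[OF t] du[OF t]] by (simp add: W_def B_def)
    have 3: "((\<lambda>t. 1 / \<kappa>\<^sup>2 + \<gamma> t \<bullet> \<gamma> t) has_real_derivative 2 * A) (at t within {0..1})"
      using DERIV_add[OF DERIV_const inner_deriv[OF d\<gamma>[OF t] d\<gamma>[OF t]]] by (simp add: s A_def)
    define D where "D = 2 * ?k * A - (((?k * W + B) * A + (?k * W + B) * A) * (1 / \<kappa>\<^sup>2 + W) - A * A * (2 * A)) / ((1 / \<kappa>\<^sup>2 + W) * (1 / \<kappa>\<^sup>2 + W))"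
    have cfun: "c = (\<lambda>t. u t \<bullet> u t - (\<gamma> t \<bullet> u t) * (\<gamma> t \<bullet> u t) / (1 / \<kappa>\<^sup>2 + \<gamma> t \<bullet> \<gamma> t))"
      using c by blast
    have "((\<lambda>t. u t \<bullet> u t - (\<gamma> t \<bullet> u t) * (\<gamma> t \<bullet> u t) / (1 / \<kappa>\<^sup>2 + \<gamma> t \<bullet> \<gamma> t)) has_real_derivative D) (at t within {0..1})"
      by (rule DERIV_cong[OF DERIV_diff[OF 1 DERIV_divide[OF DERIV_mult[OF 2 2] 3 less_imp_neq[OF Q, symmetric]]]])
        (simp only: D_def A_def B_def W_def)
    then have "(c has_real_derivative D) (at t within {0..1})"
      unfolding cfun[symmetric] .
    \<comment> \<open>After clearing the denominator \<open>r * r\<close>, the definitions of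
      \<open>c\<close> and \<open>r\<close> make the numerator vanish.\<close>
    moreover have "D = 0"
    proof -
      define r where "r = 1 / \<kappa>\<^sup>2 + W"
      have r: "r > 0" using q by (simp add: r_def)
      have cr: "c t * r = B * r - A * A"
        unfolding c A_def[symmetric] B_def[symmetric] W_def[symmetric] r_def[symmetric] using r by (simp add: field_simps)
      have kr: "?k * r = c t + ?k * W" using \<kappa> by (simp add: r_def field_simps)
      have "(2 * ?k * A) * (r * r) - (((?k * W + B) * A + (?k * W + B) * A) * r - A * A * (2 * A))
        = 2 * A * ((?k * r) * r - (?k * W) * r - (B * r - A * A))"
        by (simp add: algebra_simps)
      also have "\<dots> = 0"
        unfolding kr cr[symmetric] by (simp add: algebra_simps)
      finally have n: "2 * ?k * A * (r * r) - (((?k * W + B) * A + (?k * W + B) * A) * r - A * A * (2 * A)) = 0" .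
      have "(((?k * W + B) * A + (?k * W + B) * A) * r - A * A * (2 * A)) / (r * r) = 2 * ?k * A"
        by (subst nonzero_divide_eq_eq) (use r in simp, use n in linarith)
      then show ?thesis unfolding r_def D_def by linarith
    qed
    ultimately show ?thesis
      by (simp only: has_real_derivative_iff_has_vector_derivative)
  qed
  then obtain c0 where c0: "\<And>t. t \<in> {0..1} \<Longrightarrow> c t = c0"
    using has_vector_derivative_zero_constant[of "{0..1::real}" c] by auto
  have k: "\<kappa>\<^sup>2 * c t = \<omega>\<^sup>2" if "t \<in> {0..1}" for t
    using c0[OF that] c0[of 0] \<omega> by (simp add: c_def)
  let ?C = "\<lambda>t. cosh (\<omega> * t)" and ?D = "sinh_quotient \<omega>"
  \<comment> \<open>The inverse of the fundamental matrix applied to position and velocity: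
    \<open>a\<close> and \<open>b\<close> keep their initial values.\<close>
  define a where "a t = ?C t *\<^sub>R \<gamma> t - ?D t *\<^sub>R u t" for t
  define b where "b t = ?C t *\<^sub>R u t - (\<omega>\<^sup>2 * ?D t) *\<^sub>R \<gamma> t" for t
  have "(a has_vector_derivative 0) (at t within {0..1})" if t: "t \<in> {0..1}" for t
    unfolding a_def[abs_def]
    by (rule has_vector_derivative_eq_rhs[OF has_vector_derivative_diff[OF has_vector_derivative_scaleR[OF has_real_derivative_cosh_scaled d\<gamma>[OF t]]
        has_vector_derivative_scaleR[OF has_real_derivative_sinh_quotient du[OF t, unfolded k[OF t]]]]]) (simp add: algebra_simps)
  then obtain a0 where a: "\<And>t. t \<in> {0..1} \<Longrightarrow> a t = a0"
    using has_vector_derivative_zero_constant[of "{0..1::real}" a] by auto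
  have "(b has_vector_derivative 0) (at t within {0..1})" if t: "t \<in> {0..1}" for t
    unfolding b_def[abs_def]
    by (rule has_vector_derivative_eq_rhs[OF has_vector_derivative_diff[OF has_vector_derivative_scaleR[OF has_real_derivative_cosh_scaled du[OF t, unfolded k[OF t]]]
        has_vector_derivative_scaleR[OF DERIV_cmult[OF has_real_derivative_sinh_quotient, of "\<omega>\<^sup>2"] d\<gamma>[OF t]]]]) (simp add: algebra_simps)
  then obtain b0 where b: "\<And>t. t \<in> {0..1} \<Longrightarrow> b t = b0"
    using has_vector_derivative_zero_constant[of "{0..1::real}" b] by auto
  have "a 0 = \<gamma> 0" "b 0 = u 0"
    by (simp_all add: a_def b_def sinh_quotient_def)
  then have at: "a t = \<gamma> 0" "b t = u 0"
    using a[of 0] b[of 0] a[OF t] b[OF t] by simp_all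
  have "?C t *\<^sub>R a t + ?D t *\<^sub>R b t = ((?C t)\<^sup>2 - \<omega>\<^sup>2 * (?D t)\<^sup>2) *\<^sub>R \<gamma> t"
    by (simp add: a_def b_def algebra_simps power2_eq_square)
  then show ?thesis
    unfolding hyp_geodesic_def at cosh_square_sinh_quotient by simp
qed

text \<open>\<open>exp_map\<close> is a definite description, so uniqueness of the geodesic matters
  as much as its existence.\<close>

lemma exp_map_hyp_metric:
  fixes p w :: "real ^ 'n::finite"
  assumes \<kappa>: "\<kappa> > 0" and \<omega>: "\<omega>\<^sup>2 = \<kappa>\<^sup>2 * metric_inner (hyp_metric \<kappa>) p w w"
  shows "exp_map (hyp_metric \<kappa>) p w = hyp_geodesic \<omega> p w 1"
  unfolding exp_map_def
proof (rule the_equality)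
  have 0: "hyp_geodesic \<omega> p w 0 = p" "hyp_geodesic_velocity \<omega> p w 0 = w"
    by (simp_all add: hyp_geodesic_def hyp_geodesic_velocity_def sinh_quotient_def)
  show "\<exists>\<gamma> u. geodesic_on (hyp_metric \<kappa>) {0..1} \<gamma> u \<and> \<gamma> 0 = p \<and> u 0 = w \<and> \<gamma> 1 = hyp_geodesic \<omega> p w 1"
    using geodesic_on_hyp_geodesic[OF \<kappa> \<omega>] 0 by blast
  fix q assume "\<exists>\<gamma> u. geodesic_on (hyp_metric \<kappa>) {0..1} \<gamma> u \<and> \<gamma> 0 = p \<and> u 0 = w \<and> \<gamma> 1 = q"
  then obtain \<gamma> u where g: "geodesic_on (hyp_metric \<kappa>) {0..1} \<gamma> u" "\<gamma> 0 = p" "u 0 = w" "\<gamma> 1 = q" by blast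
  then show "q = hyp_geodesic \<omega> p w 1"
    using geodesic_on_unique[OF \<kappa> g(1), of \<omega> 1] \<omega> by simp
qed

section \<open>The distance from the base point\<close>

text \<open>The metric has an explicit symmetric square root \<open>F\<close>, again a rank one
  perturbation of the identity, so both claims are inherited from the Euclidean inner
  product.\<close>

lemma metric_inner_hyp_metric_psd:
  fixes y :: "real ^ 'n::finite"
  assumes \<kappa>: "\<kappa> > 0"
  shows "metric_inner (hyp_metric \<kappa>) y u u \<ge> 0"
    "(metric_inner (hyp_metric \<kappa>) y v u)\<^sup>2 \<le> metric_inner (hyp_metric \<kappa>) y v v * metric_inner (hyp_metric \<kappa>) y u u"
proof -
  define T where "T = \<kappa> * hyp_height \<kappa> y"
  have T: "T > 0" "\<kappa>\<^sup>2 * (y \<bullet> y) = T\<^sup>2 - 1"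
    using \<kappa> hyp_height_props[OF \<kappa>, of y] by (simp_all add: T_def power_mult_distrib)
  \<comment> \<open>Solves \<open>2 * k - k * k * (y \<bullet> y) = \<kappa>^2 / T^2\<close>, which
    says that the square of \<open>F\<close> is the metric.\<close>
  define k where "k = \<kappa>\<^sup>2 / (T * (T + 1))"
  define F where "F u = u - (k * (y \<bullet> u)) *\<^sub>R y" for u
  have k: "2 * k - k * k * (y \<bullet> y) = \<kappa>\<^sup>2 / T\<^sup>2"
  proof -
    have "k * (y \<bullet> y) = (\<kappa>\<^sup>2 * (y \<bullet> y)) / (T * (T + 1))" by (simp add: k_def)
    also have "\<kappa>\<^sup>2 * (y \<bullet> y) = (T - 1) * (T + 1)"
      unfolding T(2) by (simp add: algebra_simps power2_eq_square)
    also have "(T - 1) * (T + 1) / (T * (T + 1)) = (T - 1) / T"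
      using T(1) by (intro nonzero_mult_divide_mult_cancel_right) simp
    finally have *: "k * (y \<bullet> y) = (T - 1) / T" .
    have 1: "2 * k - k * k * (y \<bullet> y) = k * (2 - k * (y \<bullet> y))" by (simp add: algebra_simps)
    have 2: "2 - (T - 1) / T = (T + 1) / T" using T(1) by (simp add: field_simps)
    have "T + 1 \<noteq> 0" using T(1) by linarith
    then have 3: "k * ((T + 1) / T) = \<kappa>\<^sup>2 / T\<^sup>2" by (simp add: k_def power2_eq_square)
    show ?thesis unfolding 1 * 2 3 ..
  qed
  have F: "metric_inner (hyp_metric \<kappa>) y u w = F u \<bullet> F w" for u w
  proof -
    have 1: "F u \<bullet> F w = u \<bullet> w - (2 * k - k * k * (y \<bullet> y)) * ((y \<bullet> u) * (y \<bullet> w))"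
      unfolding F_def by (simp add: inner_commute[of u y] algebra_simps)
    have 2: "\<kappa>\<^sup>2 / T\<^sup>2 = 1 / (hyp_height \<kappa> y)\<^sup>2"
      using \<kappa> by (simp add: T_def power_mult_distrib)
    show ?thesis
      unfolding 1 k 2 metric_inner_hyp_metric_height[OF \<kappa>] by simp
  qed
  show "metric_inner (hyp_metric \<kappa>) y u u \<ge> 0"
    "(metric_inner (hyp_metric \<kappa>) y v u)\<^sup>2 \<le> metric_inner (hyp_metric \<kappa>) y v v * metric_inner (hyp_metric \<kappa>) y u u"
    unfolding F by (auto intro: Cauchy_Schwarz_ineq)
qed

text \<open>Cauchy-Schwarz for the metric, applied to \<open>u\<close> and to the gradient of the
  function.\<close>

lemma ambient_linear_derivative_bound:
  fixes y :: "real ^ 'n::finite"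
  assumes \<kappa>: "\<kappa> > 0"
  shows "(a \<bullet> u + a\<^sub>0 * (y \<bullet> u / hyp_height \<kappa> y))\<^sup>2 \<le>
    hyp_gradient_product \<kappa> (ambient_linear \<kappa> a a\<^sub>0) (ambient_linear \<kappa> a a\<^sub>0) y * metric_inner (hyp_metric \<kappa>) y u u"
proof -
  define n where "n = a + (a\<^sub>0 * inverse (hyp_height \<kappa> y)) *\<^sub>R y"
  define E where "E = y \<bullet> n"
  \<comment> \<open>The metric gradient: the inverse metric applied to the Euclidean gradient
    \<open>n\<close>.\<close>
  define v where "v = n + (\<kappa>\<^sup>2 * E) *\<^sub>R y"
  have Q: "1 + \<kappa>\<^sup>2 * (y \<bullet> y) > 0" by (simp add: add_pos_nonneg)
  have n: "a \<bullet> u + a\<^sub>0 * (y \<bullet> u / hyp_height \<kappa> y) = n \<bullet> u"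
    by (simp add: n_def inner_add_left divide_inverse)
  have yv: "y \<bullet> v = E * (1 + \<kappa>\<^sup>2 * (y \<bullet> y))"
    by (simp add: v_def inner_add_right E_def[symmetric] algebra_simps)
  have gv: "metric_inner (hyp_metric \<kappa>) y v w = n \<bullet> w" for w
    unfolding metric_inner_hyp_metric[OF \<kappa>] yv using Q
    by (simp add: v_def inner_add_left)
  have "hyp_gradient_product \<kappa> (ambient_linear \<kappa> a a\<^sub>0) (ambient_linear \<kappa> a a\<^sub>0) y = n \<bullet> n + \<kappa>\<^sup>2 * (E * E)"
    unfolding hyp_gradient_product_def partial_deriv_ambient_linear[OF \<kappa>] real_scaleR_def E_def inner_vec_def inner_real_def n_def
    by (simp add: mult_ac)
  also have "\<dots> = metric_inner (hyp_metric \<kappa>) y v v"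
    unfolding gv by (simp add: v_def inner_add_right E_def inner_commute)
  finally show ?thesis
    using metric_inner_hyp_metric_psd(2)[OF \<kappa>, of y v u] unfolding n gv by simp
qed

context hyp_frame
begin

text \<open>Both terms on the right are nonnegative, the second by Cauchy-Schwarz, and the second
  factor on the left is positive. The bound \<open>\<tau> \<ge> 1\<close> and its case of equality
  follow.\<close>

lemma \<tau>_minus_1_mult:
  "(\<tau> x - 1) * (\<kappa>\<^sup>2 * (hyp_height \<kappa> x * hyp_height \<kappa> p + x \<bullet> p) + 1)
     = \<kappa>\<^sup>2 * (norm (x - p))\<^sup>2 + \<kappa> ^ 4 * ((x \<bullet> x) * (p \<bullet> p) - (x \<bullet> p)\<^sup>2)"
proof -
  have "(\<tau> x - 1) * (\<kappa>\<^sup>2 * (hyp_height \<kappa> x * hyp_height \<kappa> p + x \<bullet> p) + 1)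
     = (\<tau> x - 1) * (\<tau> x + 1 + 2 * \<kappa>\<^sup>2 * (x \<bullet> p))"
    unfolding \<tau>_eq by (simp add: algebra_simps)
  also have "\<dots> = ((\<tau> x)\<^sup>2 - 1) + 2 * \<kappa>\<^sup>2 * (x \<bullet> p) * (\<tau> x - 1)"
    by (simp add: algebra_simps power2_eq_square)
  also have "\<dots> = \<kappa>\<^sup>2 * (x \<bullet> x + p \<bullet> p - 2 * (x \<bullet> p)) + \<kappa> ^ 4 * ((x \<bullet> x) * (p \<bullet> p) - (x \<bullet> p)\<^sup>2)"
    unfolding \<tau>_square by simp
  finally show ?thesis
    unfolding power2_norm_eq_inner by (simp add: inner_diff_left inner_diff_right inner_commute algebra_simps)
qed

lemma \<tau>_ge_1: "\<tau> x \<ge> 1" and \<tau>_eq_1: "\<tau> x = 1 \<Longrightarrow> x = p"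
proof -
  have "\<bar>x \<bullet> p\<bar> < hyp_height \<kappa> x * hyp_height \<kappa> p"
  proof -
    have "norm x < hyp_height \<kappa> x" "norm p < hyp_height \<kappa> p"
      unfolding hyp_height_def norm_eq_sqrt_inner using \<kappa> by simp_all
    then have "norm x * norm p < hyp_height \<kappa> x * hyp_height \<kappa> p"
      by (intro mult_strict_mono') auto
    then show ?thesis using Cauchy_Schwarz_ineq2[of x p] by linarith
  qed
  then have pos: "\<kappa>\<^sup>2 * (hyp_height \<kappa> x * hyp_height \<kappa> p + x \<bullet> p) + 1 > 0"
    by (intro add_nonneg_pos mult_nonneg_nonneg) auto
  have nn: "\<kappa> ^ 4 * ((x \<bullet> x) * (p \<bullet> p) - (x \<bullet> p)\<^sup>2) \<ge> 0"
    using Cauchy_Schwarz_ineq[of x p] by simp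
  then have "(\<tau> x - 1) * (\<kappa>\<^sup>2 * (hyp_height \<kappa> x * hyp_height \<kappa> p + x \<bullet> p) + 1) \<ge> 0"
    unfolding \<tau>_minus_1_mult by simp
  then show "\<tau> x \<ge> 1"
    using pos by (simp add: zero_le_mult_iff)
  assume "\<tau> x = 1"
  then have "\<kappa>\<^sup>2 * (norm (x - p))\<^sup>2 + \<kappa> ^ 4 * ((x \<bullet> x) * (p \<bullet> p) - (x \<bullet> p)\<^sup>2) = 0"
    using \<tau>_minus_1_mult[of x] by simp
  moreover have "\<kappa>\<^sup>2 * (norm (x - p))\<^sup>2 \<ge> 0" by simp
  ultimately have "\<kappa>\<^sup>2 * (norm (x - p))\<^sup>2 = 0" using nn by linarith
  then show "x = p" using \<kappa> by simp
qed

lemma \<tau>_p: "\<tau> p = 1"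
proof -
  have "\<tau> p = \<kappa>\<^sup>2 * (hyp_height \<kappa> p)\<^sup>2 - \<kappa>\<^sup>2 * (p \<bullet> p)"
    unfolding \<tau>_eq by (simp add: power2_eq_square algebra_simps)
  then show ?thesis unfolding hyp_height_props(3)[OF \<kappa>] by simp
qed

text \<open>The gradient of \<open>\<tau>\<close> has length
  \<open>\<kappa> * sqrt (\<tau>\<^sup>2 - 1)\<close>, so \<open>arcosh \<tau> / \<kappa>\<close>
  grows at most at unit rate along a curve. As \<open>arcosh\<close> is not differentiable at 1,
  where the path starts, it is regularized with a parameter \<open>e\<close>.\<close>

lemma path_length_ge:
  assumes valid: "valid_path \<gamma>" and ends: "pathstart \<gamma> = p" "pathfinish \<gamma> = x"
    and L: "((\<lambda>t. let u = vector_derivative \<gamma> (at t) in sqrt (metric_inner (hyp_metric \<kappa>) (\<gamma> t) u u)) has_integral L) {0..1}"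
  shows "arcosh (\<tau> x) / \<kappa> \<le> L"
proof -
  define f where "f t = sqrt (metric_inner (hyp_metric \<kappa>) (\<gamma> t) (vector_derivative \<gamma> (at t)) (vector_derivative \<gamma> (at t)))" for t
  have f: "(f has_integral L) {0..1}"
    using L by (simp add: f_def[abs_def] Let_def)
  have f0: "f t \<ge> 0" for t
    unfolding f_def by (simp add: metric_inner_hyp_metric_psd(1)[OF \<kappa>])
  obtain S where S: "finite S" and cont: "continuous_on {0..1} \<gamma>" and C1: "\<gamma> C1_differentiable_on {0..1} - S"
    using valid unfolding valid_path_def piecewise_C1_differentiable_on_def by blast
  have "arcosh (\<tau> x) \<le> \<kappa> * L + e" if e: "e > 0" for e
  proof -
    \<comment> \<open>\<open>ln (z + R z)\<close> has derivative \<open>1 / R z\<close>. It becomes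
      \<open>arcosh z\<close> for \<open>e = 0\<close>, while for \<open>e > 0\<close> it is
      differentiable at 1 with value \<open>ln (1 + e)\<close>, at most \<open>e\<close>.\<close>
    define R where "R z = sqrt (z\<^sup>2 - 1 + e\<^sup>2)" for z :: real
    have Rpos: "z\<^sup>2 - 1 + e\<^sup>2 > 0" if "z \<ge> 1" for z :: real
      using one_le_power[OF that, of 2] e by (simp add: add_nonneg_pos)
    have dphi: "((\<lambda>z. ln (z + R z)) has_real_derivative 1 / R z) (at z)" if "z \<ge> 1" for z
    proof -
      have r: "R z > 0" using Rpos[OF that] by (simp add: R_def)
      have "((\<lambda>z. z\<^sup>2 - 1 + e\<^sup>2) has_real_derivative 2 * z) (at z)"
        by (auto intro!: derivative_eq_intros)
      from DERIV_chain2[OF DERIV_real_sqrt[OF Rpos[OF that]] this]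
      have "(R has_real_derivative z / R z) (at z)"
        unfolding R_def[abs_def] by (rule DERIV_cong) (simp add: field_simps)
      from DERIV_chain2[OF DERIV_ln DERIV_add[OF DERIV_ident this]]
      have "((\<lambda>z. ln (z + R z)) has_real_derivative inverse (z + R z) * (1 + z / R z)) (at z)"
        using r that by simp
      then show ?thesis
        by (rule DERIV_cong) (use r that in \<open>simp add: field_simps\<close>)
    qed
    define h where "h t = ln (\<tau> (\<gamma> t) + R (\<tau> (\<gamma> t)))" for t
    \<comment> \<open>The value 0 at the exceptional points makes the pointwise inequality hold
      everywhere, as the comparison of integrals requires.\<close>
    define h' where "h' t = (if t \<in> {0<..<1} - S then vector_derivative h (at t) else 0)" for t
    have hd: "(h has_vector_derivative h' t) (at t)" "h' t \<le> \<kappa> * f t" if t: "t \<in> {0<..<1} - S" for t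
    proof -
      define u where "u = vector_derivative \<gamma> (at t)"
      have "t \<in> {0..1} - S" using t by auto
      then have "\<gamma> differentiable (at t)"
        using C1 unfolding C1_differentiable_on_eq by blast
      then have "(\<gamma> has_vector_derivative u) (at t)"
        unfolding u_def by (simp add: vector_derivative_works)
      then have "(\<gamma> has_derivative (\<lambda>h. h *\<^sub>R u)) (at t)"
        by (simp add: has_vector_derivative_def)
      from has_derivative_compose[OF this has_derivative_ambient_linear[OF \<kappa>]]
      have "((\<lambda>t. \<tau> (\<gamma> t)) has_real_derivative
          (- (\<kappa>\<^sup>2 *\<^sub>R p)) \<bullet> u + \<kappa>\<^sup>2 * hyp_height \<kappa> p * (\<gamma> t \<bullet> u / hyp_height \<kappa> (\<gamma> t))) (at t)"
        unfolding \<tau>_def has_field_derivative_def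
        by (rule has_derivative_eq_rhs) (simp add: fun_eq_iff algebra_simps)
      then obtain d where d: "((\<lambda>t. \<tau> (\<gamma> t)) has_real_derivative d) (at t)"
        "d = (- (\<kappa>\<^sup>2 *\<^sub>R p)) \<bullet> u + \<kappa>\<^sup>2 * hyp_height \<kappa> p * (\<gamma> t \<bullet> u / hyp_height \<kappa> (\<gamma> t))" by blast
      let ?z = "\<tau> (\<gamma> t)"
      have z: "?z \<ge> 1" by (rule \<tau>_ge_1)
      have "(h has_real_derivative 1 / R ?z * d) (at t)"
        unfolding h_def[abs_def] by (rule DERIV_chain2[OF dphi[OF z] d(1)])
      then have hv: "(h has_vector_derivative 1 / R ?z * d) (at t)"
        by (simp add: has_real_derivative_iff_has_vector_derivative)
      then have h': "h' t = 1 / R ?z * d"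
        using t vector_derivative_at by (auto simp: h'_def)
      then show "(h has_vector_derivative h' t) (at t)" using hv by simp
      have "d\<^sup>2 \<le> \<kappa>\<^sup>2 * (?z\<^sup>2 - 1) * metric_inner (hyp_metric \<kappa>) (\<gamma> t) u u"
        using ambient_linear_derivative_bound[OF \<kappa>, of "- (\<kappa>\<^sup>2 *\<^sub>R p)" u "\<kappa>\<^sup>2 * hyp_height \<kappa> p" "\<gamma> t"] gradient_products(1)[of "\<gamma> t"]
        unfolding d(2) \<tau>_def by simp
      also have "\<dots> \<le> \<kappa>\<^sup>2 * (R ?z)\<^sup>2 * metric_inner (hyp_metric \<kappa>) (\<gamma> t) u u"
        using Rpos[OF z] by (intro mult_right_mono mult_left_mono metric_inner_hyp_metric_psd(1)[OF \<kappa>]) (auto simp: R_def)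
      also have "\<dots> = (\<kappa> * R ?z * f t)\<^sup>2"
        using metric_inner_hyp_metric_psd(1)[OF \<kappa>, of "\<gamma> t" u] by (simp add: f_def u_def power_mult_distrib)
      finally have "\<bar>d\<bar> \<le> \<kappa> * R ?z * f t"
        using f0[of t] \<kappa> Rpos[OF z] by (intro abs_le_square_iff[THEN iffD2, of d "\<kappa> * R ?z * f t", THEN order_trans]) (auto simp: R_def)
      then have "d \<le> \<kappa> * f t * R ?z" by (simp add: mult_ac)
      then show "h' t \<le> \<kappa> * f t"
        unfolding h' using Rpos[OF z] by (simp add: R_def divide_le_eq)
    qed
    have "continuous_on {1..} (\<lambda>z. ln (z + R z))"
      by (intro continuous_at_imp_continuous_on ballI DERIV_isCont[OF dphi]) simp
    moreover have "continuous_on {0..1} (\<lambda>t. \<tau> (\<gamma> t))"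
      by (rule continuous_on_compose2[OF Ck_continuous[OF Ck_\<tau>] cont]) simp
    ultimately have hc: "continuous_on {0..1} h"
      unfolding h_def[abs_def] by (rule continuous_on_compose2) (use \<tau>_ge_1 in auto)
    have "(h' has_integral (h 1 - h 0)) {0..1}"
      by (rule fundamental_theorem_of_calculus_interior_strong[OF S _ hd(1) hc]) auto
    moreover have "((\<lambda>t. \<kappa> * f t) has_integral \<kappa> * L) {0..1}"
      using has_integral_mult_right[OF f] .
    moreover have "h' t \<le> \<kappa> * f t" for t
      using hd(2)[of t] f0[of t] \<kappa> by (cases "t \<in> {0<..<1} - S") (auto simp: h'_def)
    ultimately have "h 1 - h 0 \<le> \<kappa> * L"
      by (rule has_integral_le)
    moreover have "h 0 = ln (1 + e)"
      using ends e by (simp add: h_def R_def pathstart_def \<tau>_p)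
    moreover have "ln (1 + e) \<le> e"
      using e by (simp add: ln_add_one_self_le_self)
    moreover have "arcosh (\<tau> x) \<le> h 1"
    proof -
      have x1: "(\<tau> x)\<^sup>2 \<ge> 1" using \<tau>_ge_1[of x] by simp
      have "arcosh (\<tau> x) = ln (\<tau> x + sqrt ((\<tau> x)\<^sup>2 - 1))"
        using \<tau>_ge_1 by (simp add: arcosh_real_def)
      also have "\<dots> \<le> ln (\<tau> x + R (\<tau> x))"
        using \<tau>_pos[of x] x1 unfolding R_def by (intro ln_mono add_left_mono real_sqrt_le_mono) (auto intro: add_pos_nonneg)
      finally show ?thesis using ends by (simp add: h_def pathfinish_def)
    qed
    ultimately show ?thesis by linarith
  qed
  then have "arcosh (\<tau> x) \<le> \<kappa> * L" by (rule field_le_epsilon)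
  then show ?thesis using \<kappa> by (simp add: divide_le_eq mult.commute)
qed

text \<open>The geodesic formula is solved for its initial velocity.\<close>

lemma geodesic_to_point:
  defines "\<theta> \<equiv> \<lambda>x. arcosh (\<tau> x)"
  obtains w where "hyp_geodesic (\<theta> x) p w 1 = x" "(\<theta> x)\<^sup>2 = \<kappa>\<^sup>2 * metric_inner (hyp_metric \<kappa>) p w w"
proof (cases "x = p")
  case True
  then have "\<theta> x = 0" by (simp add: \<theta>_def \<tau>_p)
  then show thesis
    using True that[of 0] by (simp add: hyp_geodesic_def metric_inner_def)
next
  case False
  then have "\<tau> x > 1" using \<tau>_ge_1[of x] \<tau>_eq_1[of x] by linarith
  define t where "t = \<theta> x"
  have c: "cosh t = \<tau> x" using \<tau>_ge_1[of x] by (simp add: t_def \<theta>_def)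
  have "t \<noteq> 0" using c \<open>\<tau> x > 1\<close> by auto
  have s: "(sinh t)\<^sup>2 = (\<tau> x)\<^sup>2 - 1" using cosh_square_eq[of t] c by simp
  have sn: "sinh t \<noteq> 0" using \<open>t \<noteq> 0\<close> by simp
  \<comment> \<open>From \<open>x = cosh t *\<^sub>R p + (sinh t / t) *\<^sub>R w\<close> with
    \<open>cosh t = \<tau> x\<close>.\<close>
  define v where "v = x - \<tau> x *\<^sub>R p"
  define w where "w = (t / sinh t) *\<^sub>R v"
  define P where "P = hyp_height \<kappa> p"
  define S where "S = hyp_height \<kappa> x"
  define a where "a = x \<bullet> p"
  have P: "P > 0" "p \<bullet> p = P\<^sup>2 - 1 / \<kappa>\<^sup>2" and S: "x \<bullet> x = S\<^sup>2 - 1 / \<kappa>\<^sup>2"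
    using hyp_height_props[OF \<kappa>, of p] hyp_height_props[OF \<kappa>, of x] by (simp_all add: P_def S_def)
  have SP: "S * P = \<tau> x / \<kappa>\<^sup>2 + a"
    using \<kappa> by (simp add: \<tau>_eq S_def P_def a_def)
  have vv: "v \<bullet> v = (S\<^sup>2 - 1 / \<kappa>\<^sup>2) - 2 * \<tau> x * a + (\<tau> x)\<^sup>2 * (P\<^sup>2 - 1 / \<kappa>\<^sup>2)"
    unfolding v_def by (simp add: inner_diff_left inner_diff_right inner_commute[of p x] a_def[symmetric] P S power2_eq_square algebra_simps)
  have pv: "p \<bullet> v = a - \<tau> x * (P\<^sup>2 - 1 / \<kappa>\<^sup>2)"
    unfolding v_def by (simp add: inner_diff_right inner_commute[of p x] a_def[symmetric] P)
  have "P\<^sup>2 * (v \<bullet> v) - (p \<bullet> v)\<^sup>2 = (S * P)\<^sup>2 - (\<tau> x / \<kappa>\<^sup>2 + a)\<^sup>2 + P\<^sup>2 * (((\<tau> x)\<^sup>2 - 1) / \<kappa>\<^sup>2)"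
    unfolding vv pv using \<kappa> by (simp add: field_simps power2_eq_square)
  then have "P\<^sup>2 * (v \<bullet> v) - (p \<bullet> v)\<^sup>2 = P\<^sup>2 * (((\<tau> x)\<^sup>2 - 1) / \<kappa>\<^sup>2)"
    unfolding SP by simp
  then have "v \<bullet> v - (p \<bullet> v) * (p \<bullet> v) / P\<^sup>2 = X" if "X = ((\<tau> x)\<^sup>2 - 1) / \<kappa>\<^sup>2" for X
    unfolding that[symmetric] using P(1) by (simp add: field_simps power2_eq_square)
  then have "metric_inner (hyp_metric \<kappa>) p v v = ((\<tau> x)\<^sup>2 - 1) / \<kappa>\<^sup>2"
    unfolding metric_inner_hyp_metric_height[OF \<kappa>] P_def[symmetric] by blast
  moreover have "metric_inner (hyp_metric \<kappa>) p w w = (t / sinh t)\<^sup>2 * metric_inner (hyp_metric \<kappa>) p v v"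
    unfolding metric_inner_hyp_metric_height[OF \<kappa>] w_def by (simp add: power2_eq_square algebra_simps)
  ultimately have "metric_inner (hyp_metric \<kappa>) p w w = t\<^sup>2 / \<kappa>\<^sup>2"
    unfolding s[symmetric] using sn by (simp add: power_divide)
  then have "(\<theta> x)\<^sup>2 = \<kappa>\<^sup>2 * metric_inner (hyp_metric \<kappa>) p w w"
    using \<kappa> by (simp add: t_def)
  moreover have "hyp_geodesic (\<theta> x) p w 1 = x"
    unfolding hyp_geodesic_def sinh_quotient_def t_def[symmetric] using \<open>t \<noteq> 0\<close> sn c
    by (simp add: w_def v_def)
  ultimately show thesis using that by blast
qed

text \<open>A geodesic attains the lower bound of \<open>path_length_ge\<close>, so the infimum is a
  minimum.\<close>

lemma riemannian_dist_eq: "riemannian_dist (hyp_metric \<kappa>) p x = arcosh (\<tau> x) / \<kappa>"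
  unfolding riemannian_dist_def
proof (rule cInf_eq_minimum)
  define \<theta> where "\<theta> = arcosh (\<tau> x)"
  obtain w where w: "hyp_geodesic \<theta> p w 1 = x" "\<theta>\<^sup>2 = \<kappa>\<^sup>2 * metric_inner (hyp_metric \<kappa>) p w w"
    using geodesic_to_point[of x] unfolding \<theta>_def by blast
  let ?\<gamma> = "hyp_geodesic \<theta> p w" and ?u = "hyp_geodesic_velocity \<theta> p w"
  have "continuous_on {0..1} ?u"
    by (intro continuous_at_imp_continuous_on ballI has_vector_derivative_continuous[OF has_vector_derivative_hyp_geodesic(2)])
  then have "?\<gamma> C1_differentiable_on {0..1}"
    unfolding C1_differentiable_on_def using has_vector_derivative_hyp_geodesic(1) by blast
  then have v: "valid_path ?\<gamma>"
    unfolding valid_path_def by (rule C1_differentiable_imp_piecewise)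
  have "\<theta> \<ge> 0" using \<tau>_ge_1 by (simp add: \<theta>_def)
  have "metric_inner (hyp_metric \<kappa>) p w w = (\<theta> / \<kappa>)\<^sup>2"
    using w(2) \<kappa> by (simp add: power_divide)
  then have "sqrt (metric_inner (hyp_metric \<kappa>) (?\<gamma> t) (?u t) (?u t)) = \<theta> / \<kappa>" for t
    unfolding hyp_geodesic_speed(2)[OF \<kappa> w(2)] using \<open>\<theta> \<ge> 0\<close> \<kappa> by simp
  then have l: "((\<lambda>t. let u = vector_derivative ?\<gamma> (at t) in sqrt (metric_inner (hyp_metric \<kappa>) (?\<gamma> t) u u)) has_integral \<theta> / \<kappa>) {0..1}"
    unfolding Let_def vector_derivative_at[OF has_vector_derivative_hyp_geodesic(1)]
    using has_integral_const_real[of "\<theta> / \<kappa>" 0 1] by simp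
  have e: "pathstart ?\<gamma> = p" "pathfinish ?\<gamma> = x"
    using w(1) by (simp_all add: pathstart_def pathfinish_def hyp_geodesic_def sinh_quotient_def)
  show "arcosh (\<tau> x) / \<kappa> \<in> {L. \<exists>\<gamma>. valid_path \<gamma> \<and> pathstart \<gamma> = p \<and> pathfinish \<gamma> = x \<and>
      ((\<lambda>t. let u = vector_derivative \<gamma> (at t) in sqrt (metric_inner (hyp_metric \<kappa>) (\<gamma> t) u u)) has_integral L) {0..1}}"
    using v e l unfolding \<theta>_def by blast
next
  fix L assume "L \<in> {L. \<exists>\<gamma>. valid_path \<gamma> \<and> pathstart \<gamma> = p \<and> pathfinish \<gamma> = x \<and>
      ((\<lambda>t. let u = vector_derivative \<gamma> (at t) in sqrt (metric_inner (hyp_metric \<kappa>) (\<gamma> t) u u)) has_integral L) {0..1}}"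
  then show "arcosh (\<tau> x) / \<kappa> \<le> L"
    using path_length_ge by blast
qed

section \<open>Potential and exponential map in the adapted coordinates\<close>

text \<open>As \<open>\<kappa> * r\<close> is \<open>sinh (\<kappa> * \<rho>)\<close>, the
  denominator of the potential is the square of \<open>\<tau>\<close>. The potential therefore
  shifts the power of \<open>\<tau>\<close> by two, exactly as the Laplacian does.\<close>

lemma harmonic_potential_eq: "harmonic_potential \<kappa> p x = (1 - (inverse (\<tau> x))\<^sup>2) / \<kappa>\<^sup>2"
proof -
  have "cosh (\<kappa> * (arcosh (\<tau> x) / \<kappa>)) = \<tau> x"
    using \<kappa> \<tau>_ge_1[of x] by simp
  then have "(sinh (\<kappa> * (arcosh (\<tau> x) / \<kappa>)))\<^sup>2 = (\<tau> x)\<^sup>2 - 1"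
    using cosh_square_eq[of "\<kappa> * (arcosh (\<tau> x) / \<kappa>)"] by simp
  then show ?thesis
    unfolding harmonic_potential_def riemannian_dist_eq Let_def power_divide
    using \<kappa> \<tau>_pos[of x] by (simp add: field_simps)
qed

text \<open>Geodesic polar coordinates: \<open>\<tau>\<close> is cosh (\<kappa> |y|), and
  \<open>Y\<close> is \<open>y\<close> times sinh (\<kappa> |y|) / (\<kappa> |y|). Both are linear
  in the end point and its height, so the height is what has to be computed.\<close>

lemma exp_map_coordinates:
  fixes y :: "real ^ 'n"
  defines "s \<equiv> \<kappa>\<^sup>2 * (y \<bullet> y)"
  shows "\<tau> (exp_map (hyp_metric \<kappa>) p (J y)) = cosh_sqrt 0 s"
    "Y (exp_map (hyp_metric \<kappa>) p (J y)) = (2 * cosh_sqrt 1 s) *\<^sub>R y"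
proof -
  define P where "P = hyp_height \<kappa> p"
  have P: "P > 0" "\<kappa>\<^sup>2 * (p \<bullet> p) = \<kappa>\<^sup>2 * P\<^sup>2 - 1" using hyp_height_props[OF \<kappa>, of p] by (simp_all add: P_def)
  define \<omega> where "\<omega> = \<kappa> * norm y"
  have w0: "\<omega> \<ge> 0" using \<kappa> by (simp add: \<omega>_def)
  have \<omega>s: "\<omega>\<^sup>2 = s" by (simp add: \<omega>_def s_def power_mult_distrib power2_norm_eq_inner)
  have gJ: "metric_inner (hyp_metric \<kappa>) p (J y) (J y) = y \<bullet> y"
    using J by (simp add: tangent_isometry_def)
  have \<omega>: "\<omega>\<^sup>2 = \<kappa>\<^sup>2 * metric_inner (hyp_metric \<kappa>) p (J y) (J y)"
    unfolding gJ \<omega>s s_def ..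
  define C where "C = cosh \<omega>"
  define D where "D = sinh_quotient \<omega> 1"
  have C: "C = cosh_sqrt 0 s" unfolding C_def \<omega>s[symmetric] cosh_sqrt_0_square ..
  have D: "D = 2 * cosh_sqrt 1 s"
  proof (cases "\<omega> = 0")
    case True
    then have "s = 0" using \<omega>s by simp
    then show ?thesis
      unfolding D_def sinh_quotient_def \<open>s = 0\<close> cosh_sqrt_at_0 using True by simp
  next
    case False
    then show ?thesis
      unfolding D_def sinh_quotient_def \<omega>s[symmetric] mult_1_right cosh_sqrt_1_square[of \<omega>, symmetric] by simp
  qed
  have D0: "D \<ge> 0" using w0 by (simp add: D_def sinh_quotient_def)
  define q where "q = exp_map (hyp_metric \<kappa>) p (J y)"
  have q: "q = C *\<^sub>R p + D *\<^sub>R J y"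
    unfolding q_def exp_map_hyp_metric[OF \<kappa> \<omega>] hyp_geodesic_def C_def D_def by simp
  define b where "b = (p \<bullet> J y) / P"
  have Pb: "P * b = p \<bullet> J y" using P by (simp add: b_def)
  \<comment> \<open>The geodesic formula lifted to the time coordinate. Its square is known from
    \<open>hyp_geodesic_speed\<close>; the sign follows from
    \<open>\<bar>D * b\<bar> \<le> C * P\<close>, which rests on Cauchy-Schwarz.\<close>
  have hq: "hyp_height \<kappa> q = C * P + D * b"
  proof -
    have "(hyp_height \<kappa> q)\<^sup>2 = (C * P + D * b)\<^sup>2"
      using hyp_geodesic_speed(1)[OF \<kappa> \<omega>, of 1]
      by (simp add: q_def exp_map_hyp_metric[OF \<kappa> \<omega>] C_def D_def P_def b_def)
    moreover have "C * P + D * b \<ge> 0"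
    proof -
      have "(D * b)\<^sup>2 \<le> (C * P)\<^sup>2"
      proof -
        have "J y \<bullet> J y - b\<^sup>2 = y \<bullet> y"
          using metric_J[of y y] by (simp add: b_def P_def power_divide power2_eq_square)
        moreover have "(P * b)\<^sup>2 \<le> (p \<bullet> p) * (J y \<bullet> J y)"
          unfolding Pb by (rule Cauchy_Schwarz_ineq)
        ultimately have "P\<^sup>2 * b\<^sup>2 \<le> (p \<bullet> p) * (y \<bullet> y + b\<^sup>2)"
          by (simp add: power_mult_distrib algebra_simps)
        then have "\<kappa>\<^sup>2 * (P\<^sup>2 * b\<^sup>2) \<le> \<kappa>\<^sup>2 * ((p \<bullet> p) * (y \<bullet> y + b\<^sup>2))"
          by (intro mult_left_mono) auto
        also have "\<dots> = (\<kappa>\<^sup>2 * P\<^sup>2 - 1) * (y \<bullet> y + b\<^sup>2)"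
          unfolding P(2)[symmetric] by simp
        finally have "b\<^sup>2 \<le> \<kappa>\<^sup>2 * P\<^sup>2 * (y \<bullet> y) - y \<bullet> y"
          by (simp add: algebra_simps)
        moreover have "P\<^sup>2 * s = \<kappa>\<^sup>2 * P\<^sup>2 * (y \<bullet> y)" by (simp add: s_def mult_ac)
        ultimately have "b\<^sup>2 \<le> P\<^sup>2 * s" using inner_ge_zero[of y] by linarith
        then have "D\<^sup>2 * b\<^sup>2 \<le> D\<^sup>2 * (P\<^sup>2 * s)" by (intro mult_left_mono) auto
        also have "\<dots> = P\<^sup>2 * (\<omega>\<^sup>2 * D\<^sup>2)" by (simp add: \<omega>s mult_ac)
        also have "\<dots> \<le> P\<^sup>2 * C\<^sup>2"
          using cosh_square_sinh_quotient[of \<omega> 1] by (intro mult_left_mono) (auto simp: C_def D_def)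
        finally show ?thesis by (simp add: power_mult_distrib mult_ac)
      qed
      moreover have "C * P \<ge> 0" using P by (simp add: C_def)
      ultimately have "\<bar>D * b\<bar> \<le> C * P" by (metis abs_le_square_iff abs_of_nonneg)
      then show ?thesis by linarith
    qed
    ultimately show ?thesis
      using hyp_height_props(1)[OF \<kappa>, of q] by (metis power2_eq_iff_nonneg less_imp_le)
  qed
  have "\<tau> q = C * (\<kappa>\<^sup>2 * P\<^sup>2 - \<kappa>\<^sup>2 * (p \<bullet> p)) + \<kappa>\<^sup>2 * D * (P * b - p \<bullet> J y)"
    unfolding \<tau>_eq hq P_def[symmetric] by (simp add: q inner_add_left inner_commute[of "J y"] algebra_simps power2_eq_square)
  then show "\<tau> (exp_map (hyp_metric \<kappa>) p (J y)) = cosh_sqrt 0 s"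
    unfolding P(2) Pb q_def[symmetric] C by simp
  have "Y q $ l = D * y $ l" for l
  proof -
    let ?e = "J (axis l 1)"
    have "Y q $ l = C * (p \<bullet> ?e) + D * (J y \<bullet> ?e) - (p \<bullet> ?e) / P * (C * P + D * b)"
      by (simp add: Y_def Y_coord_def ambient_linear_def hq P_def[symmetric]) (simp add: q inner_add_right inner_commute)
    also have "\<dots> = D * (J y \<bullet> ?e - (p \<bullet> J y) * (p \<bullet> ?e) / P\<^sup>2)"
      using P(1) by (simp add: b_def field_simps power2_eq_square)
    also have "\<dots> = D * y $ l"
      unfolding P_def metric_J by (simp add: inner_axis)
    finally show ?thesis .
  qed
  then show "Y (exp_map (hyp_metric \<kappa>) p (J y)) = (2 * cosh_sqrt 1 s) *\<^sub>R y"
    unfolding q_def[symmetric] D[symmetric] by (simp add: vec_eq_iff)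
qed

end

section \<open>Eigenfunctions of the oscillator\<close>

lemma hyp_laplacian_const_scaleR:
  fixes g :: "real ^ 'n::finite \<Rightarrow> 'b::real_normed_vector"
  assumes "Ck 2 g"
  shows "hyp_laplacian \<kappa> (\<lambda>x. r *\<^sub>R g x) x = r *\<^sub>R hyp_laplacian \<kappa> g x"
  unfolding hyp_laplacian_scaleR[OF Ck_const assms]
  by (simp add: hyp_laplacian_def hyp_gradient_product_def laplacian_def partial_deriv_const)

lemma hyp_laplacian_add:
  fixes f g :: "real ^ 'n::finite \<Rightarrow> 'b::real_normed_vector"
  assumes f: "Ck 2 f" and g: "Ck 2 g"
  shows "hyp_laplacian \<kappa> (\<lambda>x. f x + g x) x = hyp_laplacian \<kappa> f x + hyp_laplacian \<kappa> g x"
proof -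
  note df = Ck_2_partials(6,7)[OF f] and dg = Ck_2_partials(6,7)[OF g]
  have p1: "partial_deriv j (\<lambda>x. f x + g x) = (\<lambda>x. partial_deriv j f x + partial_deriv j g x)" for j
    by (rule ext, rule partial_deriv_add[OF df(1) dg(1)])
  have p2: "partial_deriv i (partial_deriv j (\<lambda>x. f x + g x)) x = partial_deriv i (partial_deriv j f) x + partial_deriv i (partial_deriv j g) x" for i j
    unfolding p1 by (rule partial_deriv_add[OF df(2) dg(2)])
  show ?thesis
    unfolding hyp_laplacian_def laplacian_def p2 unfolding p1
    by (simp add: scaleR_add_right sum.distrib)
qed

lemma hyp_laplacian_sum:
  fixes f :: "'j \<Rightarrow> real ^ 'n::finite \<Rightarrow> 'b::real_normed_vector"
  assumes "\<And>j. Ck 2 (f j)"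
  shows "hyp_laplacian \<kappa> (\<lambda>x. \<Sum>j\<in>A. r j *\<^sub>R f j x) x = (\<Sum>j\<in>A. r j *\<^sub>R hyp_laplacian \<kappa> (f j) x)"
proof (induction A rule: infinite_finite_induct)
  case (insert j A)
  have "Ck 2 (\<lambda>x. r j *\<^sub>R f j x)" "Ck 2 (\<lambda>x. \<Sum>j\<in>A. r j *\<^sub>R f j x)"
    by (intro Ck_converges_sum Ck_converges_scaleR Ck_const assms)+
  from hyp_laplacian_add[OF this] insert show ?case
    by (simp add: hyp_laplacian_const_scaleR[OF assms])
qed (simp_all add: hyp_laplacian_def laplacian_def partial_deriv_const)

section \<open>An integrable majorant\<close>

text \<open>The antiderivative \<open>arctan\<close> is bounded; the negative half-line is reflected
  to the positive one.\<close>

lemma nn_integral_inverse_1_plus_square: "(\<integral>\<^sup>+x. ennreal (inverse (1 + x\<^sup>2)) \<partial>lborel) < \<infinity>"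
proof -
  let ?f = "\<lambda>x::real. ennreal (inverse (1 + x\<^sup>2))"
  have 1: "(\<integral>\<^sup>+x. ?f x * indicator {0..} x \<partial>lborel) = ennreal (pi / 2 - arctan 0)"
    by (rule nn_integral_FTC_atLeast[OF _ _ _ tendsto_arctan_at_top]) (auto intro!: DERIV_arctan)
  have "(\<integral>\<^sup>+x. ?f x * indicator {..0} x \<partial>lborel) = (\<integral>\<^sup>+x. ?f x * indicator {0..} x \<partial>lborel)"
    by (subst nn_integral_real_affine[of _ "-1" 0]) (auto simp: indicator_def intro!: nn_integral_cong)
  with 1 have "(\<integral>\<^sup>+x. ?f x * indicator {0..} x + ?f x * indicator {..0} x \<partial>lborel) < \<infinity>"
    by (subst nn_integral_add) (auto simp: less_top)
  moreover have "(\<integral>\<^sup>+x. ?f x \<partial>lborel) \<le> (\<integral>\<^sup>+x. ?f x * indicator {0..} x + ?f x * indicator {..0} x \<partial>lborel)"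
    by (intro nn_integral_mono) (auto simp: indicator_def)
  ultimately show ?thesis by (rule le_less_trans[rotated])
qed

text \<open>Of \<open>CARD('n)\<close> factors \<open>1 + x \<bullet> x\<close>, each dominates
  \<open>1 + (x \<bullet> b)\<^sup>2\<close> for one basis vector \<open>b\<close>, and the integral
  of the product factorizes by Tonelli.\<close>

lemma integrable_inverse_power_1_plus_inner:
  assumes "m \<ge> CARD('n)"
  shows "integrable lborel (\<lambda>x::real^'n::finite. inverse (1 + x \<bullet> x) ^ m)"
proof (rule Bochner_Integration.integrable_bound)
  let ?g = "\<lambda>x::real^'n. \<Prod>b\<in>Basis. inverse (1 + (x \<bullet> b)\<^sup>2)"
  show "integrable lborel ?g"
  proof (rule integrableI_nonneg)
    show "?g \<in> borel_measurable lborel" by measurable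
    show "AE x in lborel. 0 \<le> ?g x" by (intro AE_I2 prod_nonneg) (simp add: add_nonneg_nonneg)
    have "(\<integral>\<^sup>+x. ennreal (?g x) \<partial>lborel) = (\<integral>\<^sup>+x. (\<Prod>b\<in>Basis. ennreal (inverse (1 + (x \<bullet> b)\<^sup>2))) \<partial>(lborel :: (real^'n) measure))"
      by (intro nn_integral_cong prod_ennreal[symmetric]) (simp add: add_nonneg_nonneg)
    also have "\<dots> = (\<Prod>b\<in>(Basis :: (real^'n) set). (\<integral>\<^sup>+x. ennreal (inverse (1 + x\<^sup>2)) \<partial>lborel))"
      by (rule nn_integral_lborel_prod) auto
    also have "\<dots> < \<infinity>"
      using nn_integral_inverse_1_plus_square by (simp add: power_less_top_ennreal)
    finally show "(\<integral>\<^sup>+x. ennreal (?g x) \<partial>lborel) < \<infinity>" .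
  qed
  show "(\<lambda>x::real^'n. inverse (1 + x \<bullet> x) ^ m) \<in> borel_measurable lborel" by measurable
  have "norm (inverse (1 + x \<bullet> x) ^ m) \<le> norm (?g x)" for x :: "real^'n"
  proof -
    have pos: "1 + x \<bullet> x \<ge> 1" by simp
    have "inverse (1 + x \<bullet> x) ^ m \<le> inverse (1 + x \<bullet> x) ^ CARD('n)"
      using assms pos by (intro power_decreasing) (auto simp: inverse_le_1_iff)
    also have "\<dots> = (\<Prod>b\<in>(Basis :: (real^'n) set). inverse (1 + x \<bullet> x))"
      by simp
    also have "\<dots> \<le> ?g x"
    proof (intro prod_mono conjI)
      fix b :: "real^'n" assume b: "b \<in> Basis"
      have "(x \<bullet> b)\<^sup>2 \<le> (x \<bullet> x) * (b \<bullet> b)" by (rule Cauchy_Schwarz_ineq)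
      then have "1 + (x \<bullet> b)\<^sup>2 \<le> 1 + x \<bullet> x" using b by simp
      then show "inverse (1 + x \<bullet> x) \<le> inverse (1 + (x \<bullet> b)\<^sup>2)"
        by (intro le_imp_inverse_le) (auto simp: add_pos_nonneg)
    qed (simp add: add_nonneg_nonneg)
    finally show ?thesis using pos by (simp add: abs_of_nonneg)
  qed
  then show "AE x in lborel. norm (inverse (1 + x \<bullet> x) ^ m) \<le> norm (?g x)" by simp
qed

section \<open>The eigenfunctions\<close>

context hyp_frame
begin

text \<open>\<open>\<mu>\<close> will be the square root of the eigenvalue; its powers undo, degree
  by degree, the factor \<open>inverse \<mu>\<close> in the rescaled argument.\<close>

definition eigenfunction :: "real \<Rightarrow> nat \<Rightarrow> (real ^ 'n \<Rightarrow> 'b::euclidean_space) \<Rightarrow> real ^ 'n \<Rightarrow> 'b" where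
  "eigenfunction \<mu> N u x = (\<Sum>j<N + 2. (oscillator_weight CARD('n) N j * \<mu> ^ j) *\<^sub>R
     (inverse (\<tau> x) ^ (N\<^sup>2 + j) *\<^sub>R taylor_term j u (Y x)))"

lemma Ck_eigenfunction_term: "Ck k (\<lambda>x. inverse (\<tau> x) ^ m *\<^sub>R taylor_term j u (Y x))"
proof -
  have "Ck k (\<lambda>x. Y x $ l)" for l
    unfolding Y_component by (rule Ck_Y_coord)
  then show ?thesis
    by (rule Ck_converges_scaleR[OF Ck_converges_power[OF Ck_converges_inverse[OF \<tau>_pos \<tau>_pos Ck_\<tau>]]
          Ck_compose_vec[where Y = Y, OF Ck_taylor_term]])
qed

lemma Ck_eigenfunction: "Ck k (eigenfunction \<mu> N u)"
  unfolding eigenfunction_def[abs_def]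
  by (intro Ck_converges_sum Ck_converges_scaleR[OF Ck_const] Ck_eigenfunction_term)

text \<open>Apart from the eigenvalue term, degree \<open>j\<close> leaves a flat Laplacian and an
  error \<open>E j\<close>. The Laplacian of degree \<open>j + 2\<close> is minus the Taylor term of
  degree \<open>j\<close>, and the weights make it cancel \<open>E j\<close>. Nothing is left to
  cancel \<open>E N\<close> and \<open>E (N + 1)\<close>: the first is 0 by the relation between
  \<open>\<alpha>\<close> and \<open>\<kappa>\<close>, the second by parity.\<close>

lemma eigenfunction_equation:
  fixes u :: "real ^ 'n \<Rightarrow> 'b::euclidean_space"
  assumes u: "helmholtz u" and parity: "\<And>y. taylor_term (N + 1) u y = 0"
    and N: "N > 0" and \<alpha>: "\<alpha> = \<kappa> ^ 4 * (real (N\<^sup>2 + N) * real (N\<^sup>2 + N + 1))"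
    and \<mu>: "\<mu>\<^sup>2 = \<kappa>\<^sup>2 * oscillator_scale CARD('n) N"
  shows "harmonic_oscillator \<alpha> \<kappa> p (eigenfunction \<mu> N u) x = \<mu>\<^sup>2 *\<^sub>R eigenfunction \<mu> N u x"
proof -
  let ?d = "real CARD('n)" and ?a = "real (N\<^sup>2)" and ?T = "\<lambda>j. taylor_term j u (Y x)"
  define i where "i = inverse (\<tau> x)"
  define c where "c j = oscillator_weight CARD('n) N j * \<mu> ^ j" for j
  \<comment> \<open>The value of \<open>m N\<close>; by the assumption on \<open>\<alpha>\<close>
    the potential term is \<open>\<kappa>\<^sup>2 * M * (1 - i\<^sup>2)\<close>.\<close>
  define M where "M = real (N\<^sup>2 + N) * real (N\<^sup>2 + N + 1)"
  define m where "m j = real (N\<^sup>2 + j) * real (Suc (N\<^sup>2 + j))" for j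
  define D where "D = oscillator_scale CARD('n) N"
  define \<Delta> where "\<Delta> j = laplacian (taylor_term j u) (Y x)" for j
  define E where "E j = (c j * (\<kappa>\<^sup>2 * (m j - M) * i ^ (N\<^sup>2 + j + 2))) *\<^sub>R ?T j" for j
  have Dpos: "D > 0" using N unfolding D_def oscillator_scale_def by (simp add: add_nonneg_pos)
  have D: "D = (2 * real N + ?d) * ?a + real N * (real N + 1)"
    by (simp add: D_def oscillator_scale_def algebra_simps)
  \<comment> \<open>In every degree potential and Laplacian together produce this multiple of
    \<open>\<kappa>\<^sup>2\<close>, which is the eigenvalue.\<close>
  have lam: "M - ?a * (?a + 1 - ?d) = D"
    unfolding M_def D by (simp add: algebra_simps power2_eq_square)
  have summand: "(- c j) *\<^sub>R hyp_laplacian \<kappa> (\<lambda>x. inverse (\<tau> x) ^ (N\<^sup>2 + j) *\<^sub>R taylor_term j u (Y x)) x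
      + (\<kappa>\<^sup>2 * M * (1 - i\<^sup>2)) *\<^sub>R (c j *\<^sub>R (i ^ (N\<^sup>2 + j) *\<^sub>R ?T j))
      = \<mu>\<^sup>2 *\<^sub>R (c j *\<^sub>R (i ^ (N\<^sup>2 + j) *\<^sub>R ?T j)) + (- c j * i ^ (N\<^sup>2 + j)) *\<^sub>R \<Delta> j + E j" for j
  proof -
    define I where "I = i ^ (N\<^sup>2 + j)"
    have I2: "i ^ (N\<^sup>2 + j + 2) = I * i\<^sup>2" by (simp only: I_def power_add)
    have "real (N\<^sup>2 + j) - real j = ?a" by simp
    then have "(- c j) *\<^sub>R hyp_laplacian \<kappa> (\<lambda>x. inverse (\<tau> x) ^ (N\<^sup>2 + j) *\<^sub>R taylor_term j u (Y x)) x
      = (- c j * I) *\<^sub>R \<Delta> j + (- c j * (\<kappa>\<^sup>2 * (?a * (?a + 1 - ?d) * I - m j * (I * i\<^sup>2)))) *\<^sub>R ?T j"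
      unfolding hyp_laplacian_taylor_term[OF u] i_def[symmetric] I2 I_def[symmetric] m_def[symmetric] \<Delta>_def[symmetric]
      by (simp only: scaleR_add_right scaleR_scaleR)
    moreover have "- c j * (\<kappa>\<^sup>2 * (?a * (?a + 1 - ?d) * I - m j * (I * i\<^sup>2))) + \<kappa>\<^sup>2 * M * (1 - i\<^sup>2) * (c j * I)
      = \<kappa>\<^sup>2 * (M - ?a * (?a + 1 - ?d)) * (c j * I) + c j * (\<kappa>\<^sup>2 * (m j - M) * (I * i\<^sup>2))"
      by (simp add: algebra_simps)
    ultimately show ?thesis
      unfolding I_def[symmetric] E_def I2 \<mu> D_def[symmetric] lam[symmetric] scaleR_scaleR
      by (simp only: scaleR_add_left[symmetric] add.assoc add.left_commute[of _ "(- c j * I) *\<^sub>R \<Delta> j"] mult.assoc)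
  qed
  have shift: "(- c (j + 2) * i ^ (N\<^sup>2 + (j + 2))) *\<^sub>R \<Delta> (j + 2) = - E j" if "j < N" for j
  proof -
    have "c (j + 2) = real ((N - j) * (2 * N\<^sup>2 + N + j + 1)) / D * (\<kappa>\<^sup>2 * D) * c j"
    proof -
      have "oscillator_weight CARD('n) N (j + 2) =
          real ((N - j) * (2 * N\<^sup>2 + N + j + 1)) / D * oscillator_weight CARD('n) N j"
        by (simp only: add_2_eq_Suc' oscillator_weight.simps D_def oscillator_scale_def)
      moreover have "\<mu> ^ (j + 2) = \<kappa>\<^sup>2 * D * \<mu> ^ j"
        unfolding D_def \<mu>[symmetric] by (simp add: power2_eq_square)
      ultimately show ?thesis
        unfolding c_def by (simp only: mult_ac)
    qed
    also have "\<dots> = \<kappa>\<^sup>2 * ((real N - real j) * (2 * ?a + real N + real j + 1)) * c j"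
    proof -
      have "real ((N - j) * (2 * N\<^sup>2 + N + j + 1)) = (real N - real j) * (2 * ?a + real N + real j + 1)"
        unfolding of_nat_mult using that by (simp add: of_nat_diff)
      then show ?thesis using Dpos by simp
    qed
    \<comment> \<open>The factor in the recursion of the weights is a difference of two products
      \<open>(a + k) * (a + k + 1)\<close>, for \<open>k = N\<close> and
      \<open>k = j\<close>.\<close>
    also have "(real N - real j) * (2 * ?a + real N + real j + 1) = M - m j"
      unfolding M_def m_def by (simp add: algebra_simps power2_eq_square)
    finally have cc: "c (j + 2) = \<kappa>\<^sup>2 * (M - m j) * c j" .
    have "\<Delta> (j + 2) = - ?T j"
      unfolding \<Delta>_def using laplacian_taylor_term(1)[OF u] by simp
    then show ?thesis
      unfolding E_def cc by (simp add: algebra_simps flip: scaleR_minus_left)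
  qed
  have "E N = 0" by (simp add: E_def m_def M_def)
  moreover have "E (N + 1) = 0" unfolding E_def parity by simp
  ultimately have E2: "(\<Sum>j<N + 2. E j) = (\<Sum>j<N. E j)"
    by simp
  \<comment> \<open>Taylor terms of degree 0 and 1 are harmonic, so the sum may start at 2.\<close>
  have "(\<Sum>j<N + 2. (- c j * i ^ (N\<^sup>2 + j)) *\<^sub>R \<Delta> j) = (\<Sum>j<N. (- c (j + 2) * i ^ (N\<^sup>2 + (j + 2))) *\<^sub>R \<Delta> (j + 2))"
  proof -
    have "\<Delta> 0 = 0" "\<Delta> 1 = 0"
      unfolding \<Delta>_def using laplacian_taylor_term(2,3)[OF u] by simp_all
    moreover have "(\<Sum>j<N + 2. g j) = g 0 + (g 1 + (\<Sum>j<N. g (j + 2)))" for g :: "nat \<Rightarrow> 'b"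
      by (simp only: add_2_eq_Suc' sum.lessThan_Suc_shift) simp
    ultimately show ?thesis by (simp only: scaleR_zero_right add_0)
  qed
  also have "\<dots> = - (\<Sum>j<N. E j)"
    unfolding sum_negf[symmetric] by (intro sum.cong refl shift) simp
  finally have \<Delta>s: "(\<Sum>j<N + 2. (- c j * i ^ (N\<^sup>2 + j)) *\<^sub>R \<Delta> j) + (\<Sum>j<N + 2. E j) = 0"
    unfolding E2 by simp
  have pot: "\<alpha> * harmonic_potential \<kappa> p x = \<kappa>\<^sup>2 * M * (1 - i\<^sup>2)"
    unfolding harmonic_potential_eq \<alpha> M_def[symmetric] i_def using \<kappa> by (simp add: power2_eq_square power4_eq_xxxx)
  have ef: "eigenfunction \<mu> N u x = (\<Sum>j<N + 2. c j *\<^sub>R (i ^ (N\<^sup>2 + j) *\<^sub>R ?T j))"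
    by (simp add: eigenfunction_def c_def i_def)
  have lb: "laplace_beltrami (hyp_metric \<kappa>) (eigenfunction \<mu> N u) x =
      (\<Sum>j<N + 2. c j *\<^sub>R hyp_laplacian \<kappa> (\<lambda>x. inverse (\<tau> x) ^ (N\<^sup>2 + j) *\<^sub>R taylor_term j u (Y x)) x)"
    unfolding laplace_beltrami_hyp_metric[OF \<kappa> Ck_eigenfunction]
    unfolding eigenfunction_def[abs_def] c_def by (rule hyp_laplacian_sum[OF Ck_eigenfunction_term])
  have "harmonic_oscillator \<alpha> \<kappa> p (eigenfunction \<mu> N u) x =
    (\<Sum>j<N + 2. (- c j) *\<^sub>R hyp_laplacian \<kappa> (\<lambda>x. inverse (\<tau> x) ^ (N\<^sup>2 + j) *\<^sub>R taylor_term j u (Y x)) x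
      + (\<kappa>\<^sup>2 * M * (1 - i\<^sup>2)) *\<^sub>R (c j *\<^sub>R (i ^ (N\<^sup>2 + j) *\<^sub>R ?T j)))"
    unfolding harmonic_oscillator_def lb pot ef sum.distrib scaleR_sum_right by (simp only: sum_negf[symmetric] scaleR_minus_left)
  also have "\<dots> = \<mu>\<^sup>2 *\<^sub>R eigenfunction \<mu> N u x + ((\<Sum>j<N + 2. (- c j * i ^ (N\<^sup>2 + j)) *\<^sub>R \<Delta> j) + (\<Sum>j<N + 2. E j))"
    unfolding summand ef sum.distrib scaleR_sum_right by (simp only: add.assoc)
  finally show ?thesis unfolding \<Delta>s by simp
qed

text \<open>The ratio \<open>\<kappa>\<^sup>2 / \<mu>\<^sup>2\<close> is the inverse scale, so
  \<open>\<kappa>\<close> disappears; homogeneity of the Taylor terms absorbs the powers of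
  \<open>\<mu>\<close> and the degree-dependent powers of \<open>\<tau>\<close>.\<close>

lemma eigenfunction_exp_map:
  fixes u :: "real ^ 'n \<Rightarrow> 'b::euclidean_space"
  assumes \<mu>: "\<mu>\<^sup>2 = \<kappa>\<^sup>2 * oscillator_scale CARD('n) N" "\<mu> > 0"
  shows "eigenfunction \<mu> N u (exp_map (hyp_metric \<kappa>) p (J (inverse \<mu> *\<^sub>R x))) = rescaled_eigenfunction N u x"
proof -
  define s where "s = inverse (oscillator_scale CARD('n) N) * (x \<bullet> x)"
  have "\<kappa>\<^sup>2 * ((inverse \<mu> *\<^sub>R x) \<bullet> (inverse \<mu> *\<^sub>R x)) = \<kappa>\<^sup>2 / \<mu>\<^sup>2 * (x \<bullet> x)"
    by (simp add: power2_eq_square divide_inverse)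
  also have "\<dots> = s"
    unfolding \<mu>(1) s_def using \<kappa> by (simp add: divide_inverse)
  finally have s: "\<kappa>\<^sup>2 * ((inverse \<mu> *\<^sub>R x) \<bullet> (inverse \<mu> *\<^sub>R x)) = s" .
  define q where "q = inverse (cosh_sqrt 0 s)"
  define h where "h = 2 * cosh_sqrt 1 s"
  have "(oscillator_weight CARD('n) N j * \<mu> ^ j) *\<^sub>R (q ^ (N\<^sup>2 + j) *\<^sub>R taylor_term j u (h *\<^sub>R inverse \<mu> *\<^sub>R x))
      = q ^ N\<^sup>2 *\<^sub>R (oscillator_weight CARD('n) N j *\<^sub>R taylor_term j u ((h * q) *\<^sub>R x))" for j
  proof -
    have "\<mu> ^ j * inverse \<mu> ^ j = 1"
      using \<mu>(2) by (simp flip: power_mult_distrib)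
    then have "oscillator_weight CARD('n) N j * \<mu> ^ j * (q ^ (N\<^sup>2 + j) * (h * inverse \<mu>) ^ j) =
        q ^ N\<^sup>2 * (oscillator_weight CARD('n) N j * (h * q) ^ j)"
      by (simp add: power_add power_mult_distrib mult_ac)
    then show ?thesis
      unfolding taylor_term_scaleR scaleR_scaleR by (simp only: mult.assoc)
  qed
  then show ?thesis
    unfolding eigenfunction_def exp_map_coordinates s rescaled_eigenfunction_def s_def[symmetric] Let_def
      q_def[symmetric] h_def[symmetric] scaleR_sum_right by simp
qed

text \<open>In the variable \<open>Y / \<tau>\<close>, which is bounded as in the projective ball
  model, the sum is a polynomial; all decay comes from the common factor
  \<open>inverse (\<tau> x) ^ N\<^sup>2\<close>.\<close>

lemma eigenfunction_bound:
  obtains K where "K \<ge> 0" "\<And>x. norm (eigenfunction \<mu> N u x) \<le> K * inverse (hyp_height \<kappa> x) ^ N\<^sup>2"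
proof -
  \<comment> \<open>By Cauchy-Schwarz \<open>\<tau>\<close> is at least \<open>c\<close> times the
    height; \<open>c\<close> is positive because the lift of \<open>p\<close> is timelike.\<close>
  define c where "c = \<kappa>\<^sup>2 * (hyp_height \<kappa> p - norm p)"
  have "norm p < hyp_height \<kappa> p"
    unfolding hyp_height_def norm_eq_sqrt_inner using \<kappa> by simp
  then have c: "c > 0" using \<kappa> by (simp add: c_def)
  have S: "hyp_height \<kappa> x > 0" "norm x \<le> hyp_height \<kappa> x" for x :: "real ^ 'n"
    using hyp_height_props(1)[OF \<kappa>] by (auto simp: hyp_height_def norm_eq_sqrt_inner)
  have \<tau>: "\<tau> x \<ge> c * hyp_height \<kappa> x" for x
  proof -
    have "x \<bullet> p \<le> hyp_height \<kappa> x * norm p"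
      using norm_cauchy_schwarz[of x p] mult_right_mono[OF S(2)[of x] norm_ge_zero[of p]] by linarith
    then have "\<kappa>\<^sup>2 * (hyp_height \<kappa> x * hyp_height \<kappa> p - hyp_height \<kappa> x * norm p) \<le> \<tau> x"
      unfolding \<tau>_eq by (intro mult_left_mono) auto
    then show ?thesis by (simp add: c_def algebra_simps)
  qed
  define B where "B = (\<Sum>l\<in>UNIV. norm (J (axis l 1)) + \<bar>(p \<bullet> J (axis l 1)) / hyp_height \<kappa> p\<bar>)"
  have Y: "norm (Y x) \<le> B * hyp_height \<kappa> x" for x
  proof -
    have "norm (Y x) \<le> (\<Sum>l\<in>UNIV. \<bar>Y x $ l\<bar>)" by (rule norm_le_l1_cart)
    also have "\<dots> \<le> (\<Sum>l\<in>UNIV. (norm (J (axis l 1)) + \<bar>(p \<bullet> J (axis l 1)) / hyp_height \<kappa> p\<bar>) * hyp_height \<kappa> x)"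
    proof (rule sum_mono)
      fix l
      have "\<bar>Y x $ l\<bar> \<le> \<bar>J (axis l 1) \<bullet> x\<bar> + \<bar>(p \<bullet> J (axis l 1)) / hyp_height \<kappa> p\<bar> * hyp_height \<kappa> x"
      proof -
        define b where "b = (p \<bullet> J (axis l 1)) / hyp_height \<kappa> p"
        have "\<bar>Y x $ l\<bar> = \<bar>J (axis l 1) \<bullet> x - b * hyp_height \<kappa> x\<bar>"
          by (simp add: Y_def Y_coord_def ambient_linear_def b_def)
        also have "\<dots> \<le> \<bar>J (axis l 1) \<bullet> x\<bar> + \<bar>b\<bar> * hyp_height \<kappa> x"
          using abs_triangle_ineq4[of "J (axis l 1) \<bullet> x" "b * hyp_height \<kappa> x"] S(1)[of x] by (simp add: abs_mult)
        finally show ?thesis unfolding b_def .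
      qed
      also have "\<bar>J (axis l 1) \<bullet> x\<bar> \<le> norm (J (axis l 1)) * hyp_height \<kappa> x"
        using Cauchy_Schwarz_ineq2[of "J (axis l 1)" x] mult_left_mono[OF S(2)[of x] norm_ge_zero[of "J (axis l 1)"]] by linarith
      finally show "\<bar>Y x $ l\<bar> \<le> (norm (J (axis l 1)) + \<bar>(p \<bullet> J (axis l 1)) / hyp_height \<kappa> p\<bar>) * hyp_height \<kappa> x"
        by (simp add: algebra_simps)
    qed
    finally show ?thesis by (simp add: B_def sum_distrib_right)
  qed
  define g where "g z = (\<Sum>j<N + 2. (oscillator_weight CARD('n) N j * \<mu> ^ j) *\<^sub>R taylor_term j u z)" for z
  have "continuous_on (cball 0 (B / c)) g"
    unfolding g_def by (intro continuous_intros continuous_on_subset[OF Ck_continuous[OF Ck_taylor_term]]) auto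
  then have "compact (g ` cball 0 (B / c))" by (intro compact_continuous_image) auto
  from compact_imp_bounded[OF this] obtain K where "\<forall>z\<in>g ` cball 0 (B / c). norm z \<le> K"
    unfolding bounded_iff by blast
  then have K: "norm (g z) \<le> \<bar>K\<bar>" if "norm z \<le> B / c" for z
    using that by force
  have "norm (eigenfunction \<mu> N u x) \<le> (\<bar>K\<bar> * inverse c ^ N\<^sup>2) * inverse (hyp_height \<kappa> x) ^ N\<^sup>2" for x
  proof -
    have i0: "inverse (\<tau> x) \<ge> 0" using \<tau>_pos[of x] by simp
    have i: "inverse (\<tau> x) \<le> inverse (c * hyp_height \<kappa> x)"
      using \<tau>[of x] c S(1)[of x] by (intro le_imp_inverse_le) auto
    have B0: "B \<ge> 0" unfolding B_def by (intro sum_nonneg) auto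
    have "norm (inverse (\<tau> x) *\<^sub>R Y x) \<le> inverse (c * hyp_height \<kappa> x) * (B * hyp_height \<kappa> x)"
      unfolding norm_scaleR abs_of_nonneg[OF i0] using i order_trans[OF i0 i] Y[of x] by (intro mult_mono) auto
    also have "\<dots> = B / c" using c S(1)[of x] by (simp add: divide_inverse)
    finally have z: "norm (inverse (\<tau> x) *\<^sub>R Y x) \<le> B / c" .
    have "eigenfunction \<mu> N u x = inverse (\<tau> x) ^ N\<^sup>2 *\<^sub>R g (inverse (\<tau> x) *\<^sub>R Y x)"
      unfolding eigenfunction_def g_def taylor_term_scaleR scaleR_sum_right
      by (intro sum.cong refl) (simp add: power_add mult_ac)
    then have "norm (eigenfunction \<mu> N u x) = inverse (\<tau> x) ^ N\<^sup>2 * norm (g (inverse (\<tau> x) *\<^sub>R Y x))"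
      using i0 by simp
    also have "\<dots> \<le> inverse (c * hyp_height \<kappa> x) ^ N\<^sup>2 * \<bar>K\<bar>"
      using i i0 order_trans[OF i0 i] by (intro mult_mono power_mono K z zero_le_power) auto
    finally show ?thesis by (simp add: power_mult_distrib mult_ac)
  qed
  then show thesis using that[of "\<bar>K\<bar> * inverse c ^ N\<^sup>2"] c by simp
qed

text \<open>The volume density is at most 1, and the square of the norm is bounded by a multiple of
  \<open>inverse (1 + x \<bullet> x) ^ N\<^sup>2\<close>.\<close>

lemma integrable_eigenfunction:
  assumes N: "N\<^sup>2 \<ge> CARD('n)"
  shows "integrable (riemannian_volume (hyp_metric \<kappa>)) (\<lambda>x. (norm (eigenfunction \<mu> N u x))\<^sup>2)"
proof -
  obtain K where K: "K \<ge> 0" "\<And>x. norm (eigenfunction \<mu> N u x) \<le> K * inverse (hyp_height \<kappa> x) ^ N\<^sup>2"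
    using eigenfunction_bound[of \<mu> N u] by blast
  let ?Q = "\<lambda>x :: real ^ 'n. 1 + \<kappa>\<^sup>2 * (x \<bullet> x)"
  have Q: "?Q x \<ge> 1" for x :: "real ^ 'n" by simp
  have sd: "sqrt (det (hyp_metric \<kappa> x)) = 1 / sqrt (?Q x)" for x :: "real ^ 'n"
    by (simp add: det_hyp_metric[OF \<kappa>] real_sqrt_divide)
  \<comment> \<open>The constant that compares the square of the height with
    \<open>1 + x \<bullet> x\<close>.\<close>
  define k where "k = min 1 (1 / \<kappa>\<^sup>2)"
  have k: "k > 0" "k \<le> 1" "k \<le> 1 / \<kappa>\<^sup>2" using \<kappa> by (auto simp: k_def)
  have ce: "continuous_on UNIV (eigenfunction \<mu> N u)"
    by (rule Ck_continuous[OF Ck_eigenfunction])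
  then have [measurable]: "eigenfunction \<mu> N u \<in> borel_measurable borel"
    by (rule borel_measurable_continuous_onI)
  have "integrable lborel (\<lambda>x. (1 / sqrt (?Q x)) *\<^sub>R (norm (eigenfunction \<mu> N u x))\<^sup>2)"
  proof (rule Bochner_Integration.integrable_bound)
    show "integrable lborel (\<lambda>x :: real ^ 'n. (K\<^sup>2 * inverse k ^ N\<^sup>2) * inverse (1 + x \<bullet> x) ^ N\<^sup>2)"
      by (intro integrable_mult_right integrable_inverse_power_1_plus_inner N)
    show "(\<lambda>x. (1 / sqrt (?Q x)) *\<^sub>R (norm (eigenfunction \<mu> N u x))\<^sup>2) \<in> borel_measurable lborel"
      by measurable
    have "norm ((1 / sqrt (?Q x)) *\<^sub>R (norm (eigenfunction \<mu> N u x))\<^sup>2) \<le> norm ((K\<^sup>2 * inverse k ^ N\<^sup>2) * inverse (1 + x \<bullet> x) ^ N\<^sup>2)" for x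
    proof -
      have h: "hyp_height \<kappa> x > 0" using hyp_height_props(1)[OF \<kappa>] .
      have "k * (1 + x \<bullet> x) \<le> (hyp_height \<kappa> x)\<^sup>2"
        unfolding hyp_height_props(2)[OF \<kappa>] using k(3) mult_right_mono[OF k(2), of "x \<bullet> x"] by (simp add: algebra_simps)
      moreover have "k * (1 + x \<bullet> x) > 0" using k by (simp add: add_pos_nonneg)
      ultimately have i: "inverse ((hyp_height \<kappa> x)\<^sup>2) \<le> inverse (k * (1 + x \<bullet> x))"
        by (rule le_imp_inverse_le)
      have "norm ((1 / sqrt (?Q x)) *\<^sub>R (norm (eigenfunction \<mu> N u x))\<^sup>2) = 1 / sqrt (?Q x) * (norm (eigenfunction \<mu> N u x))\<^sup>2"
        using Q[of x] by simp
      also have "\<dots> \<le> 1 * (K * inverse (hyp_height \<kappa> x) ^ N\<^sup>2)\<^sup>2"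
        using real_sqrt_ge_one[OF Q[of x]] K(2)[of x] by (intro mult_mono power_mono) (auto simp: divide_le_eq)
      also have "\<dots> = K\<^sup>2 * inverse ((hyp_height \<kappa> x)\<^sup>2) ^ N\<^sup>2"
        by (simp add: power_mult_distrib power_mult[symmetric] power_inverse mult.commute)
      also have "\<dots> \<le> K\<^sup>2 * inverse (k * (1 + x \<bullet> x)) ^ N\<^sup>2"
        using i by (intro mult_left_mono power_mono) auto
      also have "\<dots> = (K\<^sup>2 * inverse k ^ N\<^sup>2) * inverse (1 + x \<bullet> x) ^ N\<^sup>2"
        by (simp add: power_mult_distrib)
      finally show ?thesis unfolding real_norm_def by (rule order_trans[OF _ abs_ge_self])
    qed
    then show "AE x in lborel. norm ((1 / sqrt (?Q x)) *\<^sub>R (norm (eigenfunction \<mu> N u x))\<^sup>2) \<le> norm ((K\<^sup>2 * inverse k ^ N\<^sup>2) * inverse (1 + x \<bullet> x) ^ N\<^sup>2)"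
      by simp
  qed
  then show ?thesis
    unfolding riemannian_volume_def sd
    by (subst integrable_density) auto
qed

end

section \<open>A standing wave for the case of the zero solution\<close>

text \<open>The phase \<open>t\<close> closes the family under differentiation: a derivative
  advances it by a quarter period.\<close>

lemma has_derivative_cos_component:
  "((\<lambda>x::real^'n::finite. cos (x $ i + t) *\<^sub>R b) has_derivative
    (\<lambda>h. \<Sum>j\<in>UNIV. h $ j *\<^sub>R (if j = i then cos (x $ i + (t + pi / 2)) *\<^sub>R b else 0))) (at x)"
proof -
  have "(\<Sum>j\<in>UNIV. h $ j *\<^sub>R (if j = i then cos (x $ i + (t + pi / 2)) *\<^sub>R b else 0))
      = (h $ i * - sin (x $ i + t)) *\<^sub>R b" for h :: "real ^ 'n"
  proof -
    have "cos (x $ i + (t + pi / 2)) = - sin (x $ i + t)"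
      unfolding add.assoc[symmetric] by (simp add: cos_add)
    then show ?thesis by (simp add: if_distrib[of "(*\<^sub>R) _"] cong: if_cong)
  qed
  then show ?thesis
    by (auto intro!: derivative_eq_intros bounded_linear.has_derivative[OF bounded_linear_vec_nth] simp: fun_eq_iff)
qed

lemma Ck_cos_component: "Ck k (\<lambda>x::real^'n::finite. cos (x $ i + t) *\<^sub>R (b :: 'b::real_normed_vector))"
proof (induction k arbitrary: t)
  case 0
  show ?case unfolding Ck_0 by (intro continuous_intros)
next
  case (Suc k)
  show ?case
  proof (rule Ck_SucI[OF has_derivative_cos_component])
    show "Ck k (\<lambda>x. if j = i then cos (x $ i + (t + pi / 2)) *\<^sub>R b else 0)" for j
      using Suc by (cases "j = i") simp_all
  qed
qed

text \<open>Supplies an even solution that, for nonzero \<open>b\<close>, does not vanish at the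
  origin.\<close>

lemma helmholtz_cos_component:
  "helmholtz (\<lambda>x::real^'n::finite. cos (x $ i) *\<^sub>R (b :: 'b::real_normed_vector))"
proof -
  have pd: "partial_deriv j (\<lambda>x::real^'n. cos (x $ i + t) *\<^sub>R b) =
      (\<lambda>x. if j = i then cos (x $ i + (t + pi / 2)) *\<^sub>R b else 0)" for j t
    by (rule ext) (simp only: partial_deriv_eq[OF has_derivative_cos_component] sum_axis_scaleR)
  have "partial_deriv j (partial_deriv j (\<lambda>x::real^'n. cos (x $ i + 0) *\<^sub>R b)) x =
      (if j = i then - (cos (x $ i) *\<^sub>R b) else 0)" for j x
  proof (cases "j = i")
    case True
    then show ?thesis
      by (simp only: pd refl if_True) (simp flip: add.assoc)
  next
    case False
    then show ?thesis
      by (simp only: pd if_False partial_deriv_const)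
  qed
  then show ?thesis
    using Ck_cos_component[of 2 i 0 b] by (simp add: helmholtz_def laplacian_def)
qed

section \<open>Choice of the parameters\<close>

text \<open>The factor \<open>r\<close> unites the two cases of the theorem: \<open>r = 1\<close>
  for nonzero \<open>v\<close>, and \<open>r = 0\<close> with an auxiliary \<open>u\<close> for the
  zero solution, since an eigenfunction must not vanish identically.\<close>

lemma oscillator_eigenfunction_approximation:
  fixes u :: "real ^ 'n::finite \<Rightarrow> 'b::euclidean_space"
  assumes u: "helmholtz u" and parity: "\<And>x. u (- x) = (- 1) ^ q *\<^sub>R u x" and nz: "u x0 \<noteq> 0"
    and r: "r \<ge> 0" and \<alpha>: "\<alpha> > 0"
    and J: "\<And>\<kappa>. \<kappa> > 0 \<Longrightarrow> tangent_isometry (hyp_metric \<kappa>) (p \<kappa>) (J \<kappa>)"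
    and \<epsilon>: "\<epsilon> > 0" and S: "bounded S"
  shows "\<exists>\<kappa>>0. \<exists>ev>0. \<exists>\<psi> :: real ^ 'n \<Rightarrow> 'b.
           oscillator_eigenfunction \<alpha> \<kappa> (p \<kappa>) ev \<psi> \<and>
           Ck_norm k S
             (\<lambda>x. \<psi> (exp_map (hyp_metric \<kappa>) (p \<kappa>) (J \<kappa> (ev powr (- 1 / 2) *\<^sub>R x))) - r *\<^sub>R u x)
             < ennreal \<epsilon>"
proof -
  \<comment> \<open>Convergent to \<open>r\<close>, and positive even if \<open>r = 0\<close>, so
    that scaling by it keeps eigenfunctions nonzero.\<close>
  define s where "s N = r + inverse (real (Suc N))" for N
  have s: "s \<longlonglongrightarrow> r"
    unfolding s_def using tendsto_add[OF tendsto_const LIMSEQ_inverse_real_of_nat, of r] by simp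
  have spos: "s N > 0" for N
    unfolding s_def using r by (intro add_nonneg_pos) auto
  have "Ck_converges k (\<lambda>N x. s N *\<^sub>R rescaled_eigenfunction N u x) (\<lambda>x. r *\<^sub>R u x)"
    by (rule Ck_converges_scaleR[OF Ck_converges_const[OF s] Ck_converges_rescaled_eigenfunction[OF u]])
  from Ck_converges_eventually_Ck_norm[OF this \<epsilon> S]
  have 1: "\<forall>\<^sub>F N in sequentially. Ck_norm k S (\<lambda>x. s N *\<^sub>R rescaled_eigenfunction N u x - r *\<^sub>R u x) < ennreal \<epsilon>" .
  \<comment> \<open>A nonzero value of \<open>u\<close> persists in the approximations, so the
    eigenfunction does not vanish identically.\<close>
  have "uniform_limit (cball 0 (norm x0)) (\<lambda>N. rescaled_eigenfunction N u) u sequentially"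
    using C0_if_Ck_converges[OF Ck_converges_rescaled_eigenfunction[OF u]] unfolding C0_converges_def by blast
  then have "(\<lambda>N. rescaled_eigenfunction N u x0) \<longlonglongrightarrow> u x0"
    by (rule tendsto_uniform_limitI) simp
  from tendsto_imp_eventually_ne[OF this nz]
  have "\<forall>\<^sub>F N in sequentially. rescaled_eigenfunction N u x0 \<noteq> 0" .
  from eventually_conj[OF 1 this] obtain N0 where N0:
    "\<And>N. N \<ge> N0 \<Longrightarrow> Ck_norm k S (\<lambda>x. s N *\<^sub>R rescaled_eigenfunction N u x - r *\<^sub>R u x) < ennreal \<epsilon>"
    "\<And>N. N \<ge> N0 \<Longrightarrow> rescaled_eigenfunction N u x0 \<noteq> 0"
    unfolding eventually_sequentially by blast
  \<comment> \<open>An even number plus \<open>q\<close>, which makes \<open>q + (N + 1)\<close>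
    odd; large enough for the approximation and for integrability.\<close>
  define N where "N = 2 * (N0 + CARD('n)) + q"
  have N: "N \<ge> N0" "N \<ge> CARD('n)" "N > 0" "odd (q + (N + 1))"
    unfolding N_def using zero_less_card_finite[where 'a = 'n] by (auto simp del: zero_less_card_finite)
  have N2: "N\<^sup>2 \<ge> CARD('n)"
    using N(2,3) by (auto simp: power2_eq_square intro: order_trans[of _ N])
  define A where "A = real (N\<^sup>2 + N) * real (N\<^sup>2 + N + 1)"
  have A: "A > 0" unfolding A_def of_nat_mult[symmetric] of_nat_0_less_iff using N(3) by simp
  \<comment> \<open>Solves \<open>\<alpha> = \<kappa> ^ 4 * A\<close>, the condition of
    \<open>eigenfunction_equation\<close>.\<close>
  define \<kappa> where "\<kappa> = sqrt (sqrt (\<alpha> / A))"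
  have \<kappa>: "\<kappa> > 0" unfolding \<kappa>_def using \<alpha> A by simp
  have "\<kappa> ^ 4 = (\<kappa>\<^sup>2)\<^sup>2" by (simp flip: power_mult)
  also have "\<dots> = \<alpha> / A" unfolding \<kappa>_def using \<alpha> A by simp
  finally have \<kappa>4: "\<alpha> = \<kappa> ^ 4 * A" using A by simp
  interpret hyp_frame \<kappa> "p \<kappa>" "J \<kappa>"
    using \<kappa> J[OF \<kappa>] by unfold_locales
  define \<mu> where "\<mu> = sqrt (\<kappa>\<^sup>2 * oscillator_scale CARD('n) N)"
  have "oscillator_scale CARD('n) N > 0"
    using N(3) unfolding oscillator_scale_def by (simp add: add_nonneg_pos)
  then have \<mu>: "\<mu> > 0" "\<mu>\<^sup>2 = \<kappa>\<^sup>2 * oscillator_scale CARD('n) N"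
    using \<kappa> by (simp_all add: \<mu>_def)
  have powr: "(\<mu>\<^sup>2) powr (- 1 / 2) = inverse \<mu>"
    using \<mu>(1) by (simp add: powr_minus powr_half_sqrt)
  let ?e = "eigenfunction \<mu> N u"
  let ?\<psi> = "\<lambda>x. s N *\<^sub>R ?e x"
  have exp: "?e (exp_map (hyp_metric \<kappa>) (p \<kappa>) (J \<kappa> ((\<mu>\<^sup>2) powr (- 1 / 2) *\<^sub>R x))) = rescaled_eigenfunction N u x" for x
    unfolding powr by (rule eigenfunction_exp_map[OF \<mu>(2,1)])
  have eq: "harmonic_oscillator \<alpha> \<kappa> (p \<kappa>) ?e x = \<mu>\<^sup>2 *\<^sub>R ?e x" for x
    by (rule eigenfunction_equation[OF u taylor_term_parity[OF u parity N(4)] N(3) \<kappa>4[unfolded A_def] \<mu>(2)])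
  have Ck_\<psi>: "Ck m ?\<psi>" for m
    by (rule Ck_converges_scaleR[OF Ck_const Ck_eigenfunction])
  have "oscillator_eigenfunction \<alpha> \<kappa> (p \<kappa>) (\<mu>\<^sup>2) ?\<psi>"
    unfolding oscillator_eigenfunction_def
  proof (intro conjI allI)
    show "\<exists>x. ?\<psi> x \<noteq> 0"
      using N0(2)[OF N(1)] spos[of N] exp[of x0]
      by (intro exI[of _ "exp_map (hyp_metric \<kappa>) (p \<kappa>) (J \<kappa> ((\<mu>\<^sup>2) powr (- 1 / 2) *\<^sub>R x0))"]) simp
    show "Ck_on m UNIV ?\<psi>" for m
      by (rule Ck_imp_Ck_on[OF Ck_\<psi>])
    show "integrable (riemannian_volume (hyp_metric \<kappa>)) (\<lambda>x. (norm (?\<psi> x))\<^sup>2)"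
      unfolding norm_scaleR power_mult_distrib
      by (rule integrable_mult_right[OF integrable_eigenfunction[OF N2]])
    show "harmonic_oscillator \<alpha> \<kappa> (p \<kappa>) ?\<psi> x = \<mu>\<^sup>2 *\<^sub>R ?\<psi> x" for x
    proof -
      have "harmonic_oscillator \<alpha> \<kappa> (p \<kappa>) ?\<psi> x = s N *\<^sub>R harmonic_oscillator \<alpha> \<kappa> (p \<kappa>) ?e x"
        unfolding harmonic_oscillator_def laplace_beltrami_hyp_metric[OF \<kappa> Ck_\<psi>]
          laplace_beltrami_hyp_metric[OF \<kappa> Ck_eigenfunction] hyp_laplacian_const_scaleR[OF Ck_eigenfunction]
        by (simp add: scaleR_add_right scaleR_diff_right mult.commute)
      then show ?thesis unfolding eq by (simp add: mult.commute)
    qed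
  qed
  moreover have "\<mu>\<^sup>2 > 0" using \<mu>(1) by simp
  ultimately show ?thesis
    using \<kappa> N0(1)[OF N(1)] unfolding exp[symmetric] by blast
qed

theorem theorem1p1:
  fixes v :: "real ^ 'n::finite \<Rightarrow> 'b::{real_normed_field, euclidean_space}"
    and \<alpha> \<epsilon> R :: real and k :: nat and c :: "real ^ 'n"
    and p\<^sub>0 :: "real \<Rightarrow> real ^ 'n" and J :: "real \<Rightarrow> real ^ 'n \<Rightarrow> real ^ 'n"
  assumes "CARD('n) \<ge> 2"
    and "\<alpha> > 0"
    and "\<And>\<kappa>. \<kappa> > 0 \<Longrightarrow> tangent_isometry (hyp_metric \<kappa>) (p\<^sub>0 \<kappa>) (J \<kappa>)"
    and "Ck_on 2 UNIV v"
    and "\<And>x. laplacian v x + v x = 0"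
    and "(\<forall>x. v (- x) = v x) \<or> (\<forall>x. v (- x) = - v x)"
    and "\<epsilon> > 0"
    and "R > 0"
  shows "\<exists>\<kappa>>0. \<exists>ev>0. \<exists>\<psi> :: real ^ 'n \<Rightarrow> 'b.
           oscillator_eigenfunction \<alpha> \<kappa> (p\<^sub>0 \<kappa>) ev \<psi> \<and>
           Ck_norm k (ball c R)
             (\<lambda>x. \<psi> (exp_map (hyp_metric \<kappa>) (p\<^sub>0 \<kappa>) (J \<kappa> (ev powr (- 1 / 2) *\<^sub>R x))) - v x)
             < ennreal \<epsilon>"
proof -
  note approx = oscillator_eigenfunction_approximation[OF _ _ _ _ assms(2,3,7) bounded_ball]
  show ?thesis
  proof (cases "\<exists>x0. v x0 \<noteq> 0")
    case True
    then obtain x0 where x0: "v x0 \<noteq> 0" by blast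
    have v: "helmholtz v"
      using Ck_on_UNIV_imp_Ck[OF assms(4)] assms(5) by (simp add: helmholtz_def)
    \<comment> \<open>Evenness and oddness become one hypothesis, with \<open>q = 0\<close> or
      \<open>q = 1\<close>.\<close>
    obtain q where "\<And>x. v (- x) = (- 1) ^ q *\<^sub>R v x"
    proof (cases "\<forall>x. v (- x) = v x")
      case True
      then show thesis using that[of 0] by simp
    next
      case False
      with assms(6) have "\<forall>x. v (- x) = - v x" by blast
      then show thesis using that[of 1] by simp
    qed
    from approx[OF v this x0, of 1 k c R] show ?thesis by simp
  next
    case False
    \<comment> \<open>Any coordinate serves for the auxiliary wave.\<close>
    obtain i :: 'n where True by blast
    have "cos ((0 :: real ^ 'n) $ i) *\<^sub>R (1 :: 'b) \<noteq> 0" by simp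
    \<comment> \<open>Even parity and factor 0: the eigenfunctions attached to the wave are scaled
      down towards the zero solution.\<close>
    from approx[OF helmholtz_cos_component _ this, of 0 0 k c R] show ?thesis
      using False by simp
  qed
qed

end
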